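(* Let $G_1,G_2$ be countable locally finite-by-abelian groups. For each $i\in\{1,2\}$ let $S_i\subset G_i$ be a subset of the smallest possible cardinality among the subsets of $G_i$ that generate a subgroup of locally finite index in $G_i$, and let $H_i=\langle S_i\rangle$. The groups $G_1$ and $G_2$ are coarsely isomorphic if and only if one of the following conditions holds: (1) $r_0(G_1)=r_0(G_2)=\infty$; (2) $r_0(G_1)=r_0(G_2)=0$ and $\phi_{G_1/H_1}=\phi_{G_2/H_2}$; (3) $0<r_0(G_1)=r_0(G_2)<\infty$ and $\phi_{G_1/H_1}=^*\phi_{G_2/H_2}$.
   Context: Here $\omega=\{0,1,2,\dots\}$ and $\Pi$ is the set of prime numbers. A function $f:G\to H$ between groups is a coarse map if for each finite $E\subset G$ there is a finite $D\subset H$ such that $f(xE)\subset f(x)D$ for every $x\in G$. It is a coarse isomorphism if it is bijective and both $f$ and $f^{-1}$ are coarse. Two groups are coarsely isomorphic if there is a coarse isomorphism between them. A group is finite-by-abelian if it contains a finite normal subgroup with abelian quotient group. A group is locally finite-by-abelian if each of its finitely generated subgroups is finite-by-abelian. A subgroup $H$ of a group $G$ has locally finite index in $G$ if for every finite subset $F\subset G$, $H$ has finite index in the subgroup $\langle H\cup F\rangle$. The free rank of $G$ is $r_0(G)=\sup\{n\in\omega:\mathbb Z^n \text{ is isomorphic to a subgroup of } G\}\in\omega\cup\{\infty\}$. For a subgroup $H\subset G$, the index spectrum $\sigma_{G:H}$ is the set of all indexes of $H$ in subgroups $E$ with $H\subset E\subset G$. The factorizing function $\phi_{G/H}:\Pi\to\omega\cup\{\infty\}$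 is $\phi_{G/H}(p)=\sup\{k\in\omega: p^k \text{ divides some finite number } i\in\sigma_{G:H}\}$. Two functions $f,g:\Pi\to\omega\cup\{\infty\}$ are almost equal, written $f=^*g$, if $\sum_{p\in\Pi}|f(p)-g(p)|<\infty$, where $\infty-\infty=0$ and $|\infty-n|=|n-\infty|=\infty$ for $n\in\omega$. *)

theory Defs
  imports
    "HOL-Algebra.Product_Groups"
    "HOL-Algebra.Generated_Groups"
    "HOL-Analysis.Infinite_Sum"
    "HOL-Library.Equipollence"
    "HOL-Library.Extended_Nonnegative_Real"
    "HOL-Computational_Algebra.Primes"
begin

definition coarse_map ::
    "('a, 'c) monoid_scheme \<Rightarrow> ('b, 'd) monoid_scheme \<Rightarrow> ('a \<Rightarrow> 'b) \<Rightarrow> bool" where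
  "coarse_map G H f \<longleftrightarrow>
     f \<in> carrier G \<rightarrow> carrier H \<and>
     (\<forall>E. finite E \<and> E \<subseteq> carrier G \<longrightarrow>
        (\<exists>D. finite D \<and> D \<subseteq> carrier H \<and>
             (\<forall>x\<in>carrier G. f ` (x <#\<^bsub>G\<^esub> E) \<subseteq> f x <#\<^bsub>H\<^esub> D)))"

definition coarse_isomorphism ::
    "('a, 'c) monoid_scheme \<Rightarrow> ('b, 'd) monoid_scheme \<Rightarrow> ('a \<Rightarrow> 'b) \<Rightarrow> bool" where
  "coarse_isomorphism G H f \<longleftrightarrow>
     bij_betw f (carrier G) (carrier H) \<and>
     coarse_map G H f \<and> coarse_map H G (inv_into (carrier G) f)"

definition coarsely_isomorphic ::
    "('a, 'c) monoid_scheme \<Rightarrow> ('b, 'd) monoid_scheme \<Rightarrow> bool" where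
  "coarsely_isomorphic G H \<longleftrightarrow> (\<exists>f. coarse_isomorphism G H f)"

definition finite_by_abelian :: "('a, 'c) monoid_scheme \<Rightarrow> bool" where
  "finite_by_abelian G \<longleftrightarrow>
     group G \<and> (\<exists>N. N \<lhd> G \<and> finite N \<and> comm_group (G Mod N))"

definition locally_finite_by_abelian :: "('a, 'c) monoid_scheme \<Rightarrow> bool" where
  "locally_finite_by_abelian G \<longleftrightarrow>
     group G \<and>
     (\<forall>F. finite F \<and> F \<subseteq> carrier G \<longrightarrow>
        finite_by_abelian (G\<lparr>carrier := generate G F\<rparr>))"

text \<open>The index of \<open>H\<close> in a subgroup \<open>E\<close> of \<open>G\<close> containing \<open>H\<close>; all infinite
  cardinal values are identified with \<open>\<infinity>\<close>.\<close>

definition subgroup_index ::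
    "('a, 'c) monoid_scheme \<Rightarrow> 'a set \<Rightarrow> 'a set \<Rightarrow> enat" where
  "subgroup_index G E H =
     (let C = rcosets\<^bsub>G\<lparr>carrier := E\<rparr>\<^esub> H in if finite C then enat (card C) else \<infinity>)"

definition locally_finite_index :: "('a, 'c) monoid_scheme \<Rightarrow> 'a set \<Rightarrow> bool" where
  "locally_finite_index G H \<longleftrightarrow>
     subgroup H G \<and>
     (\<forall>F. finite F \<and> F \<subseteq> carrier G \<longrightarrow> subgroup_index G (generate G (H \<union> F)) H \<noteq> \<infinity>)"

definition min_locally_finite_index_generators :: "('a, 'c) monoid_scheme \<Rightarrow> 'a set \<Rightarrow> bool" where
  "min_locally_finite_index_generators G S \<longleftrightarrow>
     S \<subseteq> carrier G \<and> locally_finite_index G (generate G S) \<and>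
     (\<forall>T. T \<subseteq> carrier G \<and> locally_finite_index G (generate G T) \<longrightarrow> S \<lesssim> T)"

definition free_rank :: "('a, 'c) monoid_scheme \<Rightarrow> enat" where
  "free_rank G =
     Sup {enat n | n. \<exists>K. subgroup K G \<and>
            product_group {..<n} (\<lambda>_. integer_group) \<cong> G\<lparr>carrier := K\<rparr>}"

definition index_spectrum :: "('a, 'c) monoid_scheme \<Rightarrow> 'a set \<Rightarrow> enat set" where
  "index_spectrum G H = {subgroup_index G E H | E. subgroup E G \<and> H \<subseteq> E}"

definition factorizing_function :: "('a, 'c) monoid_scheme \<Rightarrow> 'a set \<Rightarrow> nat \<Rightarrow> enat" where
  "factorizing_function G H p =
     Sup {enat k | k. \<exists>i::nat. enat i \<in> index_spectrum G H \<and> p ^ k dvd i}"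

text \<open>The convention \<open>\<infinity> - \<infinity> = 0\<close> differs from subtraction on \<^typ>\<open>enat\<close>.\<close>

definition enat_dist :: "enat \<Rightarrow> enat \<Rightarrow> enat" where
  "enat_dist a b = (if a = b then 0 else max (a - b) (b - a))"

text \<open>Functions on the set of primes are represented by functions on \<^typ>\<open>nat\<close> of which
  only the values at primes matter. Infinite sums in \<^typ>\<open>ennreal\<close> always exist.\<close>

definition equal_on_primes :: "(nat \<Rightarrow> enat) \<Rightarrow> (nat \<Rightarrow> enat) \<Rightarrow> bool" where
  "equal_on_primes f g \<longleftrightarrow> (\<forall>p. Factorial_Ring.prime p \<longrightarrow> f p = g p)"

definition almost_equal_on_primes :: "(nat \<Rightarrow> enat) \<Rightarrow> (nat \<Rightarrow> enat) \<Rightarrow> bool" where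
  "almost_equal_on_primes f g \<longleftrightarrow>
     (\<Sum>\<^sub>\<infinity>p\<in>{p. Factorial_Ring.prime p}. ennreal_of_enat (enat_dist (f p) (g p))) < \<infinity>"

end

(* A coarse chart of a subgroup K of G is a bijection, coarse in both directions, from K onto the
   finitely supported integer families with prescribed coordinate ranges (all integers or a finite
   set). Two groups with charts onto the same family space are coarsely isomorphic.

   Charts are extended along a chain of finitely generated subgroups with the help of transversals,
   using that finitely generated subgroups are finite-by-abelian and hence have finite conjugacy
   classes. A finite index step adds coordinates {0..<p} for the prime factors p of the index; an
   infinite cyclic step adds one integer coordinate, which absorbs any further finite index. So G is
   modelled by r_0(G) integer coordinates together with phi(p) copies of {0..<p} for each prime p; a
   single integer coordinate can swallow finitely many finite ones, and in infinite rank all of them.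

   Conversely, counting lattice points in boxes shows that the free rank is a coarse invariant.
   If f is a coarse isomorphism, one may enlarge H_2 by a finite index so that f maps cosets of H_1
   into cosets of H_2. By amenability the number c of cosets of H_1 over a coset of H_2 is constant.
   Counting the cosets of H_1 in the preimage of a large finite extension of H_2 then gives
   phi_1(p) <= v_p(c) + phi_2(p), and c = 1 when both H_i are trivial. *)

theory Submission
  imports Defs
begin

section \<open>Coarse charts\<close>

text \<open>A limit of charts along a chain would fail if the constants of coarseness grew with the
  stage. Each extension therefore repeats the old chart on every coset up to a translation in fresh
  coordinates, so that estimates of one finite stage hold in the whole group. Noncommutativity
  enters only when a factor is moved past another one, at the price of finitely many conjugates.
  Minimality of S_i makes the base chart consist of integer coordinates only: it provides as many
  commuting independent elements as there are generators, and counting boxes then forbids a chart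
  with fewer integer coordinates. Hence phi alone accounts for the finite coordinates. A coarse
  isomorphism respects no group structure, so indices cannot be compared algebraically. The
  substitute is the constancy of c: the Folner sets are boxes of the charts, and two fibers are
  compared by a translation. The number c measures the mismatch between H_1 and the enlarged H_2. In
  rank zero both are trivial and there is nothing to enlarge, which gives equality of the functions;
  in positive rank a finite error remains, and an integer coordinate can absorb it.\<close>

definition near :: "'i set \<Rightarrow> int \<Rightarrow> ('i \<Rightarrow> int) \<Rightarrow> ('i \<Rightarrow> int) \<Rightarrow> bool" where
  "near J n x y \<longleftrightarrow> (\<forall>i. \<bar>x i - y i\<bar> \<le> n) \<and> (\<forall>i. i \<notin> J \<longrightarrow> x i = y i)"

text \<open>The direct sum of the coordinate ranges. The range \<open>{0}\<close> encodes an absent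
  coordinate, so charts with different coordinates can share one index type.\<close>

definition fsupp :: "('i \<Rightarrow> int set) \<Rightarrow> ('i \<Rightarrow> int) set" where
  "fsupp C = {x. finite {i. x i \<noteq> 0} \<and> (\<forall>i. x i \<in> C i)}"

text \<open>The second clause is coarseness of \<open>F\<close>, the third coarseness of its
  inverse. Closeness in the group is measured by \<open>inv g \<otimes> h\<close>, in accordance
  with the right multiplications in \<open>coarse_map\<close>. A controlled change in the model
  space needs both a finite set \<open>J\<close> and a bound \<open>n\<close>: with infinitely many
  coordinates a bound alone would leave infinitely many points close to a given one.\<close>

definition coarse_chart ::
    "('a, 'c) monoid_scheme \<Rightarrow> 'a set \<Rightarrow> ('a \<Rightarrow> 'i \<Rightarrow> int) \<Rightarrow> ('i \<Rightarrow> int set) \<Rightarrow> bool" where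
  "coarse_chart G K F C \<longleftrightarrow>
     bij_betw F K (fsupp C) \<and>
     (\<forall>E. finite E \<and> E \<subseteq> K \<longrightarrow>
        (\<exists>J n. finite J \<and> (\<forall>g\<in>K. \<forall>e\<in>E. near J n (F g) (F (g \<otimes>\<^bsub>G\<^esub> e))))) \<and>
     (\<forall>J n. finite J \<longrightarrow>
        (\<exists>E. finite E \<and> E \<subseteq> K \<and>
             (\<forall>g\<in>K. \<forall>h\<in>K. near J n (F g) (F h) \<longrightarrow> inv\<^bsub>G\<^esub> g \<otimes>\<^bsub>G\<^esub> h \<in> E)))"

lemma near_refl: "0 \<le> n \<Longrightarrow> near J n x x"
  by (simp add: near_def)

lemma near_mono: "near J n x y \<Longrightarrow> J \<subseteq> J' \<Longrightarrow> n \<le> n' \<Longrightarrow> near J' n' x y"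
  unfolding near_def by (meson order_trans subsetD)

lemma near_trans: "near J n x y \<Longrightarrow> near J' n' y z \<Longrightarrow> near (J \<union> J') (n + n') x z"
  unfolding near_def by (smt (verit) Un_iff)

lemma near_add:
  "near J n x y \<Longrightarrow> near J' n' x' y' \<Longrightarrow> near (J \<union> J') (n + n') (\<lambda>i. x i + x' i) (\<lambda>i. y i + y' i)"
  unfolding near_def by (smt (verit) Un_iff)

lemma near_uniform:
  assumes "finite A" and "\<And>a. a \<in> A \<Longrightarrow> \<exists>J n. finite J \<and> (\<forall>b\<in>B. near J n (x a b) (y a b))"
  shows "\<exists>J n. finite J \<and> (\<forall>a\<in>A. \<forall>b\<in>B. near J n (x a b) (y a b))"
  using assms
proof (induction A rule: finite_induct)
  case empty
  then show ?case by auto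
next
  case (insert a A)
  obtain J n where 1: "finite J" "\<forall>a\<in>A. \<forall>b\<in>B. near J n (x a b) (y a b)"
    using insert by blast
  obtain J' n' where 2: "finite J'" "\<forall>b\<in>B. near J' n' (x a b) (y a b)"
    using insert.prems[of a] by blast
  show ?case
    using 1 2 near_mono[of J n _ _ "J \<union> J'" "max n n'"] near_mono[of J' n' _ _ "J \<union> J'" "max n n'"]
    by (intro exI[of _ "J \<union> J'"] exI[of _ "max n n'"]) auto
qed

lemma near_pair:
  assumes "finite {i. x i \<noteq> (0::int)}" "finite {i. y i \<noteq> 0}"
  shows "\<exists>J n. finite J \<and> near J n x y"
proof -
  define J where "J = {i. x i \<noteq> 0} \<union> {i. y i \<noteq> 0}"
  have J: "finite J" using assms by (simp add: J_def)
  have "\<bar>x i - y i\<bar> \<le> (\<Sum>i\<in>J. \<bar>x i - y i\<bar>)" if "i \<in> J" for i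
    using member_le_sum[OF that _ J, of "\<lambda>i. \<bar>x i - y i\<bar>"] by simp
  moreover have "x i = y i" if "i \<notin> J" for i
    using that by (simp add: J_def)
  moreover have "0 \<le> (\<Sum>i\<in>J. \<bar>x i - y i\<bar>)" by (simp add: sum_nonneg)
  ultimately have "near J (\<Sum>i\<in>J. \<bar>x i - y i\<bar>) x y"
    unfolding near_def by (metis abs_zero cancel_comm_monoid_add_class.diff_cancel)
  then show ?thesis using J by blast
qed

lemma coarse_chartD:
  assumes "coarse_chart G K F C"
  shows "bij_betw F K (fsupp C)"
    and "finite E \<Longrightarrow> E \<subseteq> K \<Longrightarrow> \<exists>J n. finite J \<and> (\<forall>g\<in>K. \<forall>e\<in>E. near J n (F g) (F (g \<otimes>\<^bsub>G\<^esub> e)))"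
    and "finite J \<Longrightarrow> \<exists>E. finite E \<and> E \<subseteq> K \<and>
             (\<forall>g\<in>K. \<forall>h\<in>K. near J n (F g) (F h) \<longrightarrow> inv\<^bsub>G\<^esub> g \<otimes>\<^bsub>G\<^esub> h \<in> E)"
  using assms by (simp_all add: coarse_chart_def)

text \<open>Right multiplication by a finite set moves coordinates in a controlled way by the
  forward estimate of \<open>F\<close>; the backward estimate of \<open>F'\<close> converts this
  into a finite set of displacements in \<open>H\<close>.\<close>

lemma coarse_map_of_charts:
  assumes "group G" "group H"
    and F: "coarse_chart G (carrier G) F C" and F': "coarse_chart H (carrier H) F' C"
  shows "coarse_map G H (inv_into (carrier H) F' \<circ> F)"
proof -
  interpret G: group G by fact
  interpret H: group H by fact
  define f where "f = inv_into (carrier H) F' \<circ> F"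
  note b = coarse_chartD(1)[OF F] and b' = coarse_chartD(1)[OF F']
  have f: "f x \<in> carrier H \<and> F' (f x) = F x" if "x \<in> carrier G" for x
  proof -
    have "F x \<in> F' ` carrier H"
      using that b b' by (auto simp: bij_betw_def)
    then show ?thesis by (simp add: f_def f_inv_into_f inv_into_into)
  qed
  have "\<exists>D. finite D \<and> D \<subseteq> carrier H \<and> (\<forall>x\<in>carrier G. f ` (x <#\<^bsub>G\<^esub> E) \<subseteq> f x <#\<^bsub>H\<^esub> D)"
    if E: "finite E" "E \<subseteq> carrier G" for E
  proof -
    obtain J n where J: "finite J" "\<forall>g\<in>carrier G. \<forall>e\<in>E. near J n (F g) (F (g \<otimes>\<^bsub>G\<^esub> e))"
      using coarse_chartD(2)[OF F E] by blast
    obtain D where D: "finite D" "D \<subseteq> carrier H"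
      "\<forall>g\<in>carrier H. \<forall>h\<in>carrier H. near J n (F' g) (F' h) \<longrightarrow> inv\<^bsub>H\<^esub> g \<otimes>\<^bsub>H\<^esub> h \<in> D"
      using coarse_chartD(3)[OF F' J(1), of n] by blast
    have "f (x \<otimes>\<^bsub>G\<^esub> e) \<in> f x <#\<^bsub>H\<^esub> D" if x: "x \<in> carrier G" and e: "e \<in> E" for x e
    proof -
      have xe: "x \<otimes>\<^bsub>G\<^esub> e \<in> carrier G" using x e E(2) by blast
      have "near J n (F' (f x)) (F' (f (x \<otimes>\<^bsub>G\<^esub> e)))"
        using J(2) x e f[OF x] f[OF xe] by simp
      then have "inv\<^bsub>H\<^esub> (f x) \<otimes>\<^bsub>H\<^esub> f (x \<otimes>\<^bsub>G\<^esub> e) \<in> D"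
        using D(3) f[OF x] f[OF xe] by blast
      moreover have "f (x \<otimes>\<^bsub>G\<^esub> e) = f x \<otimes>\<^bsub>H\<^esub> (inv\<^bsub>H\<^esub> (f x) \<otimes>\<^bsub>H\<^esub> f (x \<otimes>\<^bsub>G\<^esub> e))"
        using f[OF x] f[OF xe] by (simp add: H.m_assoc[symmetric])
      ultimately show ?thesis unfolding l_coset_def by blast
    qed
    then show ?thesis using D by (intro exI[of _ D]) (auto simp: l_coset_def)
  qed
  then show ?thesis using f by (auto simp: coarse_map_def f_def[symmetric])
qed

text \<open>Serves to replace a composite of inverse charts by \<open>inv_into\<close> of the
  composite, since the two are only known to agree on the carrier.\<close>

lemma coarse_map_cong:
  assumes "\<And>x. x \<in> carrier G \<Longrightarrow> f x = g x" and "group G" and "coarse_map G H f"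
  shows "coarse_map G H g"
proof -
  interpret group G by fact
  have "g ` (x <#\<^bsub>G\<^esub> E) = f ` (x <#\<^bsub>G\<^esub> E)" if "x \<in> carrier G" "E \<subseteq> carrier G" for x E
    using that assms(1) by (intro image_cong) (auto simp: l_coset_def)
  moreover have "g \<in> carrier G \<rightarrow> carrier H"
    using assms(3) by (auto simp: coarse_map_def assms(1)[symmetric])
  ultimately show ?thesis
    using assms(1,3) unfolding coarse_map_def by simp
qed

lemma coarsely_isomorphic_of_charts:
  assumes "group G" "group H"
    and F: "coarse_chart G (carrier G) F C" and F': "coarse_chart H (carrier H) F' C"
  shows "coarsely_isomorphic G H"
proof -
  let ?f = "inv_into (carrier H) F' \<circ> F"
  note b = coarse_chartD(1)[OF F] and b' = coarse_chartD(1)[OF F']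
  have bf: "bij_betw ?f (carrier G) (carrier H)"
    using bij_betw_trans[OF b bij_betw_inv_into[OF b']] by simp
  have "(inv_into (carrier G) F \<circ> F') y = inv_into (carrier G) ?f y" if y: "y \<in> carrier H" for y
  proof -
    obtain x where x: "x \<in> carrier G" "y = ?f x"
      using bf y by (metis bij_betw_iff_bijections)
    have "F x \<in> F' ` carrier H"
      using x b b' by (auto simp: bij_betw_def)
    then have "F' y = F x"
      using x by (simp add: f_inv_into_f)
    then show ?thesis
      using x bf b by (metis bij_betw_inv_into_left comp_apply)
  qed
  then have "coarse_map H G (inv_into (carrier G) ?f)"
    using coarse_map_of_charts[OF assms(2,1) F' F] coarse_map_cong assms(2) by blast
  then show ?thesis
    using bf coarse_map_of_charts[OF assms] unfolding coarsely_isomorphic_def coarse_isomorphism_def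
    by blast
qed

section \<open>Extending charts along subgroups\<close>

text \<open>On every left coset of \<open>D\<close> in \<open>K\<close> the new chart is a translate
  of the old one, by a vector supported off the coordinates that \<open>C\<close> uses. All cosets
  thus carry copies of the chart of \<open>D\<close> with the same constants, which is what survives
  the passage to a union.\<close>

definition extends_chart ::
    "('a, 'c) monoid_scheme \<Rightarrow> 'a set \<Rightarrow> ('a \<Rightarrow> 'i \<Rightarrow> int) \<Rightarrow> ('i \<Rightarrow> int set) \<Rightarrow> 'a set \<Rightarrow> ('a \<Rightarrow> 'i \<Rightarrow> int) \<Rightarrow> bool" where
  "extends_chart G D F C K F' \<longleftrightarrow>
     (\<forall>s\<in>D. F' s = F s) \<and>
     (\<forall>a\<in>K. \<exists>t\<in>K. \<exists>v. inv\<^bsub>G\<^esub> t \<otimes>\<^bsub>G\<^esub> a \<in> D \<and> (\<forall>i. C i \<noteq> {0} \<longrightarrow> v i = 0) \<and>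
        (\<forall>s\<in>D. F' (t \<otimes>\<^bsub>G\<^esub> s) = (\<lambda>i. v i + F s i)))"

lemma near_add_split:
  assumes "\<And>i. (x i = 0 \<and> x' i = 0) \<or> (y i = 0 \<and> y' i = (0::int))"
    and "0 \<le> n" and "near J n (\<lambda>i. x i + y i) (\<lambda>i. x' i + y' i)"
  shows "near J n x x'" "near J n y y'"
proof -
  have "\<bar>x i - x' i\<bar> \<le> n \<and> \<bar>y i - y' i\<bar> \<le> n \<and> (i \<notin> J \<longrightarrow> x i = x' i \<and> y i = y' i)" for i
    using assms(1)[of i] assms(2,3) unfolding near_def by (smt (verit))
  then show "near J n x x'" "near J n y y'" by (auto simp: near_def)
qed

lemma near_nonneg: "near J n x y \<Longrightarrow> 0 \<le> n"
  unfolding near_def by (meson abs_ge_zero order_trans)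

lemma near_empty_iff: "near {} 0 x y \<longleftrightarrow> x = y"
  by (auto simp: near_def)

text \<open>The new coordinates live on the transversal \<open>T\<close>. Multiplication by \<open>e\<close> on the right of \<open>t \<otimes> s\<close>
  is first moved past \<open>s\<close>, which only replaces \<open>e\<close> by one of finitely many conjugates.\<close>

lemma (in group) chart_step:
  assumes D: "subgroup D G" and K: "subgroup K G" "D \<subseteq> K" and T: "T \<subseteq> K"
    and ex: "\<And>a. a \<in> K \<Longrightarrow> \<exists>t\<in>T. inv t \<otimes> a \<in> D"
    and uniq: "\<And>t t'. t \<in> T \<Longrightarrow> t' \<in> T \<Longrightarrow> inv t \<otimes> t' \<in> D \<Longrightarrow> t = t'"
    and F: "coarse_chart G D F C" and C0: "\<And>i. 0 \<in> C i"
    and tau: "bij_betw \<tau> T (fsupp B)"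
    and one: "\<one> \<in> T" "\<tau> \<one> = (\<lambda>i. 0)"
    and disj: "\<And>i. C i = {0} \<or> B i = {0}"
    and conj: "\<And>E. finite E \<Longrightarrow> E \<subseteq> K \<Longrightarrow> finite {inv s \<otimes> e \<otimes> s | s e. s \<in> D \<and> e \<in> E}"
    and fw: "\<And>E. finite E \<Longrightarrow> E \<subseteq> K \<Longrightarrow> \<exists>A J n. finite A \<and> A \<subseteq> D \<and> finite J \<and>
       (\<forall>t\<in>T. \<forall>e\<in>E. \<exists>t'\<in>T. inv t' \<otimes> (t \<otimes> e) \<in> A \<and> near J n (\<tau> t) (\<tau> t'))"
    and bw: "\<And>J n. finite J \<Longrightarrow> \<exists>E. finite E \<and> E \<subseteq> K \<and>
       (\<forall>t\<in>T. \<forall>t'\<in>T. near J n (\<tau> t) (\<tau> t') \<longrightarrow> inv t \<otimes> t' \<in> E)"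
  shows "\<exists>F'. coarse_chart G K F' (\<lambda>i. if B i = {0} then C i else B i) \<and> extends_chart G D F C K F'"
proof -
  note Dc = subgroup.mem_carrier[OF D] and Kc = subgroup.mem_carrier[OF K(1)]
  note Dm = subgroup.m_closed[OF D] and Km = subgroup.m_closed[OF K(1)]
  note Di = subgroup.m_inv_closed[OF D] and Ki = subgroup.m_inv_closed[OF K(1)]
  have Tc: "t \<in> carrier G" "t \<in> K" if "t \<in> T" for t using T Kc that by auto
  have DK: "s \<in> K" if "s \<in> D" for s using K(2) that by auto
  \<comment> \<open>\<open>\<rho> a\<close> represents the left coset of \<open>a\<close>;
    \<open>F'\<close> adds the coordinates of the two factors of
    \<open>a = t \<otimes> s\<close>.\<close>
  define \<rho> where "\<rho> a = (SOME t. t \<in> T \<and> inv t \<otimes> a \<in> D)" for a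
  have \<rho>: "\<rho> a \<in> T" "inv (\<rho> a) \<otimes> a \<in> D" if "a \<in> K" for a
    using someI_ex[of "\<lambda>t. t \<in> T \<and> inv t \<otimes> a \<in> D"] ex[OF that] unfolding \<rho>_def by blast+
  define F' where "F' a = (\<lambda>i. \<tau> (\<rho> a) i + F (inv (\<rho> a) \<otimes> a) i)" for a
  have \<rho>_mult: "\<rho> (t \<otimes> s) = t" if t: "t \<in> T" and s: "s \<in> D" for t s
  proof -
    let ?r = "\<rho> (t \<otimes> s)"
    have r: "?r \<in> T" "inv ?r \<otimes> (t \<otimes> s) \<in> D"
      using \<rho>[of "t \<otimes> s"] Km Tc[OF t] DK[OF s] by auto
    have "inv ?r \<otimes> t = inv ?r \<otimes> (t \<otimes> s) \<otimes> inv s"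
      using Tc[OF r(1)] Tc[OF t] Dc[OF s] by (simp add: m_assoc)
    then have "inv ?r \<otimes> t \<in> D" using Dm[OF r(2) Di[OF s]] by simp
    then show ?thesis using uniq[OF r(1) t] by simp
  qed
  have F'_mult: "F' (t \<otimes> s) = (\<lambda>i. \<tau> t i + F s i)" if t: "t \<in> T" and s: "s \<in> D" for t s
    using Tc[OF t] Dc[OF s] by (simp add: F'_def \<rho>_mult[OF t s] m_assoc[symmetric])
  have dec: "\<exists>t\<in>T. \<exists>s\<in>D. a = t \<otimes> s" if "a \<in> K" for a
    using \<rho>[OF that] Kc[OF that] Tc[OF \<rho>(1)[OF that]]
    by (intro bexI[of _ "\<rho> a"] bexI[of _ "inv (\<rho> a) \<otimes> a"]) (auto simp: m_assoc[symmetric])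
  have F_in: "F s \<in> fsupp C" if "s \<in> D" for s
    using coarse_chartD(1)[OF F] that by (auto simp: bij_betw_def)
  have \<tau>_in: "\<tau> t \<in> fsupp B" if "t \<in> T" for t
    using tau that by (auto simp: bij_betw_def)
  have B0: "0 \<in> B i" for i using \<tau>_in[OF one(1)] one(2) by (auto simp: fsupp_def)
  have split: "(\<tau> t i = 0 \<and> \<tau> t' i = 0) \<or> (F s i = 0 \<and> F s' i = 0)"
    if "t \<in> T" "t' \<in> T" "s \<in> D" "s' \<in> D" for t t' s s' i
    using disj[of i] F_in[OF that(3)] F_in[OF that(4)] \<tau>_in[OF that(1)] \<tau>_in[OF that(2)]
    by (auto simp: fsupp_def)
  define C' where "C' = (\<lambda>i. if B i = {0} then C i else B i)"
  have inj: "inj_on F' K"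
  proof (rule inj_onI)
    fix a b assume ab: "a \<in> K" "b \<in> K" "F' a = F' b"
    obtain t s t' s' where ts: "t \<in> T" "s \<in> D" "a = t \<otimes> s" "t' \<in> T" "s' \<in> D" "b = t' \<otimes> s'"
      using dec ab(1,2) by metis
    have "near {} 0 (\<lambda>i. \<tau> t i + F s i) (\<lambda>i. \<tau> t' i + F s' i)"
      using ab(3) ts by (simp add: near_empty_iff F'_mult)
    then have "\<tau> t = \<tau> t'" "F s = F s'"
      using near_add_split[of "\<tau> t" "\<tau> t'" "F s" "F s'" 0 "{}"] split[OF ts(1,4,2,5)] near_empty_iff
      by (simp_all add: near_empty_iff)
    then show "a = b"
      using ts tau coarse_chartD(1)[OF F] by (auto simp: bij_betw_def dest: inj_onD)
  qed
  have "F' ` K = fsupp C'"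
  proof (intro equalityI subsetI)
    fix z assume "z \<in> F' ` K"
    then obtain t s where ts: "t \<in> T" "s \<in> D" "z = F' (t \<otimes> s)" using dec by blast
    have z: "z = (\<lambda>i. \<tau> t i + F s i)" using ts F'_mult by simp
    have "finite ({i. \<tau> t i \<noteq> 0} \<union> {i. F s i \<noteq> 0})"
      using \<tau>_in[OF ts(1)] F_in[OF ts(2)] by (simp add: fsupp_def)
    then have "finite {i. z i \<noteq> 0}" by (rule finite_subset[rotated]) (auto simp: z)
    moreover have "z i \<in> C' i" for i
    proof -
      have *: "\<tau> t i \<in> B i" "F s i \<in> C i"
        using \<tau>_in[OF ts(1)] F_in[OF ts(2)] by (auto simp: fsupp_def)
      show ?thesis
      proof (cases "B i = {0}")
        case True
        then have "\<tau> t i = 0" using * by auto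
        then show ?thesis using True * by (simp add: z C'_def)
      next
        case False
        then have "F s i = 0" using disj[of i] * by auto
        then show ?thesis using False * by (simp add: z C'_def)
      qed
    qed
    ultimately show "z \<in> fsupp C'" by (simp add: fsupp_def)
  next
    fix z assume z: "z \<in> fsupp C'"
    define x where "x = (\<lambda>i. if B i = {0} then 0 else z i)"
    define y where "y = (\<lambda>i. if B i = {0} then z i else 0)"
    have xy: "z = (\<lambda>i. x i + y i)" by (auto simp: x_def y_def)
    have fz: "finite {i. z i \<noteq> 0}" "\<And>i. z i \<in> C' i" using z by (auto simp: fsupp_def)
    have "finite {i. x i \<noteq> 0}" "finite {i. y i \<noteq> 0}"
      by (rule finite_subset[OF _ fz(1)], auto simp: x_def y_def)+
    moreover have "x i \<in> B i" "y i \<in> C i" for i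
      using fz(2)[of i] B0[of i] C0[of i] by (cases "B i = {0}"; simp add: x_def y_def C'_def)+
    ultimately have "x \<in> fsupp B" "y \<in> fsupp C" by (auto simp: fsupp_def)
    then obtain t s where ts: "t \<in> T" "x = \<tau> t" "s \<in> D" "y = F s"
      using tau coarse_chartD(1)[OF F] unfolding bij_betw_def by blast
    then have "z = F' (t \<otimes> s)" using F'_mult xy by simp
    then show "z \<in> F' ` K" using Km[OF Tc(2)[OF ts(1)] DK[OF ts(3)]] by blast
  qed
  then have bij: "bij_betw F' K (fsupp C')" using inj by (simp add: bij_betw_def)
  have fwd: "\<exists>J n. finite J \<and> (\<forall>g\<in>K. \<forall>e\<in>E. near J n (F' g) (F' (g \<otimes> e)))"
    if E: "finite E" "E \<subseteq> K" for E
  proof -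
    define E' where "E' = {inv s \<otimes> e \<otimes> s | s e. s \<in> D \<and> e \<in> E}"
    have E': "finite E'" "E' \<subseteq> K"
      using conj[OF E] E(2) DK Ki Km by (auto simp: E'_def)
    obtain A J n where A: "finite A" "A \<subseteq> D" "finite J"
      and AJ: "\<forall>t\<in>T. \<forall>e\<in>E'. \<exists>t'\<in>T. inv t' \<otimes> (t \<otimes> e) \<in> A \<and> near J n (\<tau> t) (\<tau> t')"
      using fw[OF E'] by blast
    \<comment> \<open>Moving \<open>e\<close> to the left of \<open>s\<close> leaves a correction in
      \<open>A\<close>, which must be moved back to the right of \<open>s\<close> before the chart
      of \<open>D\<close> applies. This is a second passage to conjugates, now inside
      \<open>D\<close>.\<close>
    define A' where "A' = {inv s \<otimes> e \<otimes> s | s e. s \<in> D \<and> e \<in> A}"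
    have A': "finite A'" "A' \<subseteq> D"
      using conj[OF A(1)] A(2) DK Di Dm by (auto simp: A'_def)
    obtain J' n' where J': "finite J'" "\<forall>g\<in>D. \<forall>e\<in>A'. near J' n' (F g) (F (g \<otimes> e))"
      using coarse_chartD(2)[OF F A'] by blast
    have "near (J \<union> J') (n + n') (F' g) (F' (g \<otimes> e))" if g: "g \<in> K" and e: "e \<in> E" for g e
    proof -
      obtain t s where ts: "t \<in> T" "s \<in> D" "g = t \<otimes> s" using dec[OF g] by blast
      define e' where "e' = s \<otimes> e \<otimes> inv s"
      have ec: "e \<in> carrier G" using e E(2) Kc by blast
      have e': "e' \<in> E'"
      proof -
        have "e' = inv (inv s) \<otimes> e \<otimes> inv s" using Dc[OF ts(2)] by (simp add: e'_def)
        then show ?thesis unfolding E'_def using e Di[OF ts(2)] by blast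
      qed
      have ec': "e' \<in> carrier G" using e' E'(2) Kc by blast
      obtain t' where t': "t' \<in> T" "inv t' \<otimes> (t \<otimes> e') \<in> A" "near J n (\<tau> t) (\<tau> t')"
        using AJ ts(1) e' by blast
      define d where "d = inv t' \<otimes> (t \<otimes> e')"
      have d: "d \<in> A" "d \<in> D" using t' A by (auto simp: d_def)
      define d' where "d' = inv s \<otimes> d \<otimes> s"
      have d': "d' \<in> A'" unfolding A'_def d'_def using ts(2) d by auto
      have cs: "t \<in> carrier G" "s \<in> carrier G" "t' \<in> carrier G" "d \<in> carrier G"
        using ts t' d Tc Dc by auto
      have "g \<otimes> e = t \<otimes> e' \<otimes> s"
        unfolding ts(3) e'_def using cs ec by (simp add: m_assoc)
      also have "t \<otimes> e' = t' \<otimes> d"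
        unfolding d_def using cs ec' by (simp add: m_assoc[symmetric])
      also have "t' \<otimes> d \<otimes> s = t' \<otimes> (s \<otimes> d')"
        unfolding d'_def using cs by (simp add: m_assoc[symmetric])
      finally have ge: "g \<otimes> e = t' \<otimes> (s \<otimes> d')" .
      have "near J' n' (F s) (F (s \<otimes> d'))" using J'(2) ts(2) d' by blast
      from near_add[OF t'(3) this]
      show ?thesis
        using ge ts F'_mult[OF ts(1,2)] F'_mult[OF t'(1), of "s \<otimes> d'"] d' A'(2) Dm[OF ts(2)] by auto
    qed
    then show ?thesis using A(3) J'(1) by (intro exI[of _ "J \<union> J'"] exI[of _ "n + n'"]) auto
  qed
  have bwd: "\<exists>E. finite E \<and> E \<subseteq> K \<and> (\<forall>g\<in>K. \<forall>h\<in>K. near J n (F' g) (F' h) \<longrightarrow> inv g \<otimes> h \<in> E)"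
    if J: "finite J" for J n
  proof -
    obtain E1 where E1: "finite E1" "E1 \<subseteq> K"
       "\<forall>t\<in>T. \<forall>t'\<in>T. near J n (\<tau> t) (\<tau> t') \<longrightarrow> inv t \<otimes> t' \<in> E1"
      using bw[OF J, of n] by blast
    obtain E2 where E2: "finite E2" "E2 \<subseteq> D"
       "\<forall>g\<in>D. \<forall>h\<in>D. near J n (F g) (F h) \<longrightarrow> inv g \<otimes> h \<in> E2"
      using coarse_chartD(3)[OF F J, of n] by blast
    \<comment> \<open>With \<open>g = t \<otimes> s\<close> and \<open>h = t' \<otimes> s'\<close>,
      the element \<open>inv g \<otimes> h\<close> is the conjugate of
      \<open>inv t \<otimes> t'\<close> by \<open>s\<close>, followed by
      \<open>inv s \<otimes> s'\<close>.\<close>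
    define E1' where "E1' = {inv s \<otimes> e \<otimes> s | s e. s \<in> D \<and> e \<in> E1}"
    have E1': "finite E1'" "E1' \<subseteq> K"
      using conj[OF E1(1,2)] E1(2) DK Ki Km by (auto simp: E1'_def)
    define E where "E = (\<lambda>(a, b). a \<otimes> b) ` (E1' \<times> E2)"
    have "inv g \<otimes> h \<in> E" if g: "g \<in> K" and h: "h \<in> K" and nr: "near J n (F' g) (F' h)" for g h
    proof -
      obtain t s t' s' where ts: "t \<in> T" "s \<in> D" "g = t \<otimes> s" "t' \<in> T" "s' \<in> D" "h = t' \<otimes> s'"
        using dec g h by metis
      have "near J n (\<lambda>i. \<tau> t i + F s i) (\<lambda>i. \<tau> t' i + F s' i)"
        using nr ts by (simp add: F'_mult)
      then have nn: "near J n (\<tau> t) (\<tau> t')" "near J n (F s) (F s')"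
        using near_add_split[of "\<tau> t" "\<tau> t'" "F s" "F s'" n J]
          split[OF ts(1,4,2,5)] near_nonneg[OF nr] by auto
      then have m: "inv t \<otimes> t' \<in> E1" "inv s \<otimes> s' \<in> E2" using E1(3) E2(3) ts by auto
      have cs: "t \<in> carrier G" "s \<in> carrier G" "t' \<in> carrier G" "s' \<in> carrier G"
        using ts Tc Dc by auto
      have "inv g \<otimes> h = (inv s \<otimes> (inv t \<otimes> t') \<otimes> s) \<otimes> (inv s \<otimes> s')"
        unfolding ts using cs by (simp add: inv_mult_group m_assoc) (simp add: m_assoc[symmetric])
      moreover have "inv s \<otimes> (inv t \<otimes> t') \<otimes> s \<in> E1'"
        unfolding E1'_def using m(1) ts(2) by auto
      ultimately show ?thesis using m(2) by (auto simp: E_def)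
    qed
    moreover have "finite E" "E \<subseteq> K"
      using E1' E2 DK Km unfolding E_def by (auto simp: subset_iff)
    ultimately show ?thesis by blast
  qed
  have "extends_chart G D F C K F'"
    unfolding extends_chart_def
  proof (intro conjI ballI)
    fix s assume "s \<in> D"
    then show "F' s = F s" using F'_mult[OF one(1)] one(2) Dc by simp
  next
    fix a assume a: "a \<in> K"
    have "\<tau> (\<rho> a) i = 0" if "C i \<noteq> {0}" for i
      using \<tau>_in[OF \<rho>(1)[OF a]] disj[of i] that by (auto simp: fsupp_def)
    then show "\<exists>t\<in>K. \<exists>v. inv t \<otimes> a \<in> D \<and> (\<forall>i. C i \<noteq> {0} \<longrightarrow> v i = 0) \<and>
        (\<forall>s\<in>D. F' (t \<otimes> s) = (\<lambda>i. v i + F s i))"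
      using \<rho>[OF a] Tc F'_mult by (intro bexI[of _ "\<rho> a"] exI[of _ "\<tau> (\<rho> a)"]) auto
  qed
  then show ?thesis
    using bij fwd bwd unfolding coarse_chart_def C'_def[symmetric] by blast
qed


lemma (in group) extends_chart_refl:
  assumes "subgroup K G"
  shows "extends_chart G K F C K F"
  unfolding extends_chart_def
  using subgroup.one_closed[OF assms] subgroup.mem_carrier[OF assms]
  by (auto intro!: bexI[of _ \<one>] exI[of _ "\<lambda>_. 0"])

text \<open>The two translations add up. Coordinates used by \<open>C\<close> remain in use in
  \<open>C'\<close>, so the sum of the translation vectors still vanishes on them.\<close>

lemma (in group) extends_chart_trans:
  assumes D: "subgroup D G" and K: "subgroup K G" "D \<subseteq> K" and L: "subgroup L G" "K \<subseteq> L"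
    and C: "\<And>i. C i \<noteq> {0} \<Longrightarrow> C' i \<noteq> {0}"
    and 1: "extends_chart G D F C K F'" and 2: "extends_chart G K F' C' L F''"
  shows "extends_chart G D F C L F''"
  unfolding extends_chart_def
proof (intro conjI ballI)
  fix s assume "s \<in> D"
  then show "F'' s = F s" using 1 2 K(2) by (auto simp: extends_chart_def)
next
  fix a assume a: "a \<in> L"
  obtain t v where t: "t \<in> L" "inv t \<otimes> a \<in> K" "\<forall>i. C' i \<noteq> {0} \<longrightarrow> v i = 0"
    "\<forall>s\<in>K. F'' (t \<otimes> s) = (\<lambda>i. v i + F' s i)"
    using 2 a unfolding extends_chart_def by blast
  obtain u w where u: "u \<in> K" "inv u \<otimes> (inv t \<otimes> a) \<in> D" "\<forall>i. C i \<noteq> {0} \<longrightarrow> w i = 0"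
    "\<forall>s\<in>D. F' (u \<otimes> s) = (\<lambda>i. w i + F s i)"
    using 1 t(2) unfolding extends_chart_def by blast
  have c: "t \<in> carrier G" "u \<in> carrier G" "a \<in> carrier G"
    using subgroup.mem_carrier[OF L(1)] subgroup.mem_carrier[OF K(1)] t(1) u(1) a by auto
  have "inv (t \<otimes> u) \<otimes> a \<in> D" using u(2) c by (simp add: inv_mult_group m_assoc)
  moreover have "F'' (t \<otimes> u \<otimes> s) = (\<lambda>i. (v i + w i) + F s i)" if s: "s \<in> D" for s
  proof -
    have "u \<otimes> s \<in> K" using u(1) s K(2) subgroup.m_closed[OF K(1)] by blast
    moreover have "t \<otimes> u \<otimes> s = t \<otimes> (u \<otimes> s)"
      using c subgroup.mem_carrier[OF D s] by (simp add: m_assoc)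
    ultimately show ?thesis using t(4) u(4) s by (auto simp: add.assoc)
  qed
  moreover have "t \<otimes> u \<in> L" using t(1) u(1) L(2) subgroup.m_closed[OF L(1)] by blast
  ultimately show "\<exists>t\<in>L. \<exists>v. inv t \<otimes> a \<in> D \<and> (\<forall>i. C i \<noteq> {0} \<longrightarrow> v i = 0) \<and>
        (\<forall>s\<in>D. F'' (t \<otimes> s) = (\<lambda>i. v i + F s i))"
    using t(3) u(3) C by (intro bexI[of _ "t \<otimes> u"] exI[of _ "\<lambda>i. v i + w i"]) auto
qed

lemma finite_subset_chain:
  fixes K :: "nat \<Rightarrow> 'a set"
  assumes "finite E" "E \<subseteq> (\<Union>n. K n)" "\<And>n. K n \<subseteq> K (Suc n)"
  shows "\<exists>n. E \<subseteq> K n"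
  using assms(1,2)
proof (induction E rule: finite_induct)
  case (insert x E)
  then obtain m n where mn: "E \<subseteq> K n" "x \<in> K m" by auto
  have "K n \<subseteq> K (max m n)" "K m \<subseteq> K (max m n)"
    using lift_Suc_mono_le[of K, OF assms(3)] by auto
  then show ?case using mn by (intro exI[of _ "max m n"]) auto
qed auto

text \<open>A finite set of group elements or of coordinates is decided at some stage
  \<open>n\<close>, and \<open>extends_chart\<close> copies the estimates of that stage to every
  coset of \<open>K n\<close>. The hypothesis on \<open>C\<close> freezes the range of a coordinate
  once it is in use.\<close>

lemma (in group) chart_tower:
  fixes K :: "nat \<Rightarrow> 'a set" and C :: "nat \<Rightarrow> 'i \<Rightarrow> int set"
  assumes sub: "\<And>n. subgroup (K n) G" and mono: "\<And>n. K n \<subseteq> K (Suc n)"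
    and C: "\<And>n i. C n i \<noteq> {0} \<Longrightarrow> C (Suc n) i = C n i"
    and C0: "\<And>n i. 0 \<in> C n i" and Cf: "\<And>n. finite {i. C n i \<noteq> {0}}"
    and chart: "\<And>n. coarse_chart G (K n) (F n) (C n)"
    and ext: "\<And>n. extends_chart G (K n) (F n) (C n) (K (Suc n)) (F (Suc n))"
  shows "\<exists>F'. coarse_chart G (\<Union>n. K n) F' (\<lambda>i. \<Union>n. C n i)"
proof -
  define L where "L = (\<Union>n. K n)"
  define C' where "C' = (\<lambda>i. \<Union>n. C n i)"
  have monole: "K n \<subseteq> K m" if "n \<le> m" for n m
    using lift_Suc_mono_le[of K, OF mono that] .
  have Cle: "C m i = C n i" if "C n i \<noteq> {0}" "n \<le> m" for n m i
    using that(2)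
  proof (induction m rule: dec_induct)
    case (step k)
    then show ?case using C[of k i] that by simp
  qed simp
  have C'eq: "C' i = C n i" if "C n i \<noteq> {0}" for n i
  proof -
    have "C m i \<subseteq> C n i" for m
    proof (cases "n \<le> m")
      case True then show ?thesis using Cle that by blast
    next
      case False
      then show ?thesis using Cle[of m i n] C0[of n i] by (cases "C m i = {0}") auto
    qed
    then show ?thesis by (auto simp: C'_def)
  qed
  have extle: "extends_chart G (K n) (F n) (C n) (K m) (F m)" if "n \<le> m" for n m
    using that
  proof (induction m rule: dec_induct)
    case base then show ?case using extends_chart_refl sub by blast
  next
    case (step k)
    show ?case
      by (rule extends_chart_trans[OF sub sub monole[OF step(1)] sub mono _ step(3) ext])
        (metis Cle step(1))
  qed
  define F' where "F' a = F (LEAST n. a \<in> K n) a" for a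
  have F'_eq: "F' a = F m a" if "a \<in> K m" for a m
  proof -
    let ?n = "LEAST n. a \<in> K n"
    have "a \<in> K ?n" "?n \<le> m" using that by (auto intro: LeastI Least_le)
    then show ?thesis using extle[of ?n m] by (simp add: extends_chart_def F'_def)
  qed
  \<comment> \<open>The extension property of all finite stages, read inside the union: each coset
    of \<open>K n\<close> in \<open>L\<close> is charted by a translate of
    \<open>F n\<close>.\<close>
  have local: "\<exists>t\<in>L. \<exists>v. inv t \<otimes> a \<in> K n \<and> (\<forall>i. C n i \<noteq> {0} \<longrightarrow> v i = 0) \<and>
        (\<forall>s\<in>K n. F' (t \<otimes> s) = (\<lambda>i. v i + F n s i))" if a: "a \<in> L" for a n
  proof -
    obtain m where m: "n \<le> m" "a \<in> K m"
    proof -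
      obtain k where "a \<in> K k" using a by (auto simp: L_def)
      then have "a \<in> K (max n k)" using monole[of k "max n k"] by auto
      then show ?thesis using that by (meson max.cobounded1)
    qed
    obtain t v where t: "t \<in> K m" "inv t \<otimes> a \<in> K n" "\<forall>i. C n i \<noteq> {0} \<longrightarrow> v i = 0"
      "\<forall>s\<in>K n. F m (t \<otimes> s) = (\<lambda>i. v i + F n s i)"
      using extle[OF m(1)] m(2) unfolding extends_chart_def by blast
    have "F' (t \<otimes> s) = F m (t \<otimes> s)" if "s \<in> K n" for s
      using that t(1) monole[OF m(1)] subgroup.m_closed[OF sub] by (intro F'_eq) blast
    then show ?thesis using t by (auto simp: L_def)
  qed
  have Lc: "a \<in> carrier G" if "a \<in> L" for a
    using that subgroup.mem_carrier[OF sub] by (auto simp: L_def)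
  have Kc: "a \<in> carrier G" if "a \<in> K n" for a n
    using that subgroup.mem_carrier[OF sub] by blast
  \<comment> \<open>From some stage on, every coordinate in \<open>J\<close> that will ever be used
    is already in use.\<close>
  have stable: "\<exists>n. \<forall>i\<in>J. C n i = {0} \<longrightarrow> C' i = {0}" if "finite J" for J
    using that
  proof (induction J rule: finite_induct)
    case (insert j J)
    obtain n where n: "\<forall>i\<in>J. C n i = {0} \<longrightarrow> C' i = {0}" using insert by blast
    show ?case
    proof (cases "C' j = {0}")
      case False
      have "\<exists>m. C m j \<noteq> {0}"
        using False unfolding C'_def by auto
      then obtain m where m: "C m j \<noteq> {0}" by blast
      have "C (max m n) i \<noteq> {0}" if "C n i \<noteq> {0} \<or> i = j" for i
        using that m Cle[of m j "max m n"] Cle[of n i "max m n"] by auto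
      then show ?thesis using n by (intro exI[of _ "max m n"]) blast
    qed (use n in auto)
  qed auto
  have Fin: "F n s \<in> fsupp (C n)" if "s \<in> K n" for n s
    using coarse_chartD(1)[OF chart] that by (auto simp: bij_betw_def)
  have Fsurj: "\<exists>s\<in>K n. z = F n s" if "z \<in> fsupp (C n)" for n z
    using coarse_chartD(1)[OF chart, of n] that by (auto simp: bij_betw_def)
  have inj: "inj_on F' L"
  proof (rule inj_onI)
    fix a b assume ab: "a \<in> L" "b \<in> L" "F' a = F' b"
    then obtain m where m: "a \<in> K m" "b \<in> K m"
      using finite_subset_chain[of "{a, b}" K, OF _ _ mono] by (auto simp: L_def)
    then show "a = b"
      using ab(3) F'_eq coarse_chartD(1)[OF chart, of m] by (auto simp: bij_betw_def dest: inj_onD)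
  qed
  have "F' ` L = fsupp C'"
  proof (intro equalityI subsetI)
    fix z assume "z \<in> F' ` L"
    then obtain s n where "s \<in> K n" "z = F n s" using F'_eq by (auto simp: L_def)
    then show "z \<in> fsupp C'" using Fin[of s n] by (auto simp: fsupp_def C'_def)
  next
    fix z assume z: "z \<in> fsupp C'"
    then obtain n where n: "\<forall>i\<in>{i. z i \<noteq> 0}. C n i = {0} \<longrightarrow> C' i = {0}"
      using stable[of "{i. z i \<noteq> 0}"] by (auto simp: fsupp_def)
    have "z i \<in> C n i" for i
    proof (cases "z i = 0")
      case False
      have "z i \<in> C' i" using z by (simp add: fsupp_def)
      then have "C n i \<noteq> {0}" using False n by auto
      then show ?thesis using C'eq \<open>z i \<in> C' i\<close> by blast
    qed (simp add: C0)
    then obtain s where "s \<in> K n" "z = F n s" using Fsurj[of z n] z by (auto simp: fsupp_def)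
    then have "s \<in> L" "z = F' s" using F'_eq by (auto simp: L_def)
    then show "z \<in> F' ` L" by blast
  qed
  then have bij: "bij_betw F' L (fsupp C')" using inj by (simp add: bij_betw_def)
  have fwd: "\<exists>J m. finite J \<and> (\<forall>g\<in>L. \<forall>e\<in>E. near J m (F' g) (F' (g \<otimes> e)))"
    if E: "finite E" "E \<subseteq> L" for E
  proof -
    obtain n where n: "E \<subseteq> K n"
      using finite_subset_chain[of E K] E mono by (auto simp: L_def)
    obtain J m where J: "finite J" "\<forall>g\<in>K n. \<forall>e\<in>E. near J m (F n g) (F n (g \<otimes> e))"
      using coarse_chartD(2)[OF chart E(1) n] by blast
    have "near J m (F' g) (F' (g \<otimes> e))" if g: "g \<in> L" and e: "e \<in> E" for g e
    proof -
      obtain t v where t: "t \<in> L" "inv t \<otimes> g \<in> K n"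
        "\<forall>s\<in>K n. F' (t \<otimes> s) = (\<lambda>i. v i + F n s i)" using local[OF g, of n] by blast
      define s where "s = inv t \<otimes> g"
      have s: "s \<in> K n" "g = t \<otimes> s"
        using t Lc[OF g] Lc[OF t(1)] by (simp_all add: s_def m_assoc[symmetric])
      have se: "s \<otimes> e \<in> K n" using s e n subgroup.m_closed[OF sub] by blast
      have ge: "g \<otimes> e = t \<otimes> (s \<otimes> e)"
        using s Lc[OF t(1)] Kc[OF s(1)] Kc[of e n] e n by (auto simp: m_assoc)
      have "near J m (F n s) (F n (s \<otimes> e))" using J(2) s e by blast
      then have "near J m (\<lambda>i. v i + F n s i) (\<lambda>i. v i + F n (s \<otimes> e) i)" by (simp add: near_def)
      moreover have "F' g = (\<lambda>i. v i + F n s i)" using s t(3) by simp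
      moreover have "F' (g \<otimes> e) = (\<lambda>i. v i + F n (s \<otimes> e) i)" using se ge t(3) by simp
      ultimately show ?thesis by simp
    qed
    then show ?thesis using J(1) by blast
  qed
  have bwd: "\<exists>E. finite E \<and> E \<subseteq> L \<and> (\<forall>g\<in>L. \<forall>h\<in>L. near J m (F' g) (F' h) \<longrightarrow> inv g \<otimes> h \<in> E)"
    if J: "finite J" for J m
  proof -
    obtain n where n: "\<forall>i\<in>J. C n i = {0} \<longrightarrow> C' i = {0}" using stable[OF J] by blast
    obtain E where E: "finite E" "E \<subseteq> K n"
      "\<forall>g\<in>K n. \<forall>h\<in>K n. near J m (F n g) (F n h) \<longrightarrow> inv g \<otimes> h \<in> E"
      using coarse_chartD(3)[OF chart J, of n m] by blast
    have "inv g \<otimes> h \<in> E" if g: "g \<in> L" and h: "h \<in> L" and nr: "near J m (F' g) (F' h)" for g h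
    proof -
      obtain t v where t: "t \<in> L" "inv t \<otimes> g \<in> K n" "\<forall>i. C n i \<noteq> {0} \<longrightarrow> v i = 0"
        "\<forall>s\<in>K n. F' (t \<otimes> s) = (\<lambda>i. v i + F n s i)" using local[OF g, of n] by blast
      define s where "s = inv t \<otimes> g"
      have s: "s \<in> K n" "g = t \<otimes> s"
        using t Lc[OF g] Lc[OF t(1)] by (simp_all add: s_def m_assoc[symmetric])
      have F'g: "F' g = (\<lambda>i. v i + F n s i)" using s t(4) by simp
      define z where "z i = F' h i - v i" for i
      have hC: "F' h i \<in> C' i" and gC: "F' g i \<in> C' i" for i
        using bij g h by (auto simp: bij_betw_def fsupp_def)
      have zC: "z i \<in> C n i" for i
      proof (cases "C n i = {0}")
        case False
        then show ?thesis using t(3) hC[of i] C'eq[OF False] by (simp add: z_def)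
      next
        case True
        have Fs: "F n s i = 0" using Fin[OF s(1)] True by (auto simp: fsupp_def)
        have "F' h i = F' g i"
        proof (cases "i \<in> J")
          case True
          then have "C' i = {0}" using n \<open>C n i = {0}\<close> by blast
          then show ?thesis using hC[of i] gC[of i] by simp
        qed (use nr in \<open>simp add: near_def\<close>)
        then show ?thesis using Fs F'g True by (simp add: z_def)
      qed
      have "finite {i. z i \<noteq> 0}"
        by (rule finite_subset[OF _ Cf[of n]]) (use zC in fastforce)
      then obtain s' where s': "s' \<in> K n" "z = F n s'" using Fsurj[of z n] zC by (auto simp: fsupp_def)
      have ts': "t \<otimes> s' \<in> L"
      proof -
        obtain k where "{t, s'} \<subseteq> K k"
          using finite_subset_chain[of "{t, s'}" K, OF _ _ mono] t(1) s'(1) by (auto simp: L_def)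
        then show ?thesis using subgroup.m_closed[OF sub, of t k s'] by (auto simp: L_def)
      qed
      have F'h: "F' h = (\<lambda>i. v i + F n s' i)" by (simp add: s'(2)[symmetric] z_def fun_eq_iff)
      then have "F' (t \<otimes> s') = F' h" using t(4) s'(1) by simp
      then have h': "h = t \<otimes> s'" using inj ts' h by (auto dest: inj_onD)
      have "near J m (F n s) (F n s')" using nr unfolding F'g F'h by (simp add: near_def)
      then have "inv s \<otimes> s' \<in> E" using E(3) s s' by blast
      moreover have "inv g \<otimes> h = inv s \<otimes> s'"
        using Lc[OF t(1)] Kc[OF s(1)] Kc[OF s'(1)] unfolding h' s(2)
        by (simp add: inv_mult_group m_assoc) (simp add: m_assoc[symmetric])
      ultimately show ?thesis by simp
    qed
    then show ?thesis using E(1,2) by (intro exI[of _ E]) (auto simp: L_def)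
  qed
  show ?thesis
    using bij fwd bwd unfolding coarse_chart_def L_def[symmetric] C'_def[symmetric] by blast
qed

section \<open>Finitely generated finite-by-abelian subgroups\<close>

lemma (in group) cancel_inv:
  assumes "a \<in> carrier G" "b \<in> carrier G"
  shows "a \<otimes> (inv a \<otimes> b) = b" "inv a \<otimes> (a \<otimes> b) = b"
  using assms by (simp_all add: m_assoc[symmetric])

lemma (in group) lfba_hom:
  assumes lf: "locally_finite_by_abelian G" and S: "finite S" "S \<subseteq> carrier G"
    and K: "K = generate G S"
  obtains Q :: "'a set monoid" and \<pi> where "comm_group Q"
    and "group_hom (G\<lparr>carrier := K\<rparr>) Q \<pi>" and "finite {a \<in> K. \<pi> a = \<one>\<^bsub>Q\<^esub>}"
proof -
  obtain N where N: "N \<lhd> G\<lparr>carrier := K\<rparr>" "finite N" "comm_group (G\<lparr>carrier := K\<rparr> Mod N)"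
    using lf S unfolding locally_finite_by_abelian_def finite_by_abelian_def K by blast
  interpret N: normal N "G\<lparr>carrier := K\<rparr>" by fact
  define \<pi> where "\<pi> = (\<lambda>a. N #>\<^bsub>G\<lparr>carrier := K\<rparr>\<^esub> a)"
  interpret Q: comm_group "G\<lparr>carrier := K\<rparr> Mod N" by fact
  have "group_hom (G\<lparr>carrier := K\<rparr>) (G\<lparr>carrier := K\<rparr> Mod N) \<pi>"
    unfolding \<pi>_def by unfold_locales (rule N.r_coset_hom_Mod)
  moreover have "{a \<in> K. \<pi> a = \<one>\<^bsub>G\<lparr>carrier := K\<rparr> Mod N\<^esub>} \<subseteq> N"
  proof
    fix a assume a: "a \<in> {a \<in> K. \<pi> a = \<one>\<^bsub>G\<lparr>carrier := K\<rparr> Mod N\<^esub>}"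
    then have "N #>\<^bsub>G\<lparr>carrier := K\<rparr>\<^esub> a = N" by (simp add: \<pi>_def FactGroup_def)
    then show "a \<in> N"
      using a N.rcos_self[OF _ N.is_subgroup, of a] by auto
  qed
  ultimately show thesis
    using that[OF N(3)] finite_subset[OF _ N(2)] by blast
qed

text \<open>Conjugation is invisible in the abelian image, so all conjugates of \<open>e\<close> lie
  in \<open>e\<close> times the finite kernel.\<close>

lemma (in group) conjugates_finite:
  assumes "locally_finite_by_abelian G" "finite S" "S \<subseteq> carrier G" "finite E" "E \<subseteq> generate G S"
  shows "finite {inv s \<otimes> e \<otimes> s | s e. s \<in> generate G S \<and> e \<in> E}"
proof -
  define K where "K = generate G S"
  obtain Q :: "'a set monoid" and \<pi> where Q: "comm_group Q"
    and h: "group_hom (G\<lparr>carrier := K\<rparr>) Q \<pi>" and fin: "finite {a \<in> K. \<pi> a = \<one>\<^bsub>Q\<^esub>}"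
    using lfba_hom[OF assms(1-3) K_def] by blast
  interpret Q: comm_group Q by fact
  interpret h: group_hom "G\<lparr>carrier := K\<rparr>" Q \<pi> by fact
  have sub: "subgroup K G" using generate_is_subgroup[OF assms(3)] by (simp add: K_def)
  note Kc = subgroup.mem_carrier[OF sub] and Km = subgroup.m_closed[OF sub]
    and Ki = subgroup.m_inv_closed[OF sub]
  have hm: "\<pi> (a \<otimes> b) = \<pi> a \<otimes>\<^bsub>Q\<^esub> \<pi> b" "\<pi> a \<in> carrier Q" if "a \<in> K" "b \<in> K" for a b
    using h.hom_mult[of a b] h.hom_closed[of a] that by auto
  have "inv s \<otimes> e \<otimes> s \<in> (\<lambda>n. e \<otimes> n) ` {a \<in> K. \<pi> a = \<one>\<^bsub>Q\<^esub>}" if s: "s \<in> K" and e: "e \<in> K" for s e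
  proof -
    let ?x = "inv s \<otimes> e \<otimes> s"
    have x: "?x \<in> K" using s e Km Ki by auto
    have n: "inv e \<otimes> ?x \<in> K" using x e Km Ki by auto
    have "s \<otimes> ?x = e \<otimes> s" using Kc s e by (simp add: m_assoc[symmetric])
    then have "\<pi> s \<otimes>\<^bsub>Q\<^esub> \<pi> ?x = \<pi> e \<otimes>\<^bsub>Q\<^esub> \<pi> s" using hm s e x by metis
    also have "\<dots> = \<pi> s \<otimes>\<^bsub>Q\<^esub> \<pi> e" using hm(2)[OF s s] hm(2)[OF e e] by (simp add: Q.m_comm)
    finally have px: "\<pi> ?x = \<pi> e" using hm(2)[OF s s] hm(2)[OF e e] hm(2)[OF x x] by simp
    have ex: "e \<otimes> (inv e \<otimes> ?x) = ?x" using Kc e x by (simp add: m_assoc[symmetric])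
    then have "\<pi> e \<otimes>\<^bsub>Q\<^esub> \<pi> (inv e \<otimes> ?x) = \<pi> e" using hm(1)[OF e n] px by simp
    then have "\<pi> (inv e \<otimes> ?x) = \<one>\<^bsub>Q\<^esub>"
      using hm(2)[OF e e] hm(2)[OF n n] by simp
    then show ?thesis using n ex by (intro image_eqI[where x = "inv e \<otimes> ?x"]) simp_all
  qed
  then have "{inv s \<otimes> e \<otimes> s | s e. s \<in> K \<and> e \<in> E} \<subseteq> (\<Union>e\<in>E. (\<lambda>n. e \<otimes> n) ` {a \<in> K. \<pi> a = \<one>\<^bsub>Q\<^esub>})"
    using assms(5) unfolding K_def[symmetric] by blast
  then show ?thesis
    unfolding K_def[symmetric] by (rule finite_subset) (use assms(4) fin in auto)
qed

text \<open>The conjugates of \<open>b\<close> by the powers of \<open>a\<close> are finitely many,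
  so two exponents give the same conjugate; their difference is the required
  \<open>k\<close>.\<close>

lemma (in group) power_commutes:
  assumes lf: "locally_finite_by_abelian G" and ab: "a \<in> carrier G" "b \<in> carrier G"
  obtains k :: nat where "k > 0" "a [^] k \<otimes> b = b \<otimes> a [^] k"
proof -
  define K where "K = generate G {a, b}"
  have sub: "subgroup K G" using generate_is_subgroup[of "{a, b}"] ab by (simp add: K_def)
  have K: "a \<in> K" "b \<in> K" by (auto simp: K_def intro: generate.incl)
  have aK: "a [^] n \<in> K" for n :: nat
    by (induction n) (use K subgroup.one_closed[OF sub] subgroup.m_closed[OF sub] in auto)
  have "finite {inv s \<otimes> e \<otimes> s | s e. s \<in> K \<and> e \<in> {b}}"
    using conjugates_finite[OF lf, of "{a, b}" "{b}"] ab K by (simp add: K_def)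
  then have "finite (range (\<lambda>n::nat. inv (a [^] n) \<otimes> b \<otimes> a [^] n))"
    by (rule rev_finite_subset) (use aK in blast)
  then have "\<not> inj (\<lambda>n::nat. inv (a [^] n) \<otimes> b \<otimes> a [^] n)"
    using finite_imageD infinite_UNIV_nat by blast
  then obtain i j :: nat where ij: "i < j"
    "inv (a [^] i) \<otimes> b \<otimes> a [^] i = inv (a [^] j) \<otimes> b \<otimes> a [^] j"
    unfolding inj_def by (metis nat_neq_iff)
  define k where "k = j - i"
  have j: "j = k + i" using ij by (simp add: k_def)
  let ?u = "a [^] i" and ?v = "a [^] k"
  have uv: "?u \<in> carrier G" "?v \<in> carrier G" using ab by auto
  have aj: "a [^] j = ?v \<otimes> ?u" unfolding j using ab by (simp add: nat_pow_mult)
  have "inv ?u \<otimes> b \<otimes> ?u = inv ?u \<otimes> (inv ?v \<otimes> b \<otimes> ?v) \<otimes> ?u"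
    using ij(2) uv ab unfolding aj by (simp add: inv_mult_group m_assoc)
  then have "b = inv ?v \<otimes> b \<otimes> ?v" using uv ab by simp
  then have "?v \<otimes> b = b \<otimes> ?v"
    using uv ab by (metis cancel_inv(1) m_assoc m_closed inv_closed)
  then show thesis using that[of k] ij by (simp add: k_def)
qed

text \<open>In the abelian image every word can be sorted into a power of \<open>x\<close>, a power
  of \<open>g\<close> and an element of the image of the old subgroup. The exponent of
  \<open>g\<close> can be reduced modulo \<open>k\<close>, and the kernel is finite, so finitely
  many middle factors remain. Putting \<open>x\<close> or \<open>g\<close> equal to
  \<open>\<one>\<close> gives the two pure cases of a finite and of an infinite cyclic
  extension.\<close>

lemma (in group) double_coset_cover:
  assumes lf: "locally_finite_by_abelian G" and S: "finite S" "S \<subseteq> carrier G"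
    and xg: "x \<in> carrier G" "g \<in> carrier G" and k: "0 < k" "g [^] (k::int) \<in> generate G S"
  obtains \<Phi> where "finite \<Phi>" "\<Phi> \<subseteq> generate G (S \<union> {x, g})"
    and "\<And>a. a \<in> generate G (S \<union> {x, g}) \<Longrightarrow>
      \<exists>z::int. \<exists>\<phi>\<in>\<Phi>. \<exists>d\<in>generate G S. a = x [^] z \<otimes> \<phi> \<otimes> d"
proof -
  define D where "D = generate G S"
  define K where "K = generate G (S \<union> {x, g})"
  obtain Q :: "'a set monoid" and \<pi> where Q: "comm_group Q"
    and h: "group_hom (G\<lparr>carrier := K\<rparr>) Q \<pi>" and fin: "finite {a \<in> K. \<pi> a = \<one>\<^bsub>Q\<^esub>}"
    using lfba_hom[OF lf _ _ K_def] S xg by blast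
  interpret Q: comm_group Q by fact
  interpret h: group_hom "G\<lparr>carrier := K\<rparr>" Q \<pi> by fact
  have sub: "subgroup K G" using generate_is_subgroup[of "S \<union> {x, g}"] S xg by (simp add: K_def)
  have subD: "subgroup D G" using generate_is_subgroup[of "S"] S by (simp add: D_def)
  have DK: "D \<subseteq> K" unfolding D_def K_def by (rule mono_generate) auto
  note Kc = subgroup.mem_carrier[OF sub] and Km = subgroup.m_closed[OF sub]
    and Ki = subgroup.m_inv_closed[OF sub] and Kp = subgroup_int_pow_closed[OF sub]
  have xgK: "x \<in> K" "g \<in> K" by (auto simp: K_def intro: generate.incl)
  have hm: "\<pi> (a \<otimes> b) = \<pi> a \<otimes>\<^bsub>Q\<^esub> \<pi> b" if "a \<in> K" "b \<in> K" for a b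
    using h.hom_mult[of a b] that by auto
  have hc: "\<pi> a \<in> carrier Q" if "a \<in> K" for a
    using h.hom_closed[of a] that by auto
  have h1: "\<pi> \<one> = \<one>\<^bsub>Q\<^esub>" using h.hom_one by simp
  have hp: "\<pi> (a [^] (n::int)) = \<pi> a [^]\<^bsub>Q\<^esub> n" if "a \<in> K" for a n
    using group_hom.hom_int_pow[OF h, of a n] that
    unfolding int_pow_consistent[OF sub that, of n, symmetric] by simp
  have oneD: "\<one> \<in> D" using subgroup.one_closed[OF subD] .
  have xi: "x [^] (-1::int) = inv x" "g [^] (-1::int) = inv g"
    using int_pow_neg[OF xg(1), of 1] int_pow_neg[OF xg(2), of 1] xg by simp_all
  have q: "\<pi> x \<in> carrier Q" "\<pi> g \<in> carrier Q" "\<pi> (inv x) \<in> carrier Q" "\<pi> (inv g) \<in> carrier Q"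
    using hc Ki xgK by simp_all
  note ss = int_pow_0 int_pow_1 xi h1 Q.l_one Q.r_one Q.one_closed q xg
  have rep: "\<exists>(z::int) (i::int). \<exists>d\<in>D. \<pi> a = \<pi> (x [^] z) \<otimes>\<^bsub>Q\<^esub> \<pi> (g [^] i) \<otimes>\<^bsub>Q\<^esub> \<pi> d"
    if "a \<in> generate G (S \<union> {x, g})" for a
    using that
  proof (induction rule: generate.induct)
    case one
    have "\<pi> \<one> = \<pi> (x [^] (0::int)) \<otimes>\<^bsub>Q\<^esub> \<pi> (g [^] (0::int)) \<otimes>\<^bsub>Q\<^esub> \<pi> \<one>"
      by (simp only: ss)
    then show ?case using oneD by blast
  next
    case (incl a)
    then consider "a \<in> S" | "a = x" | "a = g" by blast
    then show ?case
    proof cases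
      case 1
      then have a: "a \<in> D" by (simp add: D_def generate.incl)
      have "\<pi> a = \<pi> (x [^] (0::int)) \<otimes>\<^bsub>Q\<^esub> \<pi> (g [^] (0::int)) \<otimes>\<^bsub>Q\<^esub> \<pi> a"
        using hc[of a] a DK by (simp only: ss subsetD)
      then show ?thesis using a by blast
    next
      case 2
      have "\<pi> a = \<pi> (x [^] (1::int)) \<otimes>\<^bsub>Q\<^esub> \<pi> (g [^] (0::int)) \<otimes>\<^bsub>Q\<^esub> \<pi> \<one>"
        unfolding 2 by (simp only: ss)
      then show ?thesis using oneD by blast
    next
      case 3
      have "\<pi> a = \<pi> (x [^] (0::int)) \<otimes>\<^bsub>Q\<^esub> \<pi> (g [^] (1::int)) \<otimes>\<^bsub>Q\<^esub> \<pi> \<one>"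
        unfolding 3 by (simp only: ss)
      then show ?thesis using oneD by blast
    qed
  next
    case (inv a)
    then consider "a \<in> S" | "a = x" | "a = g" by blast
    then show ?case
    proof cases
      case 1
      then have a: "inv a \<in> D" by (simp add: D_def generate.inv)
      have "\<pi> (inv a) = \<pi> (x [^] (0::int)) \<otimes>\<^bsub>Q\<^esub> \<pi> (g [^] (0::int)) \<otimes>\<^bsub>Q\<^esub> \<pi> (inv a)"
        using hc[of "inv a"] a DK by (simp only: ss subsetD)
      then show ?thesis using a by blast
    next
      case 2
      have "\<pi> (inv a) = \<pi> (x [^] (-1::int)) \<otimes>\<^bsub>Q\<^esub> \<pi> (g [^] (0::int)) \<otimes>\<^bsub>Q\<^esub> \<pi> \<one>"
        unfolding 2 by (simp only: ss)
      then show ?thesis using oneD by blast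
    next
      case 3
      have "\<pi> (inv a) = \<pi> (x [^] (0::int)) \<otimes>\<^bsub>Q\<^esub> \<pi> (g [^] (-1::int)) \<otimes>\<^bsub>Q\<^esub> \<pi> \<one>"
        unfolding 3 by (simp only: ss)
      then show ?thesis using oneD by blast
    qed
  next
    case (eng a b)
    obtain z i d where 1: "d \<in> D" "\<pi> a = \<pi> (x [^] (z::int)) \<otimes>\<^bsub>Q\<^esub> \<pi> (g [^] (i::int)) \<otimes>\<^bsub>Q\<^esub> \<pi> d"
      using eng by blast
    obtain z' i' d' where 2: "d' \<in> D" "\<pi> b = \<pi> (x [^] (z'::int)) \<otimes>\<^bsub>Q\<^esub> \<pi> (g [^] (i'::int)) \<otimes>\<^bsub>Q\<^esub> \<pi> d'"
      using eng by blast
    have ab: "a \<in> K" "b \<in> K" using eng by (auto simp: K_def)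
    have dK: "d \<in> K" "d' \<in> K" using 1 2 DK by auto
    have "\<pi> (a \<otimes> b) = (\<pi> (x [^] z) \<otimes>\<^bsub>Q\<^esub> \<pi> (x [^] z')) \<otimes>\<^bsub>Q\<^esub> (\<pi> (g [^] i) \<otimes>\<^bsub>Q\<^esub> \<pi> (g [^] i')) \<otimes>\<^bsub>Q\<^esub> (\<pi> d \<otimes>\<^bsub>Q\<^esub> \<pi> d')"
      unfolding hm[OF ab] 1(2) 2(2)
      using hc[OF dK(1)] hc[OF dK(2)] hc[OF Kp[OF xgK(1)]] hc[OF Kp[OF xgK(2)]]
      by (simp add: Q.m_ac)
    also have "\<dots> = \<pi> (x [^] (z + z')) \<otimes>\<^bsub>Q\<^esub> \<pi> (g [^] (i + i')) \<otimes>\<^bsub>Q\<^esub> \<pi> (d \<otimes> d')"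
      using xg by (simp add: int_pow_mult hm Kp xgK dK)
    finally show ?case
      using subgroup.m_closed[OF subD 1(1) 2(1)] by blast
  qed
  \<comment> \<open>A remainder of the exponent of \<open>g\<close> together with an error from the
    kernel.\<close>
  define \<Phi> where "\<Phi> = (\<lambda>(r::int, n). g [^] r \<otimes> n) ` ({0..<k} \<times> {a \<in> K. \<pi> a = \<one>\<^bsub>Q\<^esub>})"
  have "\<exists>z::int. \<exists>\<phi>\<in>\<Phi>. \<exists>d\<in>D. a = x [^] z \<otimes> \<phi> \<otimes> d" if a: "a \<in> K" for a
  proof -
    obtain z i :: int and d where d: "d \<in> D"
      "\<pi> a = \<pi> (x [^] z) \<otimes>\<^bsub>Q\<^esub> \<pi> (g [^] i) \<otimes>\<^bsub>Q\<^esub> \<pi> d"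
      using rep a unfolding K_def by blast
    define r where "r = i mod k"
    define d' where "d' = (g [^] k) [^] (i div k) \<otimes> d"
    have gk: "(g [^] k) [^] (i div k) \<in> D"
      using subgroup_int_pow_closed[OF subD] k by (simp add: D_def)
    have d': "d' \<in> D" unfolding d'_def using gk d subgroup.m_closed[OF subD] by blast
    have gi: "g [^] i = g [^] r \<otimes> (g [^] k) [^] (i div k)"
    proof -
      have "g [^] (r + k * (i div k)) = g [^] r \<otimes> g [^] (k * (i div k))"
        using xg by (rule_tac int_pow_mult)
      moreover have "r + k * (i div k) = i" by (simp add: r_def)
      ultimately show ?thesis using xg by (simp add: int_pow_pow)
    qed
    have dK: "d \<in> K" "d' \<in> K" "(g [^] k) [^] (i div k) \<in> K" using d d' gk DK by auto
    let ?X = "x [^] z" and ?R = "g [^] r"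
    have XR: "?X \<in> K" "?R \<in> K" using Kp xgK by auto
    have pa: "\<pi> a = \<pi> ?X \<otimes>\<^bsub>Q\<^esub> \<pi> ?R \<otimes>\<^bsub>Q\<^esub> \<pi> d'"
      unfolding d(2) gi d'_def using XR dK hc[OF XR(1)] hc[OF XR(2)] hc[OF dK(1)] hc[OF dK(3)]
      by (simp only: hm Q.m_assoc Q.m_closed)
    \<comment> \<open>The factor missing in the decomposition of \<open>a\<close>, solved for at the
      place right after the power of \<open>g\<close>. Its image is trivial because the sorted
      product already has the image of \<open>a\<close>.\<close>
    define n where "n = inv ?R \<otimes> (inv ?X \<otimes> a \<otimes> inv d')"
    have n: "n \<in> K" unfolding n_def using XR dK a Km Ki by auto
    have an: "a = ?X \<otimes> (?R \<otimes> n) \<otimes> d'"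
      unfolding n_def using Kc[OF XR(1)] Kc[OF XR(2)] Kc[OF dK(2)] Kc[OF a]
      by (simp add: m_assoc cancel_inv)
    have "\<pi> a = (\<pi> ?X \<otimes>\<^bsub>Q\<^esub> \<pi> ?R \<otimes>\<^bsub>Q\<^esub> \<pi> d') \<otimes>\<^bsub>Q\<^esub> \<pi> n"
    proof -
      have "\<pi> a = \<pi> (?X \<otimes> (?R \<otimes> n) \<otimes> d')" using an by simp
      also have "\<dots> = \<pi> ?X \<otimes>\<^bsub>Q\<^esub> (\<pi> ?R \<otimes>\<^bsub>Q\<^esub> \<pi> n) \<otimes>\<^bsub>Q\<^esub> \<pi> d'"
        using XR n dK by (simp only: hm Km)
      also have "\<dots> = (\<pi> ?X \<otimes>\<^bsub>Q\<^esub> \<pi> ?R \<otimes>\<^bsub>Q\<^esub> \<pi> d') \<otimes>\<^bsub>Q\<^esub> \<pi> n"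
        using hc[OF XR(1)] hc[OF XR(2)] hc[OF n] hc[OF dK(2)] by (simp only: Q.m_ac Q.m_closed)
      finally show ?thesis .
    qed
    then have "(\<pi> ?X \<otimes>\<^bsub>Q\<^esub> \<pi> ?R \<otimes>\<^bsub>Q\<^esub> \<pi> d') \<otimes>\<^bsub>Q\<^esub> \<pi> n = \<pi> ?X \<otimes>\<^bsub>Q\<^esub> \<pi> ?R \<otimes>\<^bsub>Q\<^esub> \<pi> d'"
      using pa by simp
    then have "\<pi> n = \<one>\<^bsub>Q\<^esub>"
      using hc[OF XR(1)] hc[OF XR(2)] hc[OF n] hc[OF dK(2)] by simp
    then have "?R \<otimes> n \<in> \<Phi>"
      unfolding \<Phi>_def r_def using n k by auto
    then show ?thesis using an d' by blast
  qed
  moreover have "finite \<Phi>" unfolding \<Phi>_def using fin by simp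
  moreover have "\<Phi> \<subseteq> K" unfolding \<Phi>_def using Kp[OF xgK(2)] Km by auto
  ultimately show thesis using that unfolding D_def K_def by blast
qed

section \<open>Cosets and transversals\<close>

text \<open>Left cosets fit right multiplication in coarse maps and left transversals in charts. The
  index is defined with right cosets; \<open>subgroup_index_eq\<close> connects the two.\<close>

definition lcosets :: "('a, 'c) monoid_scheme \<Rightarrow> 'a set \<Rightarrow> 'a set \<Rightarrow> 'a set set" where
  "lcosets G K D = (\<lambda>a. a <#\<^bsub>G\<^esub> D) ` K"

lemma (in group) mem_l_coset_iff:
  assumes "subgroup D G" "a \<in> carrier G" "b \<in> carrier G"
  shows "b \<in> a <# D \<longleftrightarrow> inv a \<otimes> b \<in> D"
proof
  assume "b \<in> a <# D"
  then obtain d where "d \<in> D" "b = a \<otimes> d" by (auto simp: l_coset_def)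
  then show "inv a \<otimes> b \<in> D"
    using assms subgroup.mem_carrier[OF assms(1)] by (simp add: m_assoc[symmetric])
next
  assume "inv a \<otimes> b \<in> D"
  moreover have "b = a \<otimes> (inv a \<otimes> b)" using assms by (simp add: m_assoc[symmetric])
  ultimately show "b \<in> a <# D" unfolding l_coset_def by blast
qed

lemma (in group) l_coset_eq_iff:
  assumes "subgroup D G" "a \<in> carrier G" "b \<in> carrier G"
  shows "a <# D = b <# D \<longleftrightarrow> inv a \<otimes> b \<in> D"
proof
  assume "a <# D = b <# D"
  moreover have "b \<in> b <# D"
    using mem_l_coset_iff[OF assms(1,3,3)] subgroup.one_closed[OF assms(1)] assms by simp
  ultimately show "inv a \<otimes> b \<in> D" using mem_l_coset_iff[OF assms] by simp
next
  assume "inv a \<otimes> b \<in> D"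
  then have "b \<in> a <# D" using mem_l_coset_iff[OF assms] by simp
  then show "a <# D = b <# D" using l_repr_independence[OF _ assms(2,1)] by blast
qed

lemma (in group) left_transversal:
  assumes D: "subgroup D G" and K: "subgroup K G" "D \<subseteq> K"
  obtains T where "T \<subseteq> K" "\<one> \<in> T" "bij_betw (\<lambda>t. t <# D) T (lcosets G K D)"
    "\<And>a. a \<in> K \<Longrightarrow> \<exists>t\<in>T. inv t \<otimes> a \<in> D"
    "\<And>t t'. t \<in> T \<Longrightarrow> t' \<in> T \<Longrightarrow> inv t \<otimes> t' \<in> D \<Longrightarrow> t = t'"
proof -
  note Kc = subgroup.mem_carrier[OF K(1)]
  \<comment> \<open>The trivial coset is represented by \<open>\<one>\<close>, so that a chart built
    from the transversal restricts to the given chart on \<open>D\<close>.\<close>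
  define rep where "rep c = (if c = D then \<one> else (SOME t. t \<in> K \<and> t <# D = c))" for c
  have one: "\<one> <# D = D" using lcos_mult_one subgroup.subset[OF D] by blast
  have rep: "rep c \<in> K \<and> rep c <# D = c" if "c \<in> lcosets G K D" for c
  proof (cases "c = D")
    case True then show ?thesis using one subgroup.one_closed[OF K(1)] by (simp add: rep_def)
  next
    case False
    have "\<exists>t. t \<in> K \<and> t <# D = c" using that by (auto simp: lcosets_def)
    from someI_ex[OF this] show ?thesis using False by (simp add: rep_def)
  qed
  define T where "T = rep ` lcosets G K D"
  have "T \<subseteq> K" using rep by (auto simp: T_def)
  moreover have "\<one> \<in> T"
  proof -
    have "D \<in> lcosets G K D" unfolding lcosets_def using one subgroup.one_closed[OF K(1)] by blast
    moreover have "rep D = \<one>" by (simp add: rep_def)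
    ultimately show ?thesis unfolding T_def by (metis imageI)
  qed
  moreover have bij: "bij_betw (\<lambda>t. t <# D) T (lcosets G K D)"
    by (rule bij_betwI[where g = rep]) (use rep in \<open>auto simp: T_def\<close>)
  moreover have "\<exists>t\<in>T. inv t \<otimes> a \<in> D" if a: "a \<in> K" for a
  proof -
    have "a <# D \<in> lcosets G K D" using a by (auto simp: lcosets_def)
    then obtain t where t: "t \<in> T" "t <# D = a <# D" using bij unfolding bij_betw_def by (metis imageE)
    then show ?thesis using l_coset_eq_iff[OF D _ Kc[OF a]] \<open>T \<subseteq> K\<close> Kc by blast
  qed
  moreover have "t = t'" if "t \<in> T" "t' \<in> T" "inv t \<otimes> t' \<in> D" for t t'
    using l_coset_eq_iff[OF D, of t t'] that \<open>T \<subseteq> K\<close> Kc bij by (auto simp: bij_betw_def dest: inj_onD)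
  ultimately show thesis using that by blast
qed

text \<open>Used to number a finite set of representatives in such a way that \<open>\<one>\<close>
  receives the zero coordinates.\<close>

lemma bij_betw_with_basepoint:
  assumes "finite A" "finite B" "card A = card B" "a \<in> A" "b \<in> B"
  obtains h where "bij_betw h A B" "h a = b"
proof -
  have "card (A - {a}) = card (B - {b})" using assms by simp
  then obtain g where g: "bij_betw g (A - {a}) (B - {b})"
    using assms finite_same_card_bij[of "A - {a}" "B - {b}"] by auto
  define h where "h = g(a := b)"
  have "bij_betw h (A - {a}) (B - {b})" using g by (rule bij_betw_cong[THEN iffD1, rotated]) (simp add: h_def)
  then have "bij_betw h (A - {a} \<union> {a}) (B - {b} \<union> {h a})"
    by (intro notIn_Un_bij_betw) (auto simp: h_def)
  moreover have "A - {a} \<union> {a} = A" "B - {b} \<union> {h a} = B" using assms by (auto simp: h_def)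
  ultimately show thesis using that[of h] by (simp add: h_def)
qed

section \<open>Extensions of finite index and extensions by an infinite cyclic direction\<close>

text \<open>The transversal is finite, so any bijection onto the new finite block that sends
  \<open>\<one>\<close> to zero is good enough: only finitely many displacements and corrections
  occur. The structure of the quotient is irrelevant, only its cardinality counts.\<close>

lemma (in group) chart_finite_step:
  fixes F :: "'a \<Rightarrow> 'i \<Rightarrow> int"
  assumes lf: "locally_finite_by_abelian G" and S: "finite S" "S \<subseteq> carrier G"
    and D: "subgroup D G" and K: "K = generate G S" "D \<subseteq> K"
    and F: "coarse_chart G D F C" and C0: "\<And>i. 0 \<in> C i" and B0: "\<And>i. 0 \<in> B i"
    and disj: "\<And>i. C i = {0} \<or> B i = {0}"
    and fin: "finite (fsupp B)" "finite (lcosets G K D)" "card (lcosets G K D) = card (fsupp B)"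
  shows "\<exists>F'. coarse_chart G K F' (\<lambda>i. if B i = {0} then C i else B i) \<and> extends_chart G D F C K F'"
proof -
  have sK: "subgroup K G" using K(1) S generate_is_subgroup by simp
  obtain T where T: "T \<subseteq> K" "\<one> \<in> T" "bij_betw (\<lambda>t. t <# D) T (lcosets G K D)"
    "\<And>a. a \<in> K \<Longrightarrow> \<exists>t\<in>T. inv t \<otimes> a \<in> D"
    "\<And>t t'. t \<in> T \<Longrightarrow> t' \<in> T \<Longrightarrow> inv t \<otimes> t' \<in> D \<Longrightarrow> t = t'"
    using left_transversal[OF D sK K(2)] by blast
  have fT: "finite T" "card T = card (fsupp B)"
    using T(3) fin bij_betw_finite bij_betw_same_card by fastforce+
  have z: "(\<lambda>i. 0) \<in> fsupp B" using B0 by (simp add: fsupp_def)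
  obtain \<tau> where \<tau>: "bij_betw \<tau> T (fsupp B)" "\<tau> \<one> = (\<lambda>i. 0)"
    using bij_betw_with_basepoint[OF fT(1) fin(1) fT(2) T(2) z] by blast
  have "\<exists>J n. finite J \<and> (\<forall>p\<in>T \<times> T. \<forall>u\<in>UNIV::unit set. near J n (\<tau> (fst p)) (\<tau> (snd p)))"
  proof (rule near_uniform)
    fix p assume "p \<in> T \<times> T"
    then have "\<tau> (fst p) \<in> fsupp B" "\<tau> (snd p) \<in> fsupp B" using \<tau>(1) by (auto simp: bij_betw_def)
    then show "\<exists>J n. finite J \<and> (\<forall>b\<in>UNIV. near J n (\<tau> (fst p)) (\<tau> (snd p)))"
      using near_pair[of "\<tau> (fst p)" "\<tau> (snd p)"] by (simp add: fsupp_def)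
  qed (use fT in auto)
  then obtain J n where J: "finite J" "\<And>t t'. t \<in> T \<Longrightarrow> t' \<in> T \<Longrightarrow> near J n (\<tau> t) (\<tau> t')"
    by fastforce
  show ?thesis
  proof (rule chart_step[OF D sK K(2) T(1) T(4,5) F C0 \<tau>(1) T(2) \<tau>(2) disj])
    fix E assume E: "finite E" "E \<subseteq> K"
    have "{inv s \<otimes> e \<otimes> s |s e. s \<in> D \<and> e \<in> E} \<subseteq> {inv s \<otimes> e \<otimes> s |s e. s \<in> K \<and> e \<in> E}"
      using K(2) by blast
    then show "finite {inv s \<otimes> e \<otimes> s |s e. s \<in> D \<and> e \<in> E}"
      using conjugates_finite[OF lf S E(1)] E(2) K(1) by (auto intro: finite_subset)
    \<comment> \<open>All possible corrections at once; the intersection keeps those that lie in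
      \<open>D\<close>.\<close>
    define A where "A = D \<inter> (\<lambda>(t', t, e). inv t' \<otimes> (t \<otimes> e)) ` (T \<times> T \<times> E)"
    have "finite A" using fT E by (simp add: A_def)
    moreover have "\<exists>t'\<in>T. inv t' \<otimes> (t \<otimes> e) \<in> A \<and> near J n (\<tau> t) (\<tau> t')"
      if te: "t \<in> T" "e \<in> E" for t e
    proof -
      have "t \<otimes> e \<in> K" using te T(1) E(2) subgroup.m_closed[OF sK] by blast
      then obtain t' where t': "t' \<in> T" "inv t' \<otimes> (t \<otimes> e) \<in> D" using T(4) by blast
      then have "inv t' \<otimes> (t \<otimes> e) \<in> A"
        using te unfolding A_def by (auto intro!: image_eqI[of _ _ "(t', t, e)"])
      then show ?thesis using t' J te by blast
    qed
    ultimately show "\<exists>A J n. finite A \<and> A \<subseteq> D \<and> finite J \<and>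
       (\<forall>t\<in>T. \<forall>e\<in>E. \<exists>t'\<in>T. inv t' \<otimes> (t \<otimes> e) \<in> A \<and> near J n (\<tau> t) (\<tau> t'))"
      using J(1) by (intro exI[of _ A] exI[of _ J] exI[of _ n]) (auto simp: A_def)
  next
    fix J :: "'i set" and n :: int assume "finite J"
    show "\<exists>E. finite E \<and> E \<subseteq> K \<and> (\<forall>t\<in>T. \<forall>t'\<in>T. near J n (\<tau> t) (\<tau> t') \<longrightarrow> inv t \<otimes> t' \<in> E)"
      using fT(1) T(1) subgroup.m_closed[OF sK] subgroup.m_inv_closed[OF sK]
      by (intro exI[of _ "(\<lambda>(t, t'). inv t \<otimes> t') ` (T \<times> T)"]) (auto simp: subset_iff)
  qed
qed

lemma (in group) conj_int_pow:
  assumes "a \<in> carrier G" "b \<in> carrier G"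
  shows "inv a \<otimes> b [^] (n::int) \<otimes> a = (inv a \<otimes> b \<otimes> a) [^] n"
proof -
  have h: "group_hom G G (\<lambda>b. inv a \<otimes> b \<otimes> a)"
  proof unfold_locales
    show "(\<lambda>b. inv a \<otimes> b \<otimes> a) \<in> hom G G"
    proof (rule homI)
      fix x y assume xy: "x \<in> carrier G" "y \<in> carrier G"
      have "inv a \<otimes> x \<otimes> a \<otimes> (inv a \<otimes> y \<otimes> a) = inv a \<otimes> x \<otimes> (a \<otimes> inv a) \<otimes> y \<otimes> a"
        using xy assms by (simp only: m_assoc inv_closed m_closed)
      then show "inv a \<otimes> (x \<otimes> y) \<otimes> a = inv a \<otimes> x \<otimes> a \<otimes> (inv a \<otimes> y \<otimes> a)"
        using xy assms by (simp add: m_assoc)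
    qed (use assms in auto)
  qed
  show ?thesis using group_hom.hom_int_pow[OF h assms(2), of n] .
qed

text \<open>Rounding does no harm because the bound \<open>n\<close> may be replaced by the multiple
  \<open>n * q\<close>, which passes through the division exactly.\<close>

lemma div_near: "\<bar>a div q - b div q\<bar> \<le> n" if "\<bar>a - b\<bar> \<le> n" "0 < q" for a b q n :: int
proof -
  have le: "a div q \<le> b div q + n" if "a \<le> b + n" "0 \<le> n" for a b
  proof -
    have "n \<le> n * q" using that \<open>0 < q\<close> by (simp add: mult_le_cancel_left1)
    then have "a div q \<le> (b + n * q) div q" using that \<open>0 < q\<close> by (intro zdiv_mono1) auto
    then show ?thesis using \<open>0 < q\<close> by simp
  qed
  have *: "a \<le> b + n" "b \<le> a + n" "0 \<le> n" using that by linarith+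
  show ?thesis using le[OF *(1,3)] le[OF *(2,3)] by (simp add: abs_le_iff)
qed

text \<open>The transversal is \<open>{x [^] z \<otimes> \<phi>}\<close> with \<open>\<phi>\<close> ranging over the finite set \<open>\<Phi>\<close> of representatives of the
  double cosets of \<open>\<langle>x\<rangle>\<close> and \<open>D\<close>; numbering \<open>\<Phi>\<close> by \<open>\<iota>\<close>, the element \<open>x [^] z \<otimes> \<phi>\<close> gets the single
  integer coordinate \<open>z * card \<Phi> + \<iota> \<phi>\<close>, so the finite part of the index is absorbed.\<close>

lemma (in group) chart_infinite_step:
  fixes F :: "'a \<Rightarrow> 'i \<Rightarrow> int"
  assumes lf: "locally_finite_by_abelian G" and S: "finite S" "S \<subseteq> carrier G"
    and D: "D = generate G S" and K: "K = generate G (S \<union> {x, g})"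
    and xg: "x \<in> carrier G" "g \<in> carrier G" and k: "0 < k" "g [^] (k::int) \<in> D"
    and indep: "\<And>z::int. x [^] z \<in> D \<Longrightarrow> z = 0"
    and F: "coarse_chart G D F C" and C0: "\<And>i. 0 \<in> C i" and Cj: "C j = {0}"
  shows "\<exists>F'. coarse_chart G K F' (C(j := UNIV)) \<and> extends_chart G D F C K F'"
proof -
  have SK: "finite (S \<union> {x, g})" "S \<union> {x, g} \<subseteq> carrier G" using S xg by auto
  have sK: "subgroup K G" using K SK generate_is_subgroup by simp
  have sD: "subgroup D G" using D S generate_is_subgroup by simp
  have DK: "D \<subseteq> K" unfolding D K by (rule mono_generate) auto
  note Kc = subgroup.mem_carrier[OF sK] and Km = subgroup.m_closed[OF sK]
    and Ki = subgroup.m_inv_closed[OF sK] and Kp = subgroup_int_pow_closed[OF sK]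
  note Dc = subgroup.mem_carrier[OF sD] and Dm = subgroup.m_closed[OF sD]
    and Di = subgroup.m_inv_closed[OF sD]
  have xK: "x \<in> K" by (auto simp: K intro: generate.incl)
  have xz: "x [^] (z::int) \<in> carrier G" for z using xg by simp
  have xadd: "x [^] (z + w) = x [^] z \<otimes> x [^] w" for z w :: int using xg by (simp add: int_pow_mult)
  obtain \<Phi>0 where \<Phi>0: "finite \<Phi>0" "\<Phi>0 \<subseteq> K"
    "\<And>a. a \<in> K \<Longrightarrow> \<exists>z::int. \<exists>\<phi>\<in>\<Phi>0. \<exists>d\<in>D. a = x [^] z \<otimes> \<phi> \<otimes> d"
    using double_coset_cover[OF lf S xg k[unfolded D]] unfolding D K by metis
  \<comment> \<open>The double coset of \<open>a\<close> for the cyclic group of \<open>x\<close> on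
    the left and \<open>D\<close> on the right. These classes are disjoint or equal, so the cover
    \<open>\<Phi>0\<close> can be thinned to one representative per class.\<close>
  define cls where "cls a = {x [^] z \<otimes> a \<otimes> d | (z::int) d. d \<in> D}" for a
  have cls_self: "a \<in> cls a" if "a \<in> carrier G" for a
    unfolding cls_def using that subgroup.one_closed[OF sD]
    by (auto intro!: exI[of _ "0::int"] exI[of _ \<one>])
  have cls_sub: "cls c \<subseteq> cls a" if a: "a \<in> carrier G" and c: "c \<in> cls a" for a c
  proof
    fix b assume "b \<in> cls c"
    then obtain z d where b: "d \<in> D" "b = x [^] (z::int) \<otimes> c \<otimes> d" by (auto simp: cls_def)
    obtain w d' where c': "d' \<in> D" "c = x [^] (w::int) \<otimes> a \<otimes> d'" using c by (auto simp: cls_def)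
    have "b = x [^] (z + w) \<otimes> a \<otimes> (d' \<otimes> d)"
      unfolding b(2) c'(2) xadd using xz a Dc[OF b(1)] Dc[OF c'(1)] by (simp add: m_assoc)
    then show "b \<in> cls a" unfolding cls_def using Dm[OF c'(1) b(1)] by blast
  qed
  have cls_sym: "a \<in> cls c" if a: "a \<in> carrier G" and c: "c \<in> cls a" for a c
  proof -
    obtain w d' where c': "d' \<in> D" "c = x [^] (w::int) \<otimes> a \<otimes> d'" using c by (auto simp: cls_def)
    have "a = x [^] (-w) \<otimes> c \<otimes> inv d'"
      unfolding c'(2) using xg a Dc[OF c'(1)] by (simp add: int_pow_neg m_assoc[symmetric]) (simp add: m_assoc)
    then show ?thesis unfolding cls_def using Di[OF c'(1)] by blast
  qed
  have cls_carrier: "c \<in> carrier G" if "a \<in> carrier G" "c \<in> cls a" for a c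
    using that xz Dc by (auto simp: cls_def)
  have cls_eq: "cls c = cls a" if "a \<in> carrier G" "c \<in> cls a" for a c
    using cls_sub cls_sym cls_carrier that by (metis subset_antisym)
  \<comment> \<open>Again \<open>\<one>\<close> is preferred, so that it lies in
    \<open>\<Phi>\<close> and can be numbered 0.\<close>
  define rep where "rep c = (if \<one> \<in> c then \<one> else (SOME t. t \<in> c))" for c
  have rep: "rep (cls a) \<in> cls a" if "a \<in> carrier G" for a
    using cls_self[OF that] by (auto simp: rep_def intro: someI)
  define \<Phi> where "\<Phi> = (\<lambda>\<phi>. rep (cls \<phi>)) ` \<Phi>0"
  have \<Phi>fin: "finite \<Phi>" using \<Phi>0(1) by (simp add: \<Phi>_def)
  have cK: "c \<in> K" if "a \<in> K" "c \<in> cls a" for a c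
    using that Kp[OF xK] DK Km by (auto simp: cls_def)
  have \<Phi>K: "\<Phi> \<subseteq> K" using rep cK Kc \<Phi>0(2) unfolding \<Phi>_def by blast
  have \<Phi>rep: "\<phi> = \<phi>'" if \<phi>: "\<phi> \<in> \<Phi>" "\<phi>' \<in> \<Phi>" "\<phi>' \<in> cls \<phi>" for \<phi> \<phi>'
  proof -
    have *: "rep (cls \<psi>) = \<psi>" if "\<psi> \<in> \<Phi>" for \<psi>
      using that cls_eq[OF _ rep] \<Phi>0(2) Kc by (auto simp: \<Phi>_def)
    have "cls \<phi>' = cls \<phi>" using cls_eq[OF _ \<phi>(3)] \<Phi>K \<phi>(1) Kc by blast
    then show ?thesis using *[OF \<phi>(1)] *[OF \<phi>(2)] by simp
  qed
  have cover: "\<exists>z::int. \<exists>\<phi>\<in>\<Phi>. \<exists>d\<in>D. a = x [^] z \<otimes> \<phi> \<otimes> d" if a: "a \<in> K" for a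
  proof -
    obtain \<phi>0 where p: "\<phi>0 \<in> \<Phi>0" "a \<in> cls \<phi>0" using \<Phi>0(3)[OF a] by (auto simp: cls_def)
    have pc: "\<phi>0 \<in> carrier G" using p \<Phi>0(2) Kc by blast
    have "a \<in> cls (rep (cls \<phi>0))" using cls_eq[OF pc rep[OF pc]] p(2) by simp
    moreover have "rep (cls \<phi>0) \<in> \<Phi>" using p by (auto simp: \<Phi>_def)
    ultimately show ?thesis unfolding cls_def by blast
  qed
  have one\<Phi>: "\<one> \<in> \<Phi>"
  proof -
    obtain \<phi>0 where p: "\<phi>0 \<in> \<Phi>0" "\<one> \<in> cls \<phi>0"
      using \<Phi>0(3)[OF subgroup.one_closed[OF sK]] by (auto simp: cls_def)
    then have "rep (cls \<phi>0) = \<one>" by (simp add: rep_def)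
    then show ?thesis unfolding \<Phi>_def using p(1) by (metis imageI)
  qed
  define M where "M = int (card \<Phi>)"
  have M: "M > 0" using one\<Phi> \<Phi>fin card_gt_0_iff unfolding M_def by (metis empty_iff of_nat_0_less_iff)
  obtain \<iota> where \<iota>: "bij_betw \<iota> \<Phi> {0..<M}" "\<iota> \<one> = 0"
    by (rule bij_betw_with_basepoint[OF \<Phi>fin _ _ one\<Phi>, of "{0..<M}" 0]) (use M in \<open>auto simp: M_def\<close>)
  define \<kappa> where "\<kappa> = inv_into \<Phi> \<iota>"
  have \<kappa>: "\<kappa> r \<in> \<Phi>" "\<iota> (\<kappa> r) = r" if "0 \<le> r" "r < M" for r
    using that \<iota>(1) unfolding \<kappa>_def by (simp_all add: bij_betw_def inv_into_into f_inv_into_f)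
  have \<iota>r: "0 \<le> \<iota> \<phi>" "\<iota> \<phi> < M" "\<kappa> (\<iota> \<phi>) = \<phi>" if "\<phi> \<in> \<Phi>" for \<phi>
    using that \<iota>(1) bij_betw_inv_into_left[OF \<iota>(1) that] by (auto simp: bij_betw_def \<kappa>_def)
  \<comment> \<open>Enumerates the transversal by the integers: the quotient by \<open>M\<close> is
    the exponent of \<open>x\<close>, the remainder selects the representative in
    \<open>\<Phi>\<close>.\<close>
  define \<beta> where "\<beta> m = x [^] (m div M) \<otimes> \<kappa> (m mod M)" for m :: int
  have \<beta>eq: "\<beta> (z * M + \<iota> \<phi>) = x [^] z \<otimes> \<phi>" if "\<phi> \<in> \<Phi>" for z \<phi>
    using \<iota>r[OF that] M by (simp add: \<beta>_def)
  have \<beta>K: "\<beta> m \<in> K" for m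
    unfolding \<beta>_def using Kp[OF xK] Km \<kappa>(1)[of "m mod M"] \<Phi>K M by auto
  \<comment> \<open>Independence of \<open>x\<close> modulo \<open>D\<close> survives conjugation by
    \<open>\<phi>\<close>, although \<open>D\<close> need not be normal: some positive power
    \<open>x [^] n\<close> commutes with \<open>\<phi>\<close>, so the \<open>n\<close>-th power of
    the conjugate equals \<open>x [^] (n * w)\<close> and lies in \<open>D\<close>.\<close>
  have conj_indep: "w = 0" if p: "\<phi> \<in> carrier G" and w: "inv \<phi> \<otimes> x [^] (w::int) \<otimes> \<phi> \<in> D" for \<phi> w
  proof -
    obtain n :: nat where n: "n > 0" "x [^] n \<otimes> \<phi> = \<phi> \<otimes> x [^] n"
      using power_commutes[OF lf xg(1) p] by blast
    have "inv \<phi> \<otimes> x [^] (int n) \<otimes> \<phi> = x [^] (int n)"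
      using n(2) p xg by (simp add: int_pow_int m_assoc) (simp add: m_assoc[symmetric])
    then have "inv \<phi> \<otimes> x [^] (int n * w) \<otimes> \<phi> = x [^] (int n * w)"
      using conj_int_pow[OF p xz, of "int n" w] xg by (simp add: int_pow_pow)
    moreover have "inv \<phi> \<otimes> x [^] (w * int n) \<otimes> \<phi> \<in> D"
      using conj_int_pow[OF p xz, of w "int n"] xg subgroup_int_pow_closed[OF sD w, of "int n"]
      by (simp add: int_pow_pow)
    ultimately have "x [^] (int n * w) \<in> D" by (simp add: mult.commute)
    then have "int n * w = 0" by (rule indep)
    then show ?thesis using n(1) by simp
  qed
  \<comment> \<open>Equal left cosets of \<open>D\<close> lie in one double coset, which forces
    equal representatives; the exponents then agree by \<open>conj_indep\<close>.\<close>
  have \<beta>uniq: "m = m'" if mm: "inv (\<beta> m) \<otimes> \<beta> m' \<in> D" for m m'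
  proof -
    let ?z = "m div M" and ?z' = "m' div M" and ?p = "\<kappa> (m mod M)" and ?p' = "\<kappa> (m' mod M)"
    have p: "?p \<in> \<Phi>" "?p' \<in> \<Phi>" using \<kappa> M by auto
    have pc: "?p \<in> carrier G" "?p' \<in> carrier G" using p \<Phi>K Kc by auto
    have e: "inv (\<beta> m) \<otimes> \<beta> m' = inv ?p \<otimes> x [^] (?z' - ?z) \<otimes> ?p'"
    proof -
      have "x [^] ?z' = x [^] ?z \<otimes> x [^] (?z' - ?z)" by (simp add: xadd[symmetric])
      then show ?thesis
        unfolding \<beta>_def using pc xz by (simp add: inv_mult_group m_assoc cancel_inv)
    qed
    define d where "d = inv (\<beta> m) \<otimes> \<beta> m'"
    have "?p' = x [^] (?z - ?z') \<otimes> ?p \<otimes> d"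
    proof -
      have "x [^] (?z' - ?z) = inv (x [^] (?z - ?z'))"
        using int_pow_neg[OF xg(1), of "?z - ?z'"] by simp
      then show ?thesis unfolding d_def e using pc xz by (simp add: m_assoc cancel_inv)
    qed
    then have "?p' \<in> cls ?p" unfolding cls_def using mm d_def by blast
    then have pp: "?p = ?p'" using \<Phi>rep p by blast
    then have "inv ?p \<otimes> x [^] (?z' - ?z) \<otimes> ?p \<in> D" using mm unfolding e by simp
    then have "?z' - ?z = 0" by (rule conj_indep[OF pc(1)])
    then have "m div M = m' div M" by simp
    moreover have "m mod M = m' mod M"
    proof -
      have "m mod M = \<iota> ?p" using \<kappa>(2)[of "m mod M"] M by simp
      also have "\<dots> = \<iota> ?p'" using pp by (rule arg_cong)
      also have "\<dots> = m' mod M" using \<kappa>(2)[of "m' mod M"] M by simp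
      finally show ?thesis .
    qed
    ultimately show ?thesis by (metis div_mult_mod_eq)
  qed
  have \<beta>inj: "inj \<beta>"
  proof (rule injI)
    fix m m' assume "\<beta> m = \<beta> m'"
    then have "inv (\<beta> m) \<otimes> \<beta> m' \<in> D" using \<beta>K Kc subgroup.one_closed[OF sD] by simp
    then show "m = m'" by (rule \<beta>uniq)
  qed
  define B where "B = (\<lambda>i. if i = j then UNIV else {0::int})"
  define \<tau> where "\<tau> t = (\<lambda>i. if i = j then inv_into UNIV \<beta> t else 0)" for t
  have \<tau>\<beta>: "\<tau> (\<beta> m) = (\<lambda>i. if i = j then m else 0)" for m
    using inv_f_f[OF \<beta>inj, of m] by (simp add: \<tau>_def fun_eq_iff)
  have \<tau>bij: "bij_betw \<tau> (range \<beta>) (fsupp B)"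
  proof (rule bij_betwI[where g = "\<lambda>y. \<beta> (y j)"])
    show "\<tau> \<in> range \<beta> \<rightarrow> fsupp B" by (auto simp: \<tau>\<beta> fsupp_def B_def)
    show "(\<lambda>y. \<beta> (y j)) \<in> fsupp B \<rightarrow> range \<beta>" by auto
    show "\<beta> (\<tau> t j) = t" if "t \<in> range \<beta>" for t using that by (auto simp: \<tau>\<beta>)
    show "\<tau> (\<beta> (y j)) = y" if "y \<in> fsupp B" for y
      using that by (force simp: \<tau>\<beta> fsupp_def B_def fun_eq_iff split: if_splits)
  qed
  have \<beta>0: "\<beta> 0 = \<one>" using \<beta>eq[OF one\<Phi>, of 0] \<iota>(2) by simp
  have "\<exists>F'. coarse_chart G K F' (\<lambda>i. if B i = {0} then C i else B i) \<and> extends_chart G D F C K F'"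
  proof (rule chart_step[OF sD sK DK, of "range \<beta>" F C \<tau> B])
    show "range \<beta> \<subseteq> K" using \<beta>K by auto
    show "\<exists>t\<in>range \<beta>. inv t \<otimes> a \<in> D" if a: "a \<in> K" for a
    proof -
      obtain z \<phi> d where zp: "\<phi> \<in> \<Phi>" "d \<in> D" "a = x [^] (z::int) \<otimes> \<phi> \<otimes> d" using cover[OF a] by blast
      have "inv (\<beta> (z * M + \<iota> \<phi>)) \<otimes> a = d"
        unfolding \<beta>eq[OF zp(1)] zp(3) using xz Kc[of \<phi>] zp(1) \<Phi>K Dc[OF zp(2)]
        by (auto simp: cancel_inv)
      then show ?thesis using zp(2) by blast
    qed
    show "t = t'" if "t \<in> range \<beta>" "t' \<in> range \<beta>" "inv t \<otimes> t' \<in> D" for t t'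
      using that \<beta>uniq by blast
    show "coarse_chart G D F C" by fact
    show "0 \<in> C i" for i by fact
    show "bij_betw \<tau> (range \<beta>) (fsupp B)" by fact
    show "\<one> \<in> range \<beta>" using \<beta>0 by (metis rangeI)
    show "\<tau> \<one> = (\<lambda>i. 0)" using \<tau>\<beta>[of 0] \<beta>0 by (simp add: if_distrib)
    show "C i = {0} \<or> B i = {0}" for i using Cj by (auto simp: B_def)
  next
    fix E assume E: "finite E" "E \<subseteq> K"
    have "{inv s \<otimes> e \<otimes> s |s e. s \<in> D \<and> e \<in> E} \<subseteq> {inv s \<otimes> e \<otimes> s |s e. s \<in> K \<and> e \<in> E}"
      using DK by blast
    then show "finite {inv s \<otimes> e \<otimes> s |s e. s \<in> D \<and> e \<in> E}"
      using conjugates_finite[OF lf SK E(1)] E(2) K by (auto intro: finite_subset)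
    \<comment> \<open>Only the finitely many products of some \<open>\<phi>\<close> with some
      \<open>e\<close> have to be decomposed, because the power of \<open>x\<close> stands in front
      and simply adds up. This bounds the exponents \<open>w\<close> and the corrections
      \<open>d\<close> uniformly.\<close>
    have "\<forall>p\<in>\<Phi> \<times> E. \<exists>q. fst (snd q) \<in> \<Phi> \<and> snd (snd q) \<in> D \<and>
        fst p \<otimes> snd p = x [^] (fst q :: int) \<otimes> fst (snd q) \<otimes> snd (snd q)"
    proof
      fix p assume "p \<in> \<Phi> \<times> E"
      then have "fst p \<otimes> snd p \<in> K" using \<Phi>K E(2) Km by (auto simp: subset_iff)
      then obtain z \<phi> d where "\<phi> \<in> \<Phi>" "d \<in> D" "fst p \<otimes> snd p = x [^] (z::int) \<otimes> \<phi> \<otimes> d"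
        using cover by blast
      then show "\<exists>q. fst (snd q) \<in> \<Phi> \<and> snd (snd q) \<in> D \<and>
        fst p \<otimes> snd p = x [^] (fst q :: int) \<otimes> fst (snd q) \<otimes> snd (snd q)"
        by (intro exI[of _ "(z, \<phi>, d)"]) simp
    qed
    then obtain q where q: "\<And>p. p \<in> \<Phi> \<times> E \<Longrightarrow> fst (snd (q p)) \<in> \<Phi> \<and> snd (snd (q p)) \<in> D \<and>
        fst p \<otimes> snd p = x [^] (fst (q p) :: int) \<otimes> fst (snd (q p)) \<otimes> snd (snd (q p))"
      by metis
    define A where "A = (\<lambda>p. snd (snd (q p))) ` (\<Phi> \<times> E)"
    define N where "N = (\<Sum>p\<in>\<Phi> \<times> E. \<bar>fst (q p)\<bar>)"
    have N: "\<bar>fst (q p)\<bar> \<le> N" if "p \<in> \<Phi> \<times> E" for p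
      unfolding N_def using that \<Phi>fin E(1) by (intro member_le_sum) auto
    have "\<exists>t'\<in>range \<beta>. inv t' \<otimes> (t \<otimes> e) \<in> A \<and> near {j} (N * M + M) (\<tau> t) (\<tau> t')"
      if t: "t \<in> range \<beta>" and e: "e \<in> E" for t e
    proof -
      obtain m where m: "t = \<beta> m" using t by blast
      define z where "z = m div M"
      define \<phi> where "\<phi> = \<kappa> (m mod M)"
      have p: "\<phi> \<in> \<Phi>" unfolding \<phi>_def using \<kappa> M by simp
      have \<iota>p: "\<iota> \<phi> = m mod M" unfolding \<phi>_def using \<kappa> M by simp
      obtain w \<phi>' d where qe: "q (\<phi>, e) = (w, \<phi>', d)" by (cases "q (\<phi>, e)") auto
      have pe: "\<phi>' \<in> \<Phi>" "d \<in> D" "\<phi> \<otimes> e = x [^] w \<otimes> \<phi>' \<otimes> d" using q[of "(\<phi>, e)"] p e qe by auto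
      have wN: "\<bar>w\<bar> \<le> N" using N[of "(\<phi>, e)"] p e qe by simp
      have dA: "d \<in> A" unfolding A_def using p e qe by (force intro!: image_eqI[of _ _ "(\<phi>, e)"])
      \<comment> \<open>Right multiplication by \<open>e\<close> shifts the exponent by
        \<open>w\<close> and exchanges the representative, hence moves the single coordinate by at
        most \<open>N * M + M\<close>.\<close>
      define m' where "m' = (z + w) * M + \<iota> \<phi>'"
      have c: "\<phi> \<in> carrier G" "\<phi>' \<in> carrier G" "d \<in> carrier G" "e \<in> carrier G"
        using p pe \<Phi>K Kc Dc e E(2) by auto
      have tz: "t = x [^] z \<otimes> \<phi>" by (simp add: m \<beta>_def z_def \<phi>_def)
      have "t \<otimes> e = x [^] z \<otimes> (\<phi> \<otimes> e)" unfolding tz using c xz by (simp add: m_assoc)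
      also have "\<dots> = \<beta> m' \<otimes> d"
        unfolding pe(3) m'_def \<beta>eq[OF pe(1)] xadd using c xz by (simp add: m_assoc)
      finally have "inv (\<beta> m') \<otimes> (t \<otimes> e) = d"
        using c Kc[OF \<beta>K] by (simp add: m_assoc[symmetric])
      moreover have "near {j} (N * M + M) (\<tau> t) (\<tau> (\<beta> m'))"
      proof -
        have "m = z * M + \<iota> \<phi>" unfolding \<iota>p z_def by simp
        then have "m - m' = - w * M + (\<iota> \<phi> - \<iota> \<phi>')" by (simp add: m'_def algebra_simps)
        moreover have "\<bar>\<iota> \<phi> - \<iota> \<phi>'\<bar> \<le> M" using \<iota>r[OF p] \<iota>r[OF pe(1)] by linarith
        moreover have "\<bar>- w * M\<bar> \<le> N * M" using wN M by (simp add: abs_mult)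
        ultimately have "\<bar>m - m'\<bar> \<le> N * M + M" by linarith
        then show ?thesis unfolding m \<tau>\<beta> near_def by auto
      qed
      ultimately show ?thesis using dA by blast
    qed
    moreover have "finite A" "A \<subseteq> D" using \<Phi>fin E(1) q by (auto simp: A_def)
    ultimately show "\<exists>A J n. finite A \<and> A \<subseteq> D \<and> finite J \<and>
       (\<forall>t\<in>range \<beta>. \<forall>e\<in>E. \<exists>t'\<in>range \<beta>. inv t' \<otimes> (t \<otimes> e) \<in> A \<and> near J n (\<tau> t) (\<tau> t'))"
      by (intro exI[of _ A] exI[of _ "{j}"] exI[of _ "N * M + M"]) auto
  next
    fix J :: "'i set" and n :: int assume J: "finite J"
    \<comment> \<open>If the coordinates differ by at most \<open>n\<close>, so do their quotients
      by \<open>M\<close>; the powers of \<open>x\<close> cancel up to such an exponent.\<close>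
    define E where "E = (\<lambda>(\<phi>, w, \<phi>'). inv \<phi> \<otimes> x [^] (w::int) \<otimes> \<phi>') ` (\<Phi> \<times> {-n..n} \<times> \<Phi>)"
    have "inv t \<otimes> t' \<in> E" if t: "t \<in> range \<beta>" "t' \<in> range \<beta>" and nr: "near J n (\<tau> t) (\<tau> t')" for t t'
    proof -
      obtain m m' where m: "t = \<beta> m" "t' = \<beta> m'" using t by blast
      have d: "\<bar>m - m'\<bar> \<le> n" using nr[unfolded m \<tau>\<beta> near_def] by (auto dest: spec[of _ j])
      have "m' div M - m div M \<in> {-n..n}" using div_near[OF d M] by (auto simp: abs_le_iff)
      moreover have "inv t \<otimes> t' = inv (\<kappa> (m mod M)) \<otimes> x [^] (m' div M - m div M) \<otimes> \<kappa> (m' mod M)"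
      proof -
        have "\<kappa> (m mod M) \<in> \<Phi>" "\<kappa> (m' mod M) \<in> \<Phi>" using \<kappa>(1) M by auto
        then have pc: "\<kappa> (m mod M) \<in> carrier G" "\<kappa> (m' mod M) \<in> carrier G"
          using \<Phi>K Kc by auto
        have "x [^] (m' div M) = x [^] (m div M) \<otimes> x [^] (m' div M - m div M)"
          by (simp add: xadd[symmetric])
        then show ?thesis unfolding m \<beta>_def using pc xz
          by (simp add: inv_mult_group m_assoc cancel_inv)
      qed
      ultimately show ?thesis unfolding E_def
        using \<kappa> M by (auto intro!: image_eqI[of _ _ "(\<kappa> (m mod M), m' div M - m div M, \<kappa> (m' mod M))"])
    qed
    moreover have "finite E" using \<Phi>fin by (simp add: E_def)
    moreover have "E \<subseteq> K"
    proof -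
      have "\<phi> \<in> K" if "\<phi> \<in> \<Phi>" for \<phi> using that \<Phi>K by blast
      then show ?thesis unfolding E_def using Kp[OF xK] Km Ki by auto
    qed
    ultimately show "\<exists>E. finite E \<and> E \<subseteq> K \<and> (\<forall>t\<in>range \<beta>. \<forall>t'\<in>range \<beta>. near J n (\<tau> t) (\<tau> t') \<longrightarrow> inv t \<otimes> t' \<in> E)"
      by blast
  qed
  moreover have "(\<lambda>i. if B i = {0} then C i else B i) = C(j := UNIV)"
    using Cj by (auto simp: B_def fun_eq_iff)
  ultimately show ?thesis by simp
qed

section \<open>Indices, finite index criteria and independent elements\<close>

text \<open>Inversion exchanges left and right cosets.\<close>

lemma (in group) subgroup_index_eq:
  assumes D: "subgroup D G" and K: "subgroup K G" "D \<subseteq> K"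
  shows "subgroup_index G K D = (if finite (lcosets G K D) then enat (card (lcosets G K D)) else \<infinity>)"
proof -
  have Dc: "D \<subseteq> carrier G" using subgroup.subset[OF D] .
  have Kc: "K \<subseteq> carrier G" using subgroup.subset[OF K(1)] .
  define R where "R = rcosets\<^bsub>G\<lparr>carrier := K\<rparr>\<^esub> D"
  have R: "R = (\<lambda>a. D #> a) ` K"
    by (auto simp: R_def RCOSETS_def r_coset_def)
  have im: "m_inv G ` (a <# D) = D #> inv a" if "a \<in> carrier G" for a
  proof (intro equalityI subsetI)
    fix y assume "y \<in> m_inv G ` (a <# D)"
    then obtain d where d: "d \<in> D" "y = inv (a \<otimes> d)" by (auto simp: l_coset_def)
    then have "y = inv d \<otimes> inv a" using that Dc by (auto simp: inv_mult_group)
    then show "y \<in> D #> inv a" using d subgroup.m_inv_closed[OF D] by (auto simp: r_coset_def)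
  next
    fix y assume "y \<in> D #> inv a"
    then obtain d where d: "d \<in> D" "y = d \<otimes> inv a" by (auto simp: r_coset_def)
    then have "y = inv (a \<otimes> inv d)" using that Dc by (auto simp: inv_mult_group)
    then show "y \<in> m_inv G ` (a <# D)"
      using d subgroup.m_inv_closed[OF D] by (auto simp: l_coset_def)
  qed
  have ii: "m_inv G ` m_inv G ` c = c" if "c \<subseteq> carrier G" for c
    using that by (force simp: image_image subset_iff)
  have sub: "c \<subseteq> carrier G" if "c \<in> lcosets G K D" for c
    using that Dc Kc l_coset_subset_G unfolding lcosets_def by blast
  have "bij_betw (\<lambda>c. m_inv G ` c) (lcosets G K D) R"
    unfolding bij_betw_def
  proof
    show "inj_on (\<lambda>c. m_inv G ` c) (lcosets G K D)"
      by (rule inj_on_inverseI[where g = "\<lambda>c. m_inv G ` c"]) (use ii sub in auto)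
    have "(\<lambda>c. m_inv G ` c) ` lcosets G K D = (\<lambda>a. D #> inv a) ` K"
      unfolding lcosets_def image_image using im Kc by (intro image_cong) auto
    also have "\<dots> = (\<lambda>a. D #> a) ` (m_inv G ` K)" by (simp add: image_image)
    also have "m_inv G ` K = K"
    proof
      show "m_inv G ` K \<subseteq> K" using subgroup.m_inv_closed[OF K(1)] by auto
      then show "K \<subseteq> m_inv G ` K" using ii[OF Kc] by blast
    qed
    finally show "(\<lambda>c. m_inv G ` c) ` lcosets G K D = R" by (simp add: R)
  qed
  then have "finite R = finite (lcosets G K D)" "card R = card (lcosets G K D)"
    using bij_betw_finite bij_betw_same_card by metis+
  then show ?thesis unfolding subgroup_index_def Let_def R_def[symmetric] by simp
qed

lemma (in group) finite_lcosets_of_cover: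
  assumes "subgroup D G" "K \<subseteq> carrier G" "finite \<Phi>" "\<Phi> \<subseteq> K"
    and "\<And>a. a \<in> K \<Longrightarrow> \<exists>\<phi>\<in>\<Phi>. \<exists>d\<in>D. a = \<phi> \<otimes> d"
  shows "finite (lcosets G K D)"
proof -
  have "lcosets G K D \<subseteq> (\<lambda>\<phi>. \<phi> <# D) ` \<Phi>"
  proof
    fix c assume "c \<in> lcosets G K D"
    then obtain a where a: "a \<in> K" "c = a <# D" by (auto simp: lcosets_def)
    then obtain \<phi> d where p: "\<phi> \<in> \<Phi>" "d \<in> D" "a = \<phi> \<otimes> d" using assms(5) by blast
    have "a \<in> \<phi> <# D" using p by (auto simp: l_coset_def)
    then have "\<phi> <# D = a <# D" using l_repr_independence assms p by blast
    then show "c \<in> (\<lambda>\<phi>. \<phi> <# D) ` \<Phi>" using a p by blast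
  qed
  then show ?thesis using assms(3) finite_surj by blast
qed

text \<open>Products of elements of the two transversals form a transversal. Since
  \<open>card\<close> is 0 on infinite sets and both transversals are nonempty, the formula also
  covers infinite indices; a positive total index therefore yields finiteness of both steps.\<close>

lemma (in group) lcosets_mult:
  assumes D: "subgroup D G" and K: "subgroup K G" "D \<subseteq> K" and L: "subgroup L G" "K \<subseteq> L"
  shows "card (lcosets G L D) = card (lcosets G L K) * card (lcosets G K D)"
    and "finite (lcosets G L K) \<Longrightarrow> finite (lcosets G K D) \<Longrightarrow> finite (lcosets G L D)"
proof -
  note Lc = subgroup.mem_carrier[OF L(1)] and Kc = subgroup.mem_carrier[OF K(1)]
  obtain T where T: "T \<subseteq> L" "bij_betw (\<lambda>t. t <# K) T (lcosets G L K)"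
    "\<And>a. a \<in> L \<Longrightarrow> \<exists>t\<in>T. inv t \<otimes> a \<in> K"
    "\<And>t t'. t \<in> T \<Longrightarrow> t' \<in> T \<Longrightarrow> inv t \<otimes> t' \<in> K \<Longrightarrow> t = t'"
    using left_transversal[OF K(1) L] by metis
  obtain U where U: "U \<subseteq> K" "bij_betw (\<lambda>t. t <# D) U (lcosets G K D)"
    "\<And>a. a \<in> K \<Longrightarrow> \<exists>t\<in>U. inv t \<otimes> a \<in> D"
    "\<And>t t'. t \<in> U \<Longrightarrow> t' \<in> U \<Longrightarrow> inv t \<otimes> t' \<in> D \<Longrightarrow> t = t'"
    using left_transversal[OF D K] by metis
  let ?f = "\<lambda>(t, u). (t \<otimes> u) <# D"
  have c: "t \<in> carrier G" "u \<in> carrier G" "t \<in> L" "u \<in> K" "t \<otimes> u \<in> L" if "t \<in> T" "u \<in> U" for t u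
    using that T(1) U(1) L(2) Lc subgroup.m_closed[OF L(1)] by (auto simp: subset_iff)
  have "bij_betw ?f (T \<times> U) (lcosets G L D)"
    unfolding bij_betw_def
  proof
    show "inj_on ?f (T \<times> U)"
    proof (rule inj_onI, clarify)
      fix t u t' u' assume m: "t \<in> T" "u \<in> U" "t' \<in> T" "u' \<in> U" "t \<otimes> u <# D = t' \<otimes> u' <# D"
      note c1 = c[OF m(1,2)] and c2 = c[OF m(3,4)]
      have "inv (t \<otimes> u) \<otimes> (t' \<otimes> u') \<in> D"
        using l_coset_eq_iff[OF D, of "t \<otimes> u" "t' \<otimes> u'"] c1 c2 m(5) by simp
      then have d: "inv u \<otimes> (inv t \<otimes> t') \<otimes> u' \<in> D" (is "?d \<in> D")
        using c1 c2 by (simp add: inv_mult_group m_assoc)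
      have "inv t \<otimes> t' = u \<otimes> ?d \<otimes> inv u'" using c1 c2 by (simp add: m_assoc cancel_inv)
      moreover have "u \<otimes> ?d \<otimes> inv u' \<in> K"
        using d K(2) c1 c2 subgroup.m_closed[OF K(1)] subgroup.m_inv_closed[OF K(1)] by auto
      ultimately have tt: "t = t'" using T(4) m by simp
      then have "inv u \<otimes> u' \<in> D" using d c1 c2 by simp
      then show "t = t' \<and> u = u'" using tt U(4) m by blast
    qed
    show "?f ` (T \<times> U) = lcosets G L D"
    proof (intro equalityI subsetI)
      fix y assume "y \<in> ?f ` (T \<times> U)"
      then show "y \<in> lcosets G L D" using c by (auto simp: lcosets_def)
    next
      fix y assume "y \<in> lcosets G L D"
      then obtain a where a: "a \<in> L" "y = a <# D" by (auto simp: lcosets_def)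
      obtain t where t: "t \<in> T" "inv t \<otimes> a \<in> K" using T(3)[OF a(1)] by blast
      obtain u where u: "u \<in> U" "inv u \<otimes> (inv t \<otimes> a) \<in> D" using U(3)[OF t(2)] by blast
      have "inv (t \<otimes> u) \<otimes> a \<in> D" using u c[OF t(1) u(1)] Lc[OF a(1)]
        by (simp add: inv_mult_group m_assoc)
      then have "t \<otimes> u <# D = a <# D"
        using l_coset_eq_iff[OF D] c[OF t(1) u(1)] Lc a(1) by simp
      then show "y \<in> ?f ` (T \<times> U)" using a t u by force
    qed
  qed
  then have "card (lcosets G L D) = card (T \<times> U)" and f: "finite (T \<times> U) = finite (lcosets G L D)"
    using bij_betw_same_card bij_betw_finite by metis+
  moreover have "card T = card (lcosets G L K)" "card U = card (lcosets G K D)"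
    using T(2) U(2) bij_betw_same_card by blast+
  ultimately show "card (lcosets G L D) = card (lcosets G L K) * card (lcosets G K D)"
    by (simp add: card_cartesian_product)
  show "finite (lcosets G L D)" if "finite (lcosets G L K)" "finite (lcosets G K D)"
    using that f T(2) U(2) bij_betw_finite by blast
qed

lemma (in group) lcosets_self:
  assumes "subgroup D G"
  shows "lcosets G D D = {D}"
proof -
  have "a <# D = D" if "a \<in> D" for a
    using coset_join3[OF subgroup.mem_carrier[OF assms that] assms that] .
  then show ?thesis
    using subgroup.one_closed[OF assms] by (auto simp: lcosets_def)
qed

text \<open>Lets \<open>\<one>\<close> fill an idle slot when an extension lemma adjoins two
  elements \<open>x\<close> and \<open>g\<close>.\<close>

lemma (in group) generate_insert_one:
  assumes "S \<subseteq> carrier G"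
  shows "generate G (insert \<one> S) = generate G S"
proof
  show "generate G (insert \<one> S) \<subseteq> generate G S"
    using generate_is_subgroup[OF assms] by (intro generate_subgroup_incl) (auto intro: generate.intros)
qed (rule mono_generate, auto)

lemma (in group) generate_generate_Un:
  assumes "S \<subseteq> carrier G" "F \<subseteq> carrier G"
  shows "generate G (generate G S \<union> F) = generate G (S \<union> F)"
proof
  have "generate G S \<subseteq> generate G (S \<union> F)" by (rule mono_generate) auto
  then show "generate G (generate G S \<union> F) \<subseteq> generate G (S \<union> F)"
    using generate_is_subgroup[of "S \<union> F"] assms
    by (intro generate_subgroup_incl) (auto intro: generate.incl)
  show "generate G (S \<union> F) \<subseteq> generate G (generate G S \<union> F)"
    by (rule mono_generate) (auto intro: generate.incl)
qed

text \<open>The double coset cover with trivial \<open>x\<close>: the finitely many middle factors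
  then represent all left cosets.\<close>

lemma (in group) finite_index_adjoin:
  assumes lf: "locally_finite_by_abelian G" and S: "finite S" "S \<subseteq> carrier G"
    and g: "g \<in> carrier G" "0 < k" "g [^] (k::int) \<in> generate G S"
  shows "finite (lcosets G (generate G (insert g S)) (generate G S))"
proof -
  have eq: "generate G (S \<union> {\<one>, g}) = generate G (insert g S)"
    using generate_insert_one[of "insert g S"] S(2) g(1) by (simp add: insert_commute)
  obtain \<Phi> where P: "finite \<Phi>" "\<Phi> \<subseteq> generate G (insert g S)"
    "\<And>a. a \<in> generate G (insert g S) \<Longrightarrow>
      \<exists>z::int. \<exists>\<phi>\<in>\<Phi>. \<exists>d\<in>generate G S. a = \<one> [^] z \<otimes> \<phi> \<otimes> d"
    using double_coset_cover[OF lf S one_closed g] unfolding eq by metis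
  have c: "generate G (insert g S) \<subseteq> carrier G" using generate_incl S g by simp
  show ?thesis
  proof (rule finite_lcosets_of_cover[OF generate_is_subgroup[OF S(2)] c P(1,2)])
    fix a assume "a \<in> generate G (insert g S)"
    then obtain z :: int and \<phi> d where "\<phi> \<in> \<Phi>" "d \<in> generate G S" "a = \<one> [^] z \<otimes> \<phi> \<otimes> d"
      using P(3) by blast
    moreover have "\<phi> \<in> carrier G" using \<open>\<phi> \<in> \<Phi>\<close> P(2) c by blast
    ultimately show "\<exists>\<phi>\<in>\<Phi>. \<exists>d\<in>generate G S. a = \<phi> \<otimes> d"
      by (intro bexI[of _ \<phi>] bexI[of _ d]) (auto simp: int_pow_one)
  qed
qed

lemma (in group) locally_finite_index_iff:
  assumes "S \<subseteq> carrier G"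
  shows "locally_finite_index G (generate G S) \<longleftrightarrow>
    (\<forall>F. finite F \<and> F \<subseteq> carrier G \<longrightarrow> finite (lcosets G (generate G (S \<union> F)) (generate G S)))"
proof -
  have "subgroup_index G (generate G (generate G S \<union> F)) (generate G S) \<noteq> \<infinity> \<longleftrightarrow>
      finite (lcosets G (generate G (S \<union> F)) (generate G S))" if "F \<subseteq> carrier G" for F
  proof -
    have "generate G S \<subseteq> generate G (S \<union> F)" by (rule mono_generate) auto
    then show ?thesis
      using subgroup_index_eq[OF generate_is_subgroup[OF assms] generate_is_subgroup[of "S \<union> F"]] assms that
      unfolding generate_generate_Un[OF assms that] by simp
  qed
  then show ?thesis
    using generate_is_subgroup[OF assms] by (auto simp: locally_finite_index_def)
qed

lemma (in group) int_pow_mem_imp_zero: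
  assumes D: "subgroup D G" and x: "x \<in> carrier G"
    and no: "\<not> (\<exists>k::int. 0 < k \<and> x [^] k \<in> D)" and z: "x [^] (z::int) \<in> D"
  shows "z = 0"
proof (rule ccontr)
  assume "z \<noteq> 0"
  then have "0 < - z" using no z by (cases "z > 0") auto
  moreover have "x [^] (-z) \<in> D"
    using subgroup.m_inv_closed[OF D z] int_pow_neg[OF x, of z] by simp
  ultimately show False using no by blast
qed

text \<open>If every element had a positive power in the subgroup, finitely many elements could be
  adjoined one after the other with finite index each time, and the subgroup would have locally
  finite index.\<close>

lemma (in group) independent_element:
  assumes lf: "locally_finite_by_abelian G" and S: "finite S" "S \<subseteq> carrier G"
    and not: "\<not> locally_finite_index G (generate G S)"
  obtains x where "x \<in> carrier G" "\<And>z::int. x [^] z \<in> generate G S \<Longrightarrow> z = 0"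
proof -
  have sub: "subgroup (generate G S) G" using generate_is_subgroup[OF S(2)] .
  have "\<exists>x\<in>carrier G. \<forall>z::int. x [^] z \<in> generate G S \<longrightarrow> z = 0"
  proof (rule ccontr)
    assume "\<not> ?thesis"
    then have pos: "\<exists>k::int. 0 < k \<and> x [^] k \<in> generate G S" if "x \<in> carrier G" for x
      using that int_pow_mem_imp_zero[OF sub that] by blast
    have "finite (lcosets G (generate G (S \<union> F)) (generate G S))" if "finite F" "F \<subseteq> carrier G" for F
      using that
    proof (induction F rule: finite_induct)
      case empty
      then show ?case using lcosets_self[OF generate_is_subgroup[OF S(2)]] by simp
    next
      case (insert f F)
      have SF: "finite (S \<union> F)" "S \<union> F \<subseteq> carrier G" "f \<in> carrier G" using S insert by auto
      obtain k :: int where k: "0 < k" "f [^] k \<in> generate G S" using pos[OF SF(3)] by blast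
      have m: "generate G S \<subseteq> generate G (S \<union> F)" "generate G (S \<union> F) \<subseteq> generate G (insert f (S \<union> F))"
        by (rule mono_generate; blast)+
      have "finite (lcosets G (generate G (insert f (S \<union> F))) (generate G (S \<union> F)))"
        using finite_index_adjoin[OF lf SF k(1)] k(2) m(1) by blast
      moreover have "finite (lcosets G (generate G (S \<union> F)) (generate G S))" using insert by auto
      ultimately have "finite (lcosets G (generate G (insert f (S \<union> F))) (generate G S))"
        using lcosets_mult(2)[OF generate_is_subgroup generate_is_subgroup m(1) generate_is_subgroup m(2)]
          S SF by auto
      then show ?case by simp
    qed
    then show False using not locally_finite_index_iff[OF S(2)] by blast
  qed
  then show thesis using that by blast
qed

section \<open>Counting points in finite boxes\<close>

text \<open>Off the finite set \<open>J\<close> all coordinates are 0, so finite support is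
  automatic and counting reduces to extensional products.\<close>

lemma fsupp_bij_PiE:
  assumes "finite J" "\<And>i. i \<notin> J \<Longrightarrow> C i = {0}"
  shows "bij_betw (\<lambda>x. restrict x J) (fsupp C) (Pi\<^sub>E J C)"
proof (rule bij_betwI[where g = "\<lambda>y i. if i \<in> J then y i else 0"])
  show "(\<lambda>x. restrict x J) \<in> fsupp C \<rightarrow> Pi\<^sub>E J C" by (auto simp: fsupp_def)
  show "(\<lambda>y i. if i \<in> J then y i else 0) \<in> Pi\<^sub>E J C \<rightarrow> fsupp C"
    using assms by (auto simp: fsupp_def PiE_iff intro: finite_subset[of _ J])
  show "(\<lambda>i. if i \<in> J then restrict x J i else 0) = x" if "x \<in> fsupp C" for x
    using that assms(2) by (fastforce simp: fsupp_def)
  show "(\<lambda>i\<in>J. if i \<in> J then y i else 0) = y" if "y \<in> Pi\<^sub>E J C" for y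
    using that by (auto simp: fun_eq_iff PiE_def extensional_def)
qed

lemma card_fsupp:
  assumes "finite J" "\<And>i. i \<notin> J \<Longrightarrow> C i = {0}"
  shows "card (fsupp C) = (\<Prod>i\<in>J. card (C i))"
  using bij_betw_same_card[OF fsupp_bij_PiE[OF assms]] card_PiE[OF assms(1), of C] by simp

lemma finite_fsupp:
  assumes "finite J" "\<And>i. i \<notin> J \<Longrightarrow> C i = {0}" "\<And>i. i \<in> J \<Longrightarrow> finite (C i)"
  shows "finite (fsupp C)"
  using bij_betw_finite[OF fsupp_bij_PiE[OF assms(1,2)]] finite_PiE[OF assms(1,3)] by simp

section \<open>Charts of locally finite-by-abelian groups\<close>

lemma (in group) chart_trivial:
  "coarse_chart G {\<one>} (\<lambda>_ (_::'i). 0) (\<lambda>_. {0})"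
proof -
  have "fsupp (\<lambda>_::'i. {0}) = {\<lambda>_. 0}" by (auto simp: fsupp_def)
  then have 1: "bij_betw (\<lambda>_ _. 0) {\<one>} (fsupp (\<lambda>_::'i. {0}))" by (simp add: bij_betw_def)
  have 2: "\<exists>J n. finite J \<and> (\<forall>g\<in>{\<one>}. \<forall>e\<in>E. near J n (\<lambda>_::'i. 0) (\<lambda>_. 0))" for E :: "'a set"
    by (intro exI[of _ "{}"] exI[of _ "0::int"]) (simp add: near_def)
  have 3: "\<exists>E. finite E \<and> E \<subseteq> {\<one>} \<and> (\<forall>g\<in>{\<one>}. \<forall>h\<in>{\<one>}. near J n (\<lambda>_::'i. 0) (\<lambda>_. 0) \<longrightarrow> inv g \<otimes> h \<in> E)" for J n
    by (intro exI[of _ "{\<one>}"]) simp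
  show ?thesis
    unfolding coarse_chart_def using 1 2 3 by (intro conjI allI impI)
qed

text \<open>From here on coordinates are indexed by pairs of naturals: \<open>(0, i)\<close> is the \<open>i\<close>-th generator
  of the base subgroup, and \<open>(p, k)\<close> with \<open>p\<close> prime is the \<open>k\<close>-th factor \<open>{0..<p}\<close> contributed by
  the prime \<open>p\<close>.\<close>

lemma (in group) chart_generate:
  assumes lf: "locally_finite_by_abelian G" and S: "finite S" "S \<subseteq> carrier G"
  shows "\<exists>(F :: 'a \<Rightarrow> nat \<times> nat \<Rightarrow> int) C. coarse_chart G (generate G S) F C \<and> (\<forall>i. 0 \<in> C i) \<and>
     (\<forall>i. C i \<noteq> {0} \<longrightarrow> fst i = 0 \<and> snd i < card S) \<and> (\<forall>i. C i = UNIV \<or> finite (C i)) \<and>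
     ((\<forall>k<card S. C (0, k) = UNIV) \<or> card {i. C i = UNIV} < card S)"
  using S
proof (induction S rule: finite_induct)
  case empty
  show ?case
    unfolding generate_empty
    by (intro exI[of _ "\<lambda>_ _. 0"] exI[of _ "\<lambda>_. {0}"]) (auto simp: chart_trivial)
next
  case (insert x S)
  have S: "finite S" "S \<subseteq> carrier G" "x \<in> carrier G" using insert by auto
  define n where "n = card S"
  have cs: "card (insert x S) = Suc n" using insert by (simp add: n_def)
  obtain F :: "'a \<Rightarrow> nat \<times> nat \<Rightarrow> int" and C where IH: "coarse_chart G (generate G S) F C" "\<And>i. 0 \<in> C i"
    "\<And>i. C i \<noteq> {0} \<Longrightarrow> fst i = 0 \<and> snd i < n" "\<And>i. C i = UNIV \<or> finite (C i)"
    "(\<forall>k<n. C (0, k) = UNIV) \<or> card {i. C i = UNIV} < n"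
    using insert.IH[OF S(2)] unfolding n_def by blast
  have Cn: "C (0, n) = {0}" using IH(3)[of "(0, n)"] by auto
  have UF: "{i. C i = UNIV} \<subseteq> {0} \<times> {..<n}"
  proof
    fix i assume "i \<in> {i. C i = UNIV}"
    then have "1 \<in> C i" by simp
    then have "C i \<noteq> {0}" by auto
    then show "i \<in> {0} \<times> {..<n}" using IH(3)[of i] by (cases i) auto
  qed
  have Uc: "card {i. C i = UNIV} \<le> n"
    using card_mono[OF _ UF] by simp
  have sub: "generate G S \<subseteq> generate G (insert x S)" by (rule mono_generate) auto
  show ?case
  \<comment> \<open>A generator with a positive power in the previous subgroup yields a finite
    coordinate, and from then on there are fewer \<open>UNIV\<close> coordinates than generators.
    This deficit is the second alternative of the invariant; for a minimal generating set it will
    contradict the lower bound for the free rank.\<close>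
  proof (cases "\<exists>k::int. 0 < k \<and> x [^] k \<in> generate G S")
    case True
    then obtain k :: int where k: "0 < k" "x [^] k \<in> generate G S" by blast
    have fin: "finite (lcosets G (generate G (insert x S)) (generate G S))"
      by (rule finite_index_adjoin[OF lf S k])
    define q where "q = card (lcosets G (generate G (insert x S)) (generate G S))"
    have q: "q > 0"
      unfolding q_def using fin by (auto simp: card_gt_0_iff lcosets_def intro: generate.one)
    define B where "B i = (if i = (0, n) then {0..<int q} else {0})" for i :: "nat \<times> nat"
    have B: "finite (fsupp B)" "card (fsupp B) = q"
      using finite_fsupp[of "{(0, n)}" B] card_fsupp[of "{(0, n)}" B] by (auto simp: B_def)
    have B0: "0 \<in> B i" and Bd: "C i = {0} \<or> B i = {0}" for i
      using q Cn by (auto simp: B_def)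
    have xS: "finite (insert x S)" "insert x S \<subseteq> carrier G" using S by auto
    obtain F' where F': "coarse_chart G (generate G (insert x S)) F' (\<lambda>i. if B i = {0} then C i else B i)"
      using chart_finite_step[OF lf xS generate_is_subgroup[OF S(2)] refl sub IH(1,2) B0 Bd B(1) fin]
        B(2) unfolding q_def by metis
    let ?C = "\<lambda>i. if B i = {0} then C i else B i"
    have "{i. ?C i = UNIV} \<subseteq> {i. C i = UNIV}"
    proof
      fix i assume i: "i \<in> {i. ?C i = UNIV}"
      have "finite (B i)" by (simp add: B_def)
      then have "B i \<noteq> UNIV" using infinite_UNIV_int by metis
      then show "i \<in> {i. C i = UNIV}" using i by (auto split: if_splits)
    qed
    moreover have "finite {i. C i = UNIV}" using UF finite_subset by blast
    ultimately have "card {i. ?C i = UNIV} \<le> card {i. C i = UNIV}" using card_mono by blast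
    then have "card {i. ?C i = UNIV} < Suc n" using Uc by simp
    moreover have "0 \<in> ?C i" for i using IH(2) q by (auto simp: B_def)
    moreover have "?C i \<noteq> {0} \<longrightarrow> fst i = 0 \<and> snd i < Suc n" for i
    proof (cases "i = (0, n)")
      case False
      then have "?C i = C i" by (simp add: B_def)
      then show ?thesis using IH(3)[of i] by (metis less_SucI)
    qed simp
    moreover have "?C i = UNIV \<or> finite (?C i)" for i
      using IH(4)[of i] by (auto simp: B_def)
    ultimately show ?thesis using F' unfolding cs by blast
  next
    case False
    have indep: "z = 0" if "x [^] (z::int) \<in> generate G S" for z
      using int_pow_mem_imp_zero[OF generate_is_subgroup[OF S(2)] S(3) False that] .
    \<comment> \<open>The idle second element of the infinite step is \<open>\<one>\<close>, with
      exponent 1.\<close>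
    have eq: "generate G (insert x S) = generate G (S \<union> {x, \<one>})"
      using generate_insert_one[of "insert x S"] S by (simp add: insert_commute)
    have one: "\<one> [^] (1::int) \<in> generate G S" by (simp add: generate.one)
    obtain F' where F': "coarse_chart G (generate G (insert x S)) F' (C((0, n) := UNIV))"
      using chart_infinite_step[OF lf S(1,2) refl eq S(3) one_closed zero_less_one one indep IH(1,2) Cn]
      by blast
    have "(\<forall>k<Suc n. (C((0, n) := UNIV)) (0, k) = UNIV) \<or> card {i. (C((0, n) := UNIV)) i = UNIV} < Suc n"
      using IH(5)
    proof
      assume "card {i. C i = UNIV} < n"
      moreover have "{i. (C((0, n) := UNIV)) i = UNIV} = insert (0, n) {i. C i = UNIV}" by auto
      moreover have "finite {i. C i = UNIV}" using UF finite_subset by blast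
      ultimately show ?thesis by (simp add: card_insert_if)
    qed (auto simp: less_Suc_eq)
    moreover have "0 \<in> (C((0, n) := UNIV)) i" for i using IH(2) by auto
    moreover have "(C((0, n) := UNIV)) i \<noteq> {0} \<longrightarrow> fst i = 0 \<and> snd i < Suc n" for i
    proof (cases "i = (0, n)")
      case False
      then have "(C((0, n) := UNIV)) i = C i" by simp
      then show ?thesis using IH(3)[of i] by (metis less_SucI)
    qed simp
    moreover have "(C((0, n) := UNIV)) i = UNIV \<or> finite ((C((0, n) := UNIV)) i)" for i
      using IH(4)[of i] by auto
    ultimately show ?thesis using F' unfolding cs by blast
  qed
qed

text \<open>Positions \<open>k\<close> start at 0, so the \<open>k\<close>-th factor of
  \<open>p\<close> exists exactly when the power \<open>Suc k\<close> of \<open>p\<close> divides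
  some finite index. This form avoids suprema and treats infinite values uniformly.\<close>

lemma (in group) less_factorizing_function_iff:
  assumes H: "subgroup H G"
  shows "enat k < factorizing_function G H p \<longleftrightarrow>
    (\<exists>E. subgroup E G \<and> H \<subseteq> E \<and> finite (lcosets G E H) \<and> p ^ Suc k dvd card (lcosets G E H))"
proof
  assume "enat k < factorizing_function G H p"
  then obtain m i where m: "k < m" "enat i \<in> index_spectrum G H" "p ^ m dvd i"
    unfolding factorizing_function_def less_Sup_iff by auto
  then obtain E where E: "subgroup E G" "H \<subseteq> E" "enat i = subgroup_index G E H"
    by (auto simp: index_spectrum_def)
  then have "finite (lcosets G E H)" "i = card (lcosets G E H)"
    using subgroup_index_eq[OF H E(1,2)] by (auto split: if_splits)
  moreover have "p ^ Suc k dvd i" using m le_imp_power_dvd[of "Suc k" m p] dvd_trans by auto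
  ultimately show "\<exists>E. subgroup E G \<and> H \<subseteq> E \<and> finite (lcosets G E H) \<and> p ^ Suc k dvd card (lcosets G E H)"
    using E by blast
next
  assume "\<exists>E. subgroup E G \<and> H \<subseteq> E \<and> finite (lcosets G E H) \<and> p ^ Suc k dvd card (lcosets G E H)"
  then obtain E where E: "subgroup E G" "H \<subseteq> E" "finite (lcosets G E H)" "p ^ Suc k dvd card (lcosets G E H)"
    by blast
  have "enat (card (lcosets G E H)) \<in> index_spectrum G H"
    unfolding index_spectrum_def using subgroup_index_eq[OF H E(1,2)] E by (metis (mono_tags, lifting) mem_Collect_eq)
  then have "enat (Suc k) \<le> factorizing_function G H p"
    unfolding factorizing_function_def using E(4) by (intro Sup_upper) blast
  then show "enat k < factorizing_function G H p"
    by (meson enat_ord_simps(2) lessI less_le_trans)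
qed

lemma prod_prime_multiplicity:
  fixes r :: nat
  assumes "r > 0"
  shows "(\<Prod>p\<in>prime_factors r. p ^ multiplicity p r) = r"
  using prod_prime_factors[of r] assms by simp

text \<open>Adjoining an enumeration of the carrier gives a chain of finite extensions of
  \<open>H\<close>. Each step contributes the prime factors of its index as new coordinates, placed
  at positions \<open>(p, k)\<close> that continue the exponents of the total index so far. Any
  finite extension of \<open>H\<close> lies inside some stage, so these exponents exhaust the
  factorizing function.\<close>

lemma (in group) chart_locally_finite_extension:
  fixes F :: "'a \<Rightarrow> nat \<times> nat \<Rightarrow> int"
  assumes lf: "locally_finite_by_abelian G" and count: "countable (carrier G)"
    and S: "finite S" "S \<subseteq> carrier G" and H: "H = generate G S" "locally_finite_index G H"
    and F: "coarse_chart G H F C" and C0: "\<And>i. 0 \<in> C i" and Cf: "finite {i. C i \<noteq> {0}}"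
    and Cp: "\<And>p k. prime p \<Longrightarrow> C (p, k) = {0}"
  shows "\<exists>F'. coarse_chart G (carrier G) F'
     (\<lambda>i. if prime (fst i) \<and> enat (snd i) < factorizing_function G H (fst i) then {0..<int (fst i)} else C i)"
proof -
  have sH: "subgroup H G" using generate_is_subgroup[OF S(2)] H by simp
  define g where "g = from_nat_into (carrier G)"
  have gr: "range g = carrier G"
    unfolding g_def using count one_closed by (intro range_from_nat_into) auto
  have gc: "g n \<in> carrier G" for n using gr by auto
  define T where "T n = S \<union> g ` {..<n}" for n
  have T: "finite (T n)" "T n \<subseteq> carrier G" for n using S gc by (auto simp: T_def)
  define K where "K n = generate G (T n)" for n
  have sK: "subgroup (K n) G" for n unfolding K_def using generate_is_subgroup[OF T(2)] .
  have Kmono: "K n \<subseteq> K (Suc n)" for n unfolding K_def by (rule mono_generate) (auto simp: T_def)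
  have HK: "H \<subseteq> K n" for n unfolding K_def H by (rule mono_generate) (auto simp: T_def)
  have K0: "K 0 = H" by (simp add: K_def T_def H)
  have KU: "(\<Union>n. K n) = carrier G"
  proof
    show "(\<Union>n. K n) \<subseteq> carrier G" using subgroup.subset[OF sK] by blast
    show "carrier G \<subseteq> (\<Union>n. K n)"
    proof
      fix a assume "a \<in> carrier G"
      then obtain n where "a = g n" using gr by auto
      then have "a \<in> K (Suc n)" unfolding K_def T_def by (intro generate.incl) auto
      then show "a \<in> (\<Union>n. K n)" by blast
    qed
  qed
  define q where "q n = card (lcosets G (K n) H)" for n
  have finq: "finite (lcosets G (K n) H)" for n
    using H(2) locally_finite_index_iff[OF S(2)] gc unfolding H(1) K_def T_def by blast
  have q0: "q n > 0" for n
    unfolding q_def using finq subgroup.one_closed[OF sK] by (auto simp: card_gt_0_iff lcosets_def)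
  define r where "r n = card (lcosets G (K (Suc n)) (K n))" for n
  have qr: "q (Suc n) = r n * q n" for n
    unfolding q_def r_def by (rule lcosets_mult(1)[OF sH sK HK sK Kmono])
  have r0: "r n > 0" for n using qr[of n] q0[of "Suc n"] by (cases "r n") auto
  have finr: "finite (lcosets G (K (Suc n)) (K n))" for n
    using r0[of n] unfolding r_def by (rule card_ge_0_finite)
  define e where "e n p = multiplicity p (q n)" for n and p :: nat
  have eS: "e (Suc n) p = multiplicity p (r n) + e n p" if "prime p" for n p
    unfolding e_def qr using that r0[of n] q0[of n]
    by (intro prime_elem_multiplicity_mult_distrib) auto
  define Cn where "Cn n i = (if prime (fst i) \<and> snd i < e n (fst i) then {0..<int (fst i)} else C i)"
    for n i
  have Cn0: "Cn 0 = C"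
  proof -
    have "q 0 = 1" unfolding q_def K0 using lcosets_self[OF sH] by simp
    then show ?thesis by (simp add: Cn_def e_def fun_eq_iff)
  qed
  have zero: "0 \<in> Cn n i" for n i using C0 by (auto simp: Cn_def dest: prime_gt_0_nat)
  have step: "\<exists>F'. coarse_chart G (K (Suc n)) F' (Cn (Suc n)) \<and> extends_chart G (K n) F1 (Cn n) (K (Suc n)) F'"
    if F1: "coarse_chart G (K n) F1 (Cn n)" for n F1
  proof -
    \<comment> \<open>The exponent of \<open>p\<close> in the index of \<open>H\<close> grows from
      \<open>e n p\<close> to \<open>e (Suc n) p\<close>; the positions in between are new. Their
      block has \<open>r n\<close> points by prime factorization.\<close>
    define J where "J = Sigma (prime_factors (r n)) (\<lambda>p. {e n p..<e (Suc n) p})"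
    define B where "B i = (if i \<in> J then {0..<int (fst i)} else {0})" for i
    have J: "finite J" by (simp add: J_def)
    have Jp: "prime (fst i)" "\<not> snd i < e n (fst i)" "snd i < e (Suc n) (fst i)" if "i \<in> J" for i
      using that by (auto simp: J_def dest: in_prime_factors_imp_prime)
    have JB: "B i \<noteq> {0}" if "i \<in> J" for i
    proof -
      have "int (fst i) \<ge> 2" using prime_ge_2_nat[OF Jp(1)[OF that]] by simp
      then have "1 \<in> B i" using that by (simp add: B_def)
      then show ?thesis by auto
    qed
    have Jiff: "i \<in> J \<longleftrightarrow> prime (fst i) \<and> e n (fst i) \<le> snd i \<and> snd i < e (Suc n) (fst i)" for i
    proof
      assume *: "prime (fst i) \<and> e n (fst i) \<le> snd i \<and> snd i < e (Suc n) (fst i)"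
      then have "multiplicity (fst i) (r n) > 0" using eS[of "fst i" n] by simp
      then have "fst i \<in> prime_factors (r n)"
        using * r0[of n] by (simp add: prime_factors_multiplicity)
      then show "i \<in> J" using * by (cases i) (auto simp: J_def)
    qed (use Jp in \<open>auto simp: not_less\<close>)
    have B: "finite (fsupp B)" "card (fsupp B) = r n"
    proof -
      show "finite (fsupp B)" by (rule finite_fsupp[OF J]) (auto simp: B_def)
      have "card (fsupp B) = (\<Prod>i\<in>J. card (B i))" by (rule card_fsupp[OF J]) (simp add: B_def)
      also have "\<dots> = (\<Prod>i\<in>J. fst i)" by (rule prod.cong) (auto simp: B_def)
      also have "\<dots> = (\<Prod>p\<in>prime_factors (r n). \<Prod>k\<in>{e n p..<e (Suc n) p}. p)"
        unfolding J_def by (subst prod.Sigma) (auto simp: case_prod_unfold)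
      also have "\<dots> = (\<Prod>p\<in>prime_factors (r n). p ^ multiplicity p (r n))"
        using eS by (intro prod.cong) (auto dest: in_prime_factors_imp_prime)
      finally show "card (fsupp B) = r n" using prod_prime_multiplicity[OF r0] by simp
    qed
    have "\<exists>F'. coarse_chart G (K (Suc n)) F' (\<lambda>i. if B i = {0} then Cn n i else B i) \<and>
        extends_chart G (K n) F1 (Cn n) (K (Suc n)) F'"
    proof (rule chart_finite_step[OF lf T sK K_def Kmono F1 zero _ _ B(1) finr])
      show "0 \<in> B i" for i using Jp(1)[of i] prime_gt_0_nat by (auto simp: B_def)
      show "Cn n i = {0} \<or> B i = {0}" for i
        using Jp[of i] Cp[of "fst i" "snd i"] by (auto simp: B_def Cn_def)
      show "card (lcosets G (K (Suc n)) (K n)) = card (fsupp B)" using B(2) by (simp add: r_def)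
    qed
    moreover have "(if B i = {0} then Cn n i else B i) = Cn (Suc n) i" for i
    proof (cases "i \<in> J")
      case True
      then show ?thesis using JB[OF True] Jp[OF True] by (simp add: B_def Cn_def)
    next
      case False
      have "prime (fst i) \<and> snd i < e n (fst i) \<longleftrightarrow> prime (fst i) \<and> snd i < e (Suc n) (fst i)"
        using False eS[of "fst i" n] by (auto simp: Jiff)
      then have "Cn n i = Cn (Suc n) i" unfolding Cn_def by simp
      then show ?thesis using False by (simp add: B_def)
    qed
    ultimately show ?thesis by simp
  qed
  have "\<exists>Fn. \<forall>n. coarse_chart G (K n) (Fn n) (Cn n) \<and> extends_chart G (K n) (Fn n) (Cn n) (K (Suc n)) (Fn (Suc n))"
  proof (rule dependent_nat_choice[where P = "\<lambda>n F. coarse_chart G (K n) F (Cn n)"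
        and Q = "\<lambda>n F F'. extends_chart G (K n) F (Cn n) (K (Suc n)) F'"])
    show "\<exists>F. coarse_chart G (K 0) F (Cn 0)" using F by (auto simp: K0 Cn0)
  qed (use step in blast)
  then obtain Fn where Fn: "\<And>n. coarse_chart G (K n) (Fn n) (Cn n)"
    "\<And>n. extends_chart G (K n) (Fn n) (Cn n) (K (Suc n)) (Fn (Suc n))" by blast
  have emono: "e n p \<le> e (Suc n) p" if "prime p" for n p using eS[OF that] by simp
  have Cstable: "Cn (Suc n) i = Cn n i" if i: "Cn n i \<noteq> {0}" for n i
  proof (cases "prime (fst i)")
    case True
    then have "snd i < e n (fst i)"
      using i Cp[OF True, of "snd i"] unfolding Cn_def by (auto split: if_splits)
    then show ?thesis using emono[OF True, of n] True by (simp add: Cn_def)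
  qed (simp add: Cn_def)
  have Cfin: "finite {i. Cn n i \<noteq> {0}}" for n
  proof -
    have "{i. Cn n i \<noteq> {0}} \<subseteq> {i. C i \<noteq> {0}} \<union> Sigma (prime_factors (q n)) (\<lambda>p. {..<e n p})"
    proof
      fix i assume i: "i \<in> {i. Cn n i \<noteq> {0}}"
      show "i \<in> {i. C i \<noteq> {0}} \<union> Sigma (prime_factors (q n)) (\<lambda>p. {..<e n p})"
      proof (cases "prime (fst i) \<and> snd i < e n (fst i)")
        case True
        then have "fst i \<in> prime_factors (q n)"
          using q0[of n] by (simp add: prime_factors_multiplicity e_def)
        then show ?thesis using True by (cases i) auto
      next
        case False
        then have "Cn n i = C i" by (auto simp: Cn_def)
        then show ?thesis using i by auto
      qed
    qed
    then show ?thesis by (rule finite_subset) (use Cf in simp)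
  qed
  obtain F' where F': "coarse_chart G (carrier G) F' (\<lambda>i. \<Union>n. Cn n i)"
    using chart_tower[where K = K and C = Cn and F = Fn, OF sK Kmono Cstable zero Cfin Fn] KU by auto
  \<comment> \<open>The stages alone compute the supremum over all subgroups containing
    \<open>H\<close> with finite index.\<close>
  have key: "enat k < factorizing_function G H p \<longleftrightarrow> (\<exists>n. k < e n p)" if p: "prime p" for p k
  proof
    assume "\<exists>n. k < e n p"
    then obtain n where "k < e n p" by blast
    then have "p ^ Suc k dvd q n"
      unfolding e_def using multiplicity_dvd'[of "Suc k" p "q n"] by simp
    then show "enat k < factorizing_function G H p"
      unfolding less_factorizing_function_iff[OF sH] using sK[of n] HK[of n] finq[of n]
      by (intro exI[of _ "K n"]) (simp add: q_def)
  next
    assume "enat k < factorizing_function G H p"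
    then obtain E where E: "subgroup E G" "H \<subseteq> E" "finite (lcosets G E H)" "p ^ Suc k dvd card (lcosets G E H)"
      using less_factorizing_function_iff[OF sH] by blast
    obtain U where U: "U \<subseteq> E" "bij_betw (\<lambda>t. t <# H) U (lcosets G E H)"
      "\<And>a. a \<in> E \<Longrightarrow> \<exists>t\<in>U. inv t \<otimes> a \<in> H"
      using left_transversal[OF sH E(1,2)] by metis
    have Uc: "u \<in> carrier G" if "u \<in> U" for u using that U(1) subgroup.mem_carrier[OF E(1)] by blast
    have "finite U" using U(2) E(3) bij_betw_finite by blast
    then obtain n where n: "U \<subseteq> K n"
      using finite_subset_chain[of U K, OF _ _ Kmono] KU Uc by auto
    \<comment> \<open>A finite transversal of \<open>E\<close> lies in one stage, and that stage
      contains \<open>H\<close>, hence all of \<open>E\<close>; the index of \<open>H\<close> in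
      \<open>E\<close> then divides \<open>q n\<close>.\<close>
    have EK: "E \<subseteq> K n"
    proof
      fix a assume a: "a \<in> E"
      then obtain t where t: "t \<in> U" "inv t \<otimes> a \<in> H" using U(3) by blast
      have "t \<otimes> (inv t \<otimes> a) \<in> K n" using t n HK subgroup.m_closed[OF sK] by blast
      then show "a \<in> K n" using cancel_inv(1)[OF Uc[OF t(1)] subgroup.mem_carrier[OF E(1) a]] by simp
    qed
    have "q n = card (lcosets G (K n) E) * card (lcosets G E H)"
      unfolding q_def by (rule lcosets_mult(1)[OF sH E(1,2) sK EK])
    then have "p ^ Suc k dvd q n" using E(4) by simp
    then have "Suc k \<le> e n p"
      unfolding e_def using q0[of n] p by (intro multiplicity_geI) (auto dest: prime_gt_1_nat)
    then show "\<exists>n. k < e n p" by (intro exI[of _ n]) simp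
  qed
  have "(\<Union>n. Cn n i) = (if prime (fst i) \<and> enat (snd i) < factorizing_function G H (fst i) then {0..<int (fst i)} else C i)" for i
  proof (cases "prime (fst i) \<and> (\<exists>n. snd i < e n (fst i))")
    case True
    then have C: "C i = {0}" using Cp[of "fst i" "snd i"] by simp
    have "0 \<in> {0..<int (fst i)}" using True prime_gt_0_nat[of "fst i"] by auto
    then have "(\<Union>n. Cn n i) = {0..<int (fst i)}"
      using True unfolding Cn_def C by (auto split: if_splits)
    then show ?thesis using True key by simp
  next
    case False
    then have "Cn n i = C i" for n by (auto simp: Cn_def)
    then show ?thesis using False key by auto
  qed
  then show ?thesis using F' by auto
qed

text \<open>An independent element is available at every stage, so every stage can create a new
  integer coordinate and absorb the finite index caused by the next element of the enumeration. No
  finite coordinate is ever left over, and one model space serves all groups of this kind.\<close>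

lemma (in group) chart_infinite_rank:
  assumes lf: "locally_finite_by_abelian G" and count: "countable (carrier G)"
    and inf: "\<And>S. finite S \<Longrightarrow> S \<subseteq> carrier G \<Longrightarrow> \<not> locally_finite_index G (generate G S)"
  shows "\<exists>F. coarse_chart G (carrier G) F (\<lambda>i::nat \<times> nat. if fst i = 0 then UNIV else {0})"
proof -
  define g where "g = from_nat_into (carrier G)"
  have gr: "range g = carrier G"
    unfolding g_def using count one_closed by (intro range_from_nat_into) auto
  have gc: "g n \<in> carrier G" for n using gr by auto
  define Cn where "Cn n i = (if fst i = 0 \<and> snd i < n then UNIV else {0::int})"
    for n and i :: "nat \<times> nat"
  define P where "P = (\<lambda>n (S, F). finite S \<and> S \<subseteq> carrier G \<and> coarse_chart G (generate G S) F (Cn n))"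
  define Q where "Q = (\<lambda>n (S, F) (S', F'). g n \<in> S' \<and> S \<subseteq> S' \<and>
      extends_chart G (generate G S) F (Cn n) (generate G S') F')"
  have "\<exists>f. \<forall>n. P n (f n) \<and> Q n (f n) (f (Suc n))"
  proof (rule dependent_nat_choice)
    have "Cn 0 = (\<lambda>_. {0})" by (auto simp: Cn_def)
    then have "P 0 ({}, \<lambda>_ _. 0)" using chart_trivial by (simp add: P_def generate_empty)
    then show "\<exists>x. P 0 x" by blast
  next
    fix x n assume x: "P n x"
    obtain S F where SF: "x = (S, F)" by (cases x) auto
    then have S: "finite S" "S \<subseteq> carrier G" and F: "coarse_chart G (generate G S) F (Cn n)"
      using x by (auto simp: P_def)
    have C0: "0 \<in> Cn n i" for i by (simp add: Cn_def)
    have Cj: "Cn n (0, n) = {0}" by (simp add: Cn_def)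
    \<comment> \<open>If \<open>g n\<close> is independent of the current subgroup it is itself the
      new direction \<open>y\<close>, with \<open>h = \<one>\<close>. Otherwise it is the torsion
      element \<open>h\<close>, adjoined together with an arbitrary independent
      \<open>y\<close>.\<close>
    obtain y h k where y: "y \<in> carrier G" "\<And>z::int. y [^] z \<in> generate G S \<Longrightarrow> z = 0"
      and h: "h \<in> carrier G" "0 < k" "h [^] (k::int) \<in> generate G S" and gy: "g n \<in> {y, h}"
    proof (cases "\<exists>k::int. 0 < k \<and> g n [^] k \<in> generate G S")
      case True
      then obtain k :: int where "0 < k" "g n [^] k \<in> generate G S" by blast
      moreover obtain y where "y \<in> carrier G" "\<And>z::int. y [^] z \<in> generate G S \<Longrightarrow> z = 0"
        using independent_element[OF lf S inf[OF S]] by blast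
      ultimately show thesis using that[of y "g n" k] gc by blast
    next
      case False
      have "z = 0" if "g n [^] (z::int) \<in> generate G S" for z
        using int_pow_mem_imp_zero[OF generate_is_subgroup[OF S(2)] gc False that] .
      moreover have "\<one> [^] (1::int) \<in> generate G S" by (simp add: generate.one)
      ultimately show thesis using that[of "g n" \<one> 1] gc by auto
    qed
    obtain F' where F': "coarse_chart G (generate G (S \<union> {y, h})) F' ((Cn n)((0, n) := UNIV))"
      "extends_chart G (generate G S) F (Cn n) (generate G (S \<union> {y, h})) F'"
      using chart_infinite_step[OF lf S refl refl y(1) h y(2) F C0 Cj] by blast
    have "(Cn n)((0, n) := UNIV) = Cn (Suc n)" by (auto simp: Cn_def fun_eq_iff)
    then have "P (Suc n) (S \<union> {y, h}, F') \<and> Q n x (S \<union> {y, h}, F')"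
      using F' S y(1) h(1) gy by (auto simp: P_def Q_def SF)
    then show "\<exists>z. P (Suc n) z \<and> Q n x z" by blast
  qed
  then obtain f where f: "\<And>n. P n (f n)" "\<And>n. Q n (f n) (f (Suc n))" by blast
  define S where "S n = fst (f n)" for n
  define Fn where "Fn n = snd (f n)" for n
  have SF: "f n = (S n, Fn n)" for n by (simp add: S_def Fn_def)
  have P: "finite (S n)" "S n \<subseteq> carrier G" "coarse_chart G (generate G (S n)) (Fn n) (Cn n)" for n
    using f(1)[of n] unfolding SF P_def by auto
  have Q: "g n \<in> S (Suc n)" "S n \<subseteq> S (Suc n)"
    "extends_chart G (generate G (S n)) (Fn n) (Cn n) (generate G (S (Suc n))) (Fn (Suc n))" for n
    using f(2)[of n] unfolding SF Q_def by auto
  have U: "(\<Union>n. generate G (S n)) = carrier G"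
  proof
    show "(\<Union>n. generate G (S n)) \<subseteq> carrier G" using generate_incl[OF P(2)] by blast
    show "carrier G \<subseteq> (\<Union>n. generate G (S n))"
    proof
      fix a assume "a \<in> carrier G"
      then obtain n where "a = g n" using gr by auto
      then have "a \<in> generate G (S (Suc n))" using Q(1) by (simp add: generate.incl)
      then show "a \<in> (\<Union>n. generate G (S n))" by blast
    qed
  qed
  have "\<exists>F. coarse_chart G (\<Union>n. generate G (S n)) F (\<lambda>i. \<Union>n. Cn n i)"
  proof (rule chart_tower[where K = "\<lambda>n. generate G (S n)" and C = Cn and F = Fn,
        OF generate_is_subgroup[OF P(2)] mono_generate[OF Q(2)] _ _ _ P(3) Q(3)])
    show "Cn (Suc n) i = Cn n i" if "Cn n i \<noteq> {0}" for n i using that by (auto simp: Cn_def split: if_splits)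
    show "0 \<in> Cn n i" for n i by (simp add: Cn_def)
    show "finite {i. Cn n i \<noteq> {0}}" for n
      by (rule finite_subset[of _ "{0} \<times> {..<n}"]) (auto simp: Cn_def split: if_splits)
  qed
  moreover have "(\<Union>n. Cn n i) = (if fst i = 0 then UNIV else {0})" for i
    by (auto simp: Cn_def)
  ultimately show ?thesis unfolding U by simp
qed

section \<open>Moving finite factors between coordinates\<close>

text \<open>Euclidean division by \<open>q\<close> identifies the integers coarsely with the
  integers times \<open>{0..<q}\<close>: the coordinate \<open>j\<close> keeps the quotient, and the
  free coordinate \<open>i\<close> receives the remainder.\<close>

lemma chart_split:
  assumes F: "coarse_chart G K F C" and j: "C j = UNIV" "C i = {0}" "i \<noteq> j" and q: "0 < q"
  shows "\<exists>F'. coarse_chart G K F' (C(i := {0..<q}))"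
proof -
  define s where "s x = x(j := x j div q, i := x j mod q)" for x :: "'c \<Rightarrow> int"
  define u where "u y = y(j := q * y j + y i, i := 0)" for y :: "'c \<Rightarrow> int"
  have us: "u (s x) = x" if "x i = 0" for x
    using j(3) that by (auto simp: u_def s_def fun_eq_iff)
  have su: "s (u y) = y" if "0 \<le> y i" "y i < q" for y
    using j(3) that q by (auto simp: u_def s_def fun_eq_iff)
  have fin: "finite {k. (x(a := c, b := d)) k \<noteq> 0}" if "finite {k. x k \<noteq> 0}" for x :: "'c \<Rightarrow> int" and a b c d
    by (rule finite_subset[of _ "insert a (insert b {k. x k \<noteq> 0})"]) (use that in auto)
  have x0: "x i = 0" if "x \<in> fsupp C" for x using that j(2) by (auto simp: fsupp_def)
  have bs: "bij_betw s (fsupp C) (fsupp (C(i := {0..<q})))"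
  proof (rule bij_betwI[where g = u])
    show "s \<in> fsupp C \<rightarrow> fsupp (C(i := {0..<q}))"
      using q j fin by (auto simp: fsupp_def s_def)
    show "u \<in> fsupp (C(i := {0..<q})) \<rightarrow> fsupp C"
    proof
      fix y assume y: "y \<in> fsupp (C(i := {0..<q}))"
      have "u y k \<in> C k" for k
        using y j by (cases "k = i"; cases "k = j") (auto simp: fsupp_def u_def dest: spec[of _ k])
      moreover have "finite {k. u y k \<noteq> 0}" using y fin unfolding u_def by (auto simp: fsupp_def)
      ultimately show "u y \<in> fsupp C" by (simp add: fsupp_def)
    qed
    show "u (s x) = x" if "x \<in> fsupp C" for x using us x0[OF that] by simp
    show "s (u y) = y" if "y \<in> fsupp (C(i := {0..<q}))" for y
      using that by (intro su) (auto simp: fsupp_def dest!: spec[of _ i])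
  qed
  note b = coarse_chartD(1)[OF F]
  have F0: "F g i = 0" if "g \<in> K" for g using b x0 that by (auto simp: bij_betw_def)
  \<comment> \<open>Quotients differ by at most \<open>n\<close>, remainders by at most
    \<open>q\<close>, so \<open>n + q\<close> covers both.\<close>
  have sn: "near (insert i (insert j J)) (n + q) (s x) (s y)" if n: "near J n x y" for J n x y
  proof -
    have n0: "0 \<le> n" using near_nonneg[OF n] .
    have xy: "\<bar>x k - y k\<bar> \<le> n" "k \<notin> J \<Longrightarrow> x k = y k" for k using n by (auto simp: near_def)
    have "\<bar>s x k - s y k\<bar> \<le> n + q" for k
    proof -
      have "0 \<le> x j mod q" "x j mod q < q" "0 \<le> y j mod q" "y j mod q < q" using q by auto
      then have "\<bar>x j mod q - y j mod q\<bar> \<le> q" by linarith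
      moreover have "\<bar>x j div q - y j div q\<bar> \<le> n" using div_near[OF xy(1) q] .
      ultimately show ?thesis using xy(1)[of k] n0 q by (auto simp: s_def)
    qed
    moreover have "s x k = s y k" if "k \<notin> insert i (insert j J)" for k
      using that xy(2)[of k] by (auto simp: s_def)
    ultimately show ?thesis by (simp add: near_def)
  qed
  \<comment> \<open>The old value is \<open>q\<close> times the quotient plus the remainder.
    Coordinate \<open>i\<close> need not be added to the set, as both old points vanish
    there.\<close>
  have un: "near (insert j J) (n * q + n) x y"
    if n: "near J n (s x) (s y)" and x: "x i = 0" "y i = 0" for J n x y
  proof -
    have n0: "0 \<le> n" using near_nonneg[OF n] .
    have xy: "\<bar>s x k - s y k\<bar> \<le> n" "k \<notin> J \<Longrightarrow> s x k = s y k" for k using n by (auto simp: near_def)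
    have nq: "0 \<le> n * q" using n0 q by simp
    have "\<bar>x k - y k\<bar> \<le> n * q + n" for k
    proof (cases "k = j")
      case True
      have 1: "x j = q * s x j + s x i" "y j = q * s y j + s y i" using j(3) by (auto simp: s_def)
      have "x j - y j = q * (s x j - s y j) + (s x i - s y i)" unfolding 1 by (simp add: algebra_simps)
      moreover have "\<bar>q * (s x j - s y j)\<bar> \<le> n * q"
        using mult_left_mono[OF xy(1)[of j], of q] q by (simp add: abs_mult mult.commute)
      ultimately have "\<bar>x j - y j\<bar> \<le> n * q + n" using xy(1)[of i] by linarith
      then show ?thesis using True by simp
    next
      case False
      then have "k \<noteq> i \<Longrightarrow> s x k = x k \<and> s y k = y k" by (simp add: s_def)
      then show ?thesis using xy(1)[of k] nq n0 x by (cases "k = i") auto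
    qed
    moreover have "x k = y k" if "k \<notin> insert j J" for k
      using xy(2)[of k] that x by (cases "k = i") (auto simp: s_def)
    ultimately show ?thesis by (simp add: near_def)
  qed
  have "coarse_chart G K (s \<circ> F) (C(i := {0..<q}))"
    unfolding coarse_chart_def
  proof (intro conjI allI impI)
    show "bij_betw (s \<circ> F) K (fsupp (C(i := {0..<q})))" using bij_betw_trans[OF b bs] .
  next
    fix E assume "finite E \<and> E \<subseteq> K"
    then obtain J n where "finite J" "\<forall>g\<in>K. \<forall>e\<in>E. near J n (F g) (F (g \<otimes>\<^bsub>G\<^esub> e))"
      using coarse_chartD(2)[OF F] by meson
    then show "\<exists>J n. finite J \<and> (\<forall>g\<in>K. \<forall>e\<in>E. near J n ((s \<circ> F) g) ((s \<circ> F) (g \<otimes>\<^bsub>G\<^esub> e)))"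
      using sn by (intro exI[of _ "insert i (insert j J)"] exI[of _ "n + q"]) auto
  next
    fix J :: "'c set" and n assume "finite J"
    then obtain E where E: "finite E" "E \<subseteq> K"
      "\<forall>g\<in>K. \<forall>h\<in>K. near (insert j J) (n * q + n) (F g) (F h) \<longrightarrow> inv\<^bsub>G\<^esub> g \<otimes>\<^bsub>G\<^esub> h \<in> E"
      using coarse_chartD(3)[OF F, of "insert j J" "n * q + n"] by auto
    then show "\<exists>E. finite E \<and> E \<subseteq> K \<and>
        (\<forall>g\<in>K. \<forall>h\<in>K. near J n ((s \<circ> F) g) ((s \<circ> F) h) \<longrightarrow> inv\<^bsub>G\<^esub> g \<otimes>\<^bsub>G\<^esub> h \<in> E)"
      using un F0 by (intro exI[of _ E]) auto
  qed
  then show ?thesis by blast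
qed

text \<open>The coordinate \<open>j\<close> keeps the range \<open>UNIV\<close> after each split, so
  the same coordinate can be divided again and again.\<close>

lemma chart_split_finite:
  assumes "finite I" "coarse_chart G K F C" "C j = UNIV" "j \<notin> I"
    and "\<And>i. i \<in> I \<Longrightarrow> C i = {0} \<and> 0 < q i"
  shows "\<exists>F'. coarse_chart G K F' (\<lambda>i. if i \<in> I then {0..<q i} else C i)"
  using assms(1,4,5)
proof (induction I rule: finite_induct)
  case empty
  then show ?case using assms(2) by auto
next
  case (insert i I)
  then obtain F' where F': "coarse_chart G K F' (\<lambda>i. if i \<in> I then {0..<q i} else C i)" by blast
  have "\<exists>F'. coarse_chart G K F' ((\<lambda>i. if i \<in> I then {0..<q i} else C i)(i := {0..<q i}))"
    by (rule chart_split[OF F', of j]) (use insert assms(3) in auto)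
  moreover have "(\<lambda>i. if i \<in> I then {0..<q i} else C i)(i := {0..<q i}) = (\<lambda>k. if k \<in> insert i I then {0..<q k} else C k)"
    by (auto simp: fun_eq_iff)
  ultimately show ?case by simp
qed

section \<open>The free rank\<close>

text \<open>A box of side \<open>n\<close> has \<open>(n + 1) ^ m\<close> points. Their images agree
  off \<open>J\<close> and stay within a distance linear in \<open>n\<close>, which leaves room for
  at most a constant times \<open>(n + 1) ^ k\<close> points. Injectivity then forbids
  \<open>m > k\<close>.\<close>

lemma rank_le_infinite_coordinates:
  fixes \<Phi> :: "(nat \<Rightarrow> int) \<Rightarrow> 'i \<Rightarrow> int"
  assumes inj: "inj_on \<Phi> (Pi\<^sub>E {..<m} (\<lambda>_. UNIV))"
    and J: "finite J"
    and lip: "\<And>z i. z \<in> Pi\<^sub>E {..<m} (\<lambda>_. UNIV) \<Longrightarrow> i < m \<Longrightarrow> near J c (\<Phi> z) (\<Phi> (z(i := z i + 1)))"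
    and C: "\<And>z i. z \<in> Pi\<^sub>E {..<m} (\<lambda>_. UNIV) \<Longrightarrow> \<Phi> z i \<in> C i"
    and k: "finite {i. infinite (C i)}" "card {i. infinite (C i)} \<le> k"
  shows "m \<le> k"
proof (rule ccontr)
  assume "\<not> m \<le> k"
  then have km: "Suc k \<le> m" by simp
  then have "0 < m" by simp
  define z0 where "z0 = (\<lambda>i\<in>{..<m}. 0::int)"
  have z0: "z0 \<in> Pi\<^sub>E {..<m} (\<lambda>_. UNIV)" by (simp add: z0_def)
  have c0: "0 \<le> c" using near_nonneg[OF lip[OF z0 \<open>0 < m\<close>]] .
  \<comment> \<open>Induction on the coordinate sum: lowering a positive coordinate by one stays in
    the nonnegative orthant. Every step changes coordinates in the same set \<open>J\<close>, so
    only the bound accumulates.\<close>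
  have reach: "near J (c * int s) (\<Phi> z0) (\<Phi> z)"
    if "z \<in> Pi\<^sub>E {..<m} (\<lambda>_. UNIV)" "\<And>i. i < m \<Longrightarrow> 0 \<le> z i" "(\<Sum>i<m. z i) = int s" for z s
    using that
  proof (induction s arbitrary: z)
    case 0
    then have "\<forall>i\<in>{..<m}. z i = 0" using sum_nonneg_eq_0_iff[of "{..<m}" z] by simp
    then have "z = z0" using 0(1) by (auto simp: z0_def fun_eq_iff PiE_def extensional_def)
    then show ?case by (simp add: near_refl)
  next
    case (Suc s)
    have "\<exists>i<m. 0 < z i"
    proof (rule ccontr)
      assume "\<not> ?thesis"
      then have "z i \<le> 0" if "i < m" for i using that by (meson not_less)
      then have "(\<Sum>i<m. z i) \<le> 0" by (intro sum_nonpos) auto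
      then show False using Suc(4) by simp
    qed
    then obtain i where i: "i < m" "0 < z i" by blast
    define z' where "z' = z(i := z i - 1)"
    have z': "z' \<in> Pi\<^sub>E {..<m} (\<lambda>_. UNIV)" using Suc(2) i by (auto simp: z'_def PiE_def extensional_def)
    have nn: "0 \<le> z' l" if "l < m" for l using Suc(3)[OF that] i by (auto simp: z'_def)
    have "(\<Sum>l<m. z' l) = (\<Sum>l<m. z l - (if l = i then 1 else 0))" by (rule sum.cong) (auto simp: z'_def)
    also have "\<dots> = (\<Sum>l<m. z l) - 1" using i by (simp add: sum_subtractf)
    finally have "(\<Sum>l<m. z' l) = int s" using Suc(4) by simp
    from Suc.IH[OF z' nn this] have "near J (c * int s) (\<Phi> z0) (\<Phi> z')" .
    moreover have "near J c (\<Phi> z') (\<Phi> z)" using lip[OF z' i(1)] by (simp add: z'_def)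
    ultimately have "near (J \<union> J) (c * int s + c) (\<Phi> z0) (\<Phi> z)" by (rule near_trans)
    then show ?case by (simp add: algebra_simps)
  qed
  define I where "I = {i. infinite (C i)}"
  define Q where "Q = (\<Prod>i\<in>J - I. card (C i))"
  \<comment> \<open>Chosen so that \<open>2 * N + 1 \<le> b * (n + 1)\<close> for the radius
    \<open>N = c * m * n\<close> reached below; \<open>b\<close> does not depend on
    \<open>n\<close>.\<close>
  define b where "b = nat (2 * c * int m + 1)"
  have main: "n + 1 \<le> b ^ k * Q" for n :: nat
  proof -
    define A where "A = Pi\<^sub>E {..<m} (\<lambda>_. {0..int n})"
    have A: "A \<subseteq> Pi\<^sub>E {..<m} (\<lambda>_. UNIV)" by (auto simp: A_def)
    have cA: "card A = (n + 1) ^ m" by (simp add: A_def card_PiE nat_add_distrib)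
    define N where "N = c * (int m * int n)"
    have N0: "0 \<le> N" using c0 by (simp add: N_def)
    have nz: "near J N (\<Phi> z0) (\<Phi> z)" if z: "z \<in> A" for z
    proof -
      have zi: "0 \<le> z i" "z i \<le> int n" if "i < m" for i
        using PiE_mem[OF z[unfolded A_def], of i] that by simp_all
      have s0: "0 \<le> (\<Sum>i<m. z i)" using zi by (intro sum_nonneg) auto
      have sm: "(\<Sum>i<m. z i) \<le> int m * int n"
        using sum_bounded_above[of "{..<m}" z "int n"] zi by simp
      have "near J (c * int (nat (\<Sum>i<m. z i))) (\<Phi> z0) (\<Phi> z)"
        using z A zi s0 by (intro reach) auto
      moreover have "c * int (nat (\<Sum>i<m. z i)) \<le> N"
        unfolding N_def using s0 sm c0 by (intro mult_left_mono) auto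
      ultimately show ?thesis using near_mono by blast
    qed
    \<comment> \<open>Infinite coordinates are confined to the ball around the image of the origin;
      finite coordinates keep their whole range and contribute the constant
      \<open>Q\<close>.\<close>
    define D where "D i = (if i \<in> I then {\<Phi> z0 i - N..\<Phi> z0 i + N} else C i)" for i
    have DJ: "restrict (\<Phi> z) J \<in> Pi\<^sub>E J D" if z: "z \<in> A" for z
    proof -
      have "\<bar>\<Phi> z0 i - \<Phi> z i\<bar> \<le> N" for i using nz[OF z] by (simp add: near_def)
      then have "\<Phi> z i \<in> {\<Phi> z0 i - N..\<Phi> z0 i + N}" for i
        by (metis abs_diff_le_iff abs_minus_commute atLeastAtMost_iff)
      moreover have "\<Phi> z i \<in> C i" for i using C z A by blast
      ultimately have "\<Phi> z i \<in> D i" for i by (simp add: D_def)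
      then show ?thesis by auto
    qed
    have ij: "inj_on (\<lambda>z. restrict (\<Phi> z) J) A"
    proof (rule inj_onI)
      fix z w assume zw: "z \<in> A" "w \<in> A" "restrict (\<Phi> z) J = restrict (\<Phi> w) J"
      have "\<Phi> z i = \<Phi> w i" for i
      proof (cases "i \<in> J")
        case True then show ?thesis using fun_cong[OF zw(3), of i] by simp
      next
        case False then show ?thesis using nz[OF zw(1)] nz[OF zw(2)] by (simp add: near_def)
      qed
      then show "z = w" using inj zw(1,2) A by (meson ext inj_onD subsetD)
    qed
    have "finite (D i)" for i by (simp add: D_def I_def)
    then have fp: "finite (Pi\<^sub>E J D)" using J by (simp add: finite_PiE)
    have "card A \<le> card (Pi\<^sub>E J D)"
      by (rule card_inj_on_le[OF ij _ fp]) (intro image_subsetI DJ)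
    also have "\<dots> = (\<Prod>i\<in>J. card (D i))" using J by (simp add: card_PiE)
    also have "\<dots> = (\<Prod>i\<in>J \<inter> I. card (D i)) * (\<Prod>i\<in>J - I. card (D i))"
      using prod.Int_Diff[OF J] .
    also have "(\<Prod>i\<in>J \<inter> I. card (D i)) = (\<Prod>i\<in>J \<inter> I. nat (2 * N + 1))"
      by (rule prod.cong) (auto simp: D_def)
    also have "(\<Prod>i\<in>J - I. card (D i)) = Q" unfolding Q_def by (rule prod.cong) (auto simp: D_def)
    also have "(\<Prod>i\<in>J \<inter> I. nat (2 * N + 1)) = nat (2 * N + 1) ^ card (J \<inter> I)" by simp
    also have "\<dots> \<le> nat (2 * N + 1) ^ k"
    proof (rule power_increasing)
      have "card (J \<inter> I) \<le> card I" using k(1) by (intro card_mono) (auto simp: I_def)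
      then show "card (J \<inter> I) \<le> k" using k(2) by (simp add: I_def)
    qed (use N0 in simp)
    also have "nat (2 * N + 1) ^ k \<le> (b * (n + 1)) ^ k"
    proof (rule power_mono)
      have "2 * N + 1 \<le> (2 * c * int m + 1) * (int n + 1)"
        using c0 by (simp add: N_def algebra_simps)
      then have "nat (2 * N + 1) \<le> nat ((2 * c * int m + 1) * (int n + 1))" by (rule nat_mono)
      also have "\<dots> = b * (n + 1)" unfolding b_def using c0 by (simp add: nat_mult_distrib nat_add_distrib)
      finally show "nat (2 * N + 1) \<le> b * (n + 1)" .
    qed simp
    finally have "(n + 1) ^ m \<le> (b * (n + 1)) ^ k * Q" unfolding cA by simp
    moreover have "(n + 1) ^ Suc k \<le> (n + 1) ^ m" using km by (intro power_increasing) auto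
    moreover have "(b * (n + 1)) ^ k * Q = (n + 1) ^ k * (b ^ k * Q)"
      by (simp only: power_mult_distrib mult_ac)
    ultimately have "(n + 1) ^ k * (n + 1) \<le> (n + 1) ^ k * (b ^ k * Q)"
      unfolding power_Suc2 by linarith
    then show ?thesis by (simp only: mult_le_cancel1) simp
  qed
  \<comment> \<open>The right side of \<open>main\<close> is independent of \<open>n\<close>, so it
    may be taken as \<open>n\<close> itself.\<close>
  show False using main[of "b ^ k * Q"] by simp
qed

text \<open>The embedded lattice, followed by \<open>f\<close> and the chart of \<open>H\<close>, is
  injective and moves coordinates in a controlled way along the unit vectors, so the counting
  argument applies to it.\<close>

lemma free_rank_le_of_coarse_injection:
  assumes "group G" "group H" and f: "coarse_map G H f" "inj_on f (carrier G)"
    and F: "coarse_chart H (carrier H) F C"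
    and k: "finite {i. infinite (C i)}" "card {i. infinite (C i)} \<le> k"
  shows "free_rank G \<le> enat k"
proof -
  interpret G: group G by fact
  interpret H: group H by fact
  have "m \<le> k" if K: "subgroup K G" and iso: "product_group {..<m} (\<lambda>_. integer_group) \<cong> G\<lparr>carrier := K\<rparr>" for m K
  proof -
    obtain \<psi> where \<psi>: "\<psi> \<in> iso (product_group {..<m} (\<lambda>_. integer_group)) (G\<lparr>carrier := K\<rparr>)"
      using iso by (auto simp: is_iso_def)
    have \<psi>b: "bij_betw \<psi> (Pi\<^sub>E {..<m} (\<lambda>_. UNIV)) K" using \<psi> by (simp add: iso_def)
    have \<psi>m: "\<psi> (\<lambda>i\<in>{..<m}. z i + w i) = \<psi> z \<otimes>\<^bsub>G\<^esub> \<psi> w"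
      if "z \<in> Pi\<^sub>E {..<m} (\<lambda>_. UNIV)" "w \<in> Pi\<^sub>E {..<m} (\<lambda>_. UNIV)" for z w
      using \<psi> that by (auto simp: iso_def hom_def)
    have Kc: "\<psi> z \<in> carrier G" if "z \<in> Pi\<^sub>E {..<m} (\<lambda>_. UNIV)" for z
      using \<psi>b that subgroup.subset[OF K] by (auto simp: bij_betw_def)
    define e where "e i = (\<lambda>l\<in>{..<m}. if l = i then 1 else 0 :: int)" for i
    have e: "e i \<in> Pi\<^sub>E {..<m} (\<lambda>_. UNIV)" for i by (auto simp: e_def)
    define E where "E = (\<lambda>i. \<psi> (e i)) ` {..<m}"
    have E: "finite E" "E \<subseteq> carrier G" using Kc e by (auto simp: E_def)
    obtain D where D: "finite D" "D \<subseteq> carrier H" "\<forall>x\<in>carrier G. f ` (x <#\<^bsub>G\<^esub> E) \<subseteq> f x <#\<^bsub>H\<^esub> D"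
      using f(1) E unfolding coarse_map_def by meson
    have fc: "f x \<in> carrier H" if "x \<in> carrier G" for x
      using f(1) that by (auto simp: coarse_map_def)
    obtain J c where J: "finite J" "\<forall>g\<in>carrier H. \<forall>e\<in>D. near J c (F g) (F (g \<otimes>\<^bsub>H\<^esub> e))"
      using coarse_chartD(2)[OF F D(1,2)] by blast
    show "m \<le> k"
    proof (rule rank_le_infinite_coordinates[where \<Phi> = "\<lambda>z. F (f (\<psi> z))" and J = J and c = c and C = C])
      have "inj_on (F \<circ> (f \<circ> \<psi>)) (Pi\<^sub>E {..<m} (\<lambda>_. UNIV))"
      proof (intro comp_inj_on)
        show "inj_on \<psi> (Pi\<^sub>E {..<m} (\<lambda>_. UNIV))" using \<psi>b by (simp add: bij_betw_def)
        show "inj_on f (\<psi> ` Pi\<^sub>E {..<m} (\<lambda>_. UNIV))" using f(2) Kc by (meson image_subsetI inj_on_subset)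
        show "inj_on F ((f \<circ> \<psi>) ` Pi\<^sub>E {..<m} (\<lambda>_. UNIV))"
          using coarse_chartD(1)[OF F] Kc fc unfolding bij_betw_def
          by (metis comp_apply image_subsetI inj_on_subset)
      qed
      then show "inj_on (\<lambda>z. F (f (\<psi> z))) (Pi\<^sub>E {..<m} (\<lambda>_. UNIV))" by (simp add: comp_def)
    next
      fix z :: "nat \<Rightarrow> int" and i assume z: "z \<in> Pi\<^sub>E {..<m} (\<lambda>_. UNIV)" and i: "i < (m::nat)"
      have "z(i := z i + 1) = (\<lambda>l\<in>{..<m}. z l + e i l)"
        using z i by (auto simp: e_def fun_eq_iff PiE_def extensional_def)
      then have "\<psi> (z(i := z i + 1)) = \<psi> z \<otimes>\<^bsub>G\<^esub> \<psi> (e i)" using \<psi>m[OF z e] by simp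
      then have "\<psi> (z(i := z i + 1)) \<in> \<psi> z <#\<^bsub>G\<^esub> E" using i by (auto simp: l_coset_def E_def)
      then have "f (\<psi> (z(i := z i + 1))) \<in> f (\<psi> z) <#\<^bsub>H\<^esub> D" using D(3) Kc[OF z] by blast
      then obtain d where "d \<in> D" "f (\<psi> (z(i := z i + 1))) = f (\<psi> z) \<otimes>\<^bsub>H\<^esub> d" by (auto simp: l_coset_def)
      then show "near J c (F (f (\<psi> z))) (F (f (\<psi> (z(i := z i + 1)))))"
        using J(2) fc[OF Kc[OF z]] by simp
    next
      fix z i assume "z \<in> Pi\<^sub>E {..<m} (\<lambda>_. UNIV :: int set)"
      then have "F (f (\<psi> z)) \<in> fsupp C" using coarse_chartD(1)[OF F] Kc fc by (auto simp: bij_betw_def)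
      then show "F (f (\<psi> z)) i \<in> C i" by (simp add: fsupp_def)
    qed (use J k in auto)
  qed
  then show ?thesis unfolding free_rank_def by (intro Sup_least) auto
qed

section \<open>Lower bound for the free rank by independent commuting elements\<close>

text \<open>Individual commuting exponents are multiplied, since powers of a commuting element still
  commute.\<close>

lemma (in group) commuting_power:
  assumes lf: "locally_finite_by_abelian G" and x: "x \<in> carrier G" and B: "finite B" "B \<subseteq> carrier G"
  shows "\<exists>k::nat. 0 < k \<and> (\<forall>b\<in>B. x [^] k \<otimes> b = b \<otimes> x [^] k)"
  using B
proof (induction B rule: finite_induct)
  case (insert b B)
  then obtain k :: nat where k: "0 < k" "\<forall>b\<in>B. x [^] k \<otimes> b = b \<otimes> x [^] k" by auto
  obtain l :: nat where l: "0 < l" "x [^] l \<otimes> b = b \<otimes> x [^] l"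
    using power_commutes[OF lf x, of b] insert by auto
  have 1: "x [^] (k * l) = (x [^] k) [^] l" "x [^] (k * l) = (x [^] l) [^] k"
    using x by (simp_all add: nat_pow_pow mult.commute)
  have "x [^] (k * l) \<otimes> c = c \<otimes> x [^] (k * l)" if "c \<in> insert b B" for c
  proof (cases "c = b")
    case True
    then show ?thesis unfolding 1(2) using group_commutes_pow[of "x [^] l" b k] l(2) x insert(4) by auto
  next
    case False
    then show ?thesis
      unfolding 1(1) using group_commutes_pow[of "x [^] k" c l] k(2) x insert(4) that by auto
  qed
  then show ?case using k l by (intro exI[of _ "k * l"]) auto
qed (auto intro: exI[of _ 1])

text \<open>A new independent element is replaced by a positive power that commutes with all earlier
  members; the power remains independent because exponents only get multiplied.\<close>

lemma (in group) independent_commuting_family: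
  assumes lf: "locally_finite_by_abelian G"
    and not: "\<And>T. finite T \<Longrightarrow> T \<subseteq> carrier G \<Longrightarrow> card T < n \<Longrightarrow> \<not> locally_finite_index G (generate G T)"
  shows "\<exists>y. (\<forall>i<n. y i \<in> carrier G) \<and> (\<forall>i<n. \<forall>l<n. y i \<otimes> y l = y l \<otimes> y i) \<and>
     (\<forall>i<n. \<forall>z::int. y i [^] z \<in> generate G (y ` {..<i}) \<longrightarrow> z = 0)"
  using not
proof (induction n)
  case (Suc n)
  then obtain y where y: "\<And>i. i < n \<Longrightarrow> y i \<in> carrier G"
    "\<And>i l. i < n \<Longrightarrow> l < n \<Longrightarrow> y i \<otimes> y l = y l \<otimes> y i"
    "\<And>i z. i < n \<Longrightarrow> y i [^] (z::int) \<in> generate G (y ` {..<i}) \<Longrightarrow> z = 0"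
    by (metis less_SucI)
  have T: "finite (y ` {..<n})" "y ` {..<n} \<subseteq> carrier G" "card (y ` {..<n}) < Suc n"
    using y(1) card_image_le[of "{..<n}" y] by auto
  obtain x where x: "x \<in> carrier G" "\<And>z::int. x [^] z \<in> generate G (y ` {..<n}) \<Longrightarrow> z = 0"
    using independent_element[OF lf T(1,2) Suc.prems[OF T]] by blast
  obtain k :: nat where k: "0 < k" "\<forall>b\<in>y ` {..<n}. x [^] k \<otimes> b = b \<otimes> x [^] k"
    using commuting_power[OF lf x(1) T(1,2)] by blast
  define y' where "y' = y(n := x [^] k)"
  have im: "y' ` {..<i} = y ` {..<i}" if "i \<le> n" for i
    using that by (intro image_cong) (auto simp: y'_def)
  have "y' i \<in> carrier G" if "i < Suc n" for i
    using that y(1) x(1) by (auto simp: y'_def less_Suc_eq)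
  moreover have "y' i \<otimes> y' l = y' l \<otimes> y' i" if "i < Suc n" "l < Suc n" for i l
    using that y(2) k(2) by (auto simp: y'_def less_Suc_eq)
  moreover have "z = 0" if "i < Suc n" "y' i [^] (z::int) \<in> generate G (y' ` {..<i})" for i z
  proof (cases "i = n")
    case True
    have "x [^] (int k * z) = (x [^] k) [^] z" using x(1) int_pow_pow[of x "int k" z] by (simp add: int_pow_int)
    then have "x [^] (int k * z) \<in> generate G (y ` {..<n})" using that True im by (simp add: y'_def)
    then have "int k * z = 0" by (rule x(2))
    then show ?thesis using k(1) by simp
  next
    case False
    then have "i < n" using that by simp
    then show ?thesis using that(2) y(3)[of i z] im[of i] by (simp add: y'_def)
  qed
  ultimately show ?case by (intro exI[of _ y']) blast
qed auto

text \<open>The ordered products of powers \<open>y 0\<close>, \<open>y 1\<close>, ... define a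
  homomorphism from the lattice because the factors commute, and its kernel is trivial because the
  last factor of a trivial product lies in the span of the earlier ones.\<close>

lemma (in group) free_rank_ge:
  assumes y: "\<And>i. i < n \<Longrightarrow> y i \<in> carrier G" "\<And>i l. i < n \<Longrightarrow> l < n \<Longrightarrow> y i \<otimes> y l = y l \<otimes> y i"
    "\<And>i z. i < n \<Longrightarrow> y i [^] (z::int) \<in> generate G (y ` {..<i}) \<Longrightarrow> z = 0"
  shows "enat n \<le> free_rank G"
proof -
  define p where "p m z = rec_nat \<one> (\<lambda>i a. a \<otimes> y i [^] z i) m" for m :: nat and z :: "nat \<Rightarrow> int"
  have p0: "p 0 z = \<one>" and pS: "p (Suc m) z = p m z \<otimes> y m [^] z m" for m z
    by (simp_all add: p_def)
  have ic: "a [^] (i::int) \<otimes> b = b \<otimes> a [^] i" if "a \<in> carrier G" "b \<in> carrier G" "a \<otimes> b = b \<otimes> a" for a b i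
  proof -
    have "inv b \<otimes> a \<otimes> b = a" using that by (simp add: m_assoc cancel_inv)
    then have "inv b \<otimes> a [^] i \<otimes> b = a [^] i" using conj_int_pow[OF that(2,1)] by simp
    then show ?thesis using that by (metis cancel_inv(1) int_pow_closed inv_closed m_assoc m_closed)
  qed
  have pc: "p m z \<in> carrier G" if "m \<le> n" for m z
    using that by (induction m) (auto simp: p0 pS y(1))
  have pcomm: "p m z \<otimes> y i [^] a = y i [^] a \<otimes> p m z" if "m \<le> n" "i < n" for m z i and a :: int
    using that
  proof (induction m)
    case 0 then show ?case by (simp add: p0 y(1))
  next
    case (Suc m)
    then have c: "p m z \<in> carrier G" "y m [^] z m \<in> carrier G" "y i [^] a \<in> carrier G" and IH: "p m z \<otimes> y i [^] a = y i [^] a \<otimes> p m z"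
      using pc y(1) by auto
    have "y m [^] z m \<otimes> y i = y i \<otimes> y m [^] z m"
      using ic[of "y m" "y i" "z m"] y Suc by auto
    then have "y i [^] a \<otimes> y m [^] z m = y m [^] z m \<otimes> y i [^] a"
      using ic[of "y i" "y m [^] z m" a] c y(1) Suc by auto
    then have "p (Suc m) z \<otimes> y i [^] a = p m z \<otimes> y i [^] a \<otimes> y m [^] z m"
      using c by (simp add: pS m_assoc)
    then show ?case using IH c by (simp add: pS m_assoc)
  qed
  have padd: "p m (\<lambda>i. z i + w i) = p m z \<otimes> p m w" if "m \<le> n" for m z w
    using that
  proof (induction m)
    case (Suc m)
    then have c: "p m z \<in> carrier G" "p m w \<in> carrier G" "y m [^] z m \<in> carrier G" "y m [^] w m \<in> carrier G" "y m \<in> carrier G"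
      using pc y(1) by auto
    have "p (Suc m) (\<lambda>i. z i + w i) = p m z \<otimes> (p m w \<otimes> y m [^] z m) \<otimes> y m [^] w m"
      using Suc c by (simp add: pS int_pow_mult m_assoc)
    also have "p m w \<otimes> y m [^] z m = y m [^] z m \<otimes> p m w" using pcomm Suc by simp
    finally show ?case using c by (simp add: pS m_assoc)
  qed (simp add: p0)
  have pgen: "p m z \<in> generate G (y ` {..<m})" if "m \<le> n" for m z
    using that
  proof (induction m)
    case (Suc m)
    have s: "y ` {..<Suc m} \<subseteq> carrier G" using y(1) Suc by auto
    have "p m z \<in> generate G (y ` {..<Suc m})"
      using Suc mono_generate[of "y ` {..<m}" "y ` {..<Suc m}", OF image_mono] by auto
    moreover have "y m [^] z m \<in> generate G (y ` {..<Suc m})"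
      using subgroup_int_pow_closed[OF generate_is_subgroup[OF s]] by (simp add: generate.incl)
    ultimately show ?case by (simp add: pS generate.eng)
  qed (simp add: p0 generate.one)
  \<comment> \<open>The top exponent vanishes first by independence; then the shorter product is
    trivial as well.\<close>
  have pker: "\<forall>i<m. z i = 0" if "m \<le> n" "p m z = \<one>" for m z
    using that
  proof (induction m)
    case (Suc m)
    have c: "p m z \<in> carrier G" "y m [^] z m \<in> carrier G" using pc y(1) Suc by auto
    have "y m [^] z m = inv (p m z)"
      using Suc c by (metis inv_equality inv_inv pS inv_closed)
    then have "y m [^] z m \<in> generate G (y ` {..<m})"
    proof -
      have "p m z \<in> generate G (y ` {..<m})" using pgen Suc by simp
      moreover have "y ` {..<m} \<subseteq> carrier G" using y(1) Suc by auto
      ultimately show ?thesis using \<open>y m [^] z m = inv (p m z)\<close> generate_m_inv_closed by simp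
    qed
    then have "z m = 0" using y(3)[of m] Suc by simp
    then show ?case using Suc c by (auto simp: pS less_Suc_eq)
  qed simp
  have pcong: "p m z = p m w" if "\<And>i. i < m \<Longrightarrow> z i = w i" for m z w
    using that by (induction m) (auto simp: p0 pS)
  define Z where "Z = product_group {..<n} (\<lambda>_. integer_group)"
  have Z: "carrier Z = Pi\<^sub>E {..<n} (\<lambda>_. UNIV)" by (simp add: Z_def)
  have gZ: "group Z" unfolding Z_def by (rule product_group) simp
  have hom: "p n \<in> hom Z G"
  proof (rule homI)
    fix z w assume "z \<in> carrier Z" "w \<in> carrier Z"
    have "p n (z \<otimes>\<^bsub>Z\<^esub> w) = p n (\<lambda>i. z i + w i)" by (rule pcong) (simp add: Z_def)
    then show "p n (z \<otimes>\<^bsub>Z\<^esub> w) = p n z \<otimes> p n w" by (simp add: padd)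
  qed (simp add: pc)
  have inj: "inj_on (p n) (carrier Z)"
  proof (rule inj_onI)
    fix z w assume zw: "z \<in> carrier Z" "w \<in> carrier Z" "p n z = p n w"
    have "p n z = p n (\<lambda>i. (z i - w i) + w i)" by simp
    also have "\<dots> = p n (\<lambda>i. z i - w i) \<otimes> p n w" by (rule padd) simp
    finally have "p n (\<lambda>i. z i - w i) = \<one>" using zw(3) pc[of n] by simp
    then have "\<forall>i<n. z i - w i = 0" using pker[of n] by blast
    then have "z x = w x" for x
      using zw(1,2) unfolding Z by (cases "x < n") (auto simp: PiE_def extensional_def)
    then show "z = w" by (rule ext)
  qed
  interpret h: group_hom Z G "p n"
    using gZ hom by (simp add: group_hom_def group_hom_axioms_def)
  define K where "K = p n ` carrier Z"
  have K: "subgroup K G" unfolding K_def by (rule h.img_is_subgroup)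
  have "p n \<in> iso Z (G\<lparr>carrier := K\<rparr>)"
    using hom inj by (auto simp: iso_def hom_def bij_betw_def K_def)
  then have "Z \<cong> G\<lparr>carrier := K\<rparr>" by (rule is_isoI)
  then show ?thesis
    unfolding free_rank_def Z_def using K by (intro Sup_upper) blast
qed

lemma (in group) free_rank_ge_of_not_locally_finite_index:
  assumes lf: "locally_finite_by_abelian G"
    and not: "\<And>T. finite T \<Longrightarrow> T \<subseteq> carrier G \<Longrightarrow> card T < n \<Longrightarrow> \<not> locally_finite_index G (generate G T)"
  shows "enat n \<le> free_rank G"
proof (rule exE[OF independent_commuting_family[where n = n, OF lf]])
  show "\<not> locally_finite_index G (generate G T)"
    if "finite T" "T \<subseteq> carrier G" "card T < n" for T using not that by blast
next
  fix y assume y: "(\<forall>i<n. y i \<in> carrier G) \<and> (\<forall>i<n. \<forall>l<n. y i \<otimes> y l = y l \<otimes> y i) \<and>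
     (\<forall>i<n. \<forall>z::int. y i [^] z \<in> generate G (y ` {..<i}) \<longrightarrow> z = 0)"
  show ?thesis
  proof (rule free_rank_ge[of n y])
    show "y i \<in> carrier G" if "i < n" for i using y that by blast
    show "y i \<otimes> y l = y l \<otimes> y i" if "i < n" "l < n" for i l using y that by blast
    show "z = 0" if "i < n" "y i [^] (z::int) \<in> generate G (y ` {..<i})" for i z
      using y that by blast
  qed
qed

section \<open>Minimal generating sets and the free rank\<close>

text \<open>The chart of the whole group bounds the free rank from above by the number of its
  \<open>UNIV\<close> coordinates, and minimality bounds it from below by \<open>card S\<close>. The
  bounds meet only if every generator contributes an integer coordinate.\<close>

lemma (in group) min_generators_finite:
  assumes lf: "locally_finite_by_abelian G" and count: "countable (carrier G)"
    and S: "min_locally_finite_index_generators G S" "finite S"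
  shows "free_rank G = enat (card S)"
    and "\<exists>F. coarse_chart G (generate G S) F (\<lambda>i::nat \<times> nat. if fst i = 0 \<and> snd i < card S then UNIV else {0})"
    and "\<exists>F C. coarse_chart G (carrier G) F (C :: nat \<times> nat \<Rightarrow> int set) \<and>
       finite {i. infinite (C i)} \<and> card {i. infinite (C i)} \<le> card S"
proof -
  have Sc: "S \<subseteq> carrier G" and Sl: "locally_finite_index G (generate G S)"
    and Smin: "\<And>T. T \<subseteq> carrier G \<Longrightarrow> locally_finite_index G (generate G T) \<Longrightarrow> S \<lesssim> T"
    using S(1) by (auto simp: min_locally_finite_index_generators_def)
  obtain F :: "'a \<Rightarrow> nat \<times> nat \<Rightarrow> int" and C where F: "coarse_chart G (generate G S) F C" "\<And>i. 0 \<in> C i"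
    "\<And>i. C i \<noteq> {0} \<Longrightarrow> fst i = 0 \<and> snd i < card S" "\<And>i. C i = UNIV \<or> finite (C i)"
    "(\<forall>k<card S. C (0, k) = UNIV) \<or> card {i. C i = UNIV} < card S"
    using chart_generate[OF lf S(2) Sc] by blast
  have Cf: "finite {i. C i \<noteq> {0}}"
  proof (rule finite_subset)
    show "{i. C i \<noteq> {0}} \<subseteq> {0} \<times> {..<card S}"
    proof
      fix i assume "i \<in> {i. C i \<noteq> {0}}"
      then show "i \<in> {0} \<times> {..<card S}" using F(3)[of i] by (cases i) simp
    qed
  qed simp
  have Cp: "C (p, k) = {0}" if "prime p" for p k using F(3)[of "(p, k)"] that by auto
  let ?C = "\<lambda>i. if prime (fst i) \<and> enat (snd i) < factorizing_function G (generate G S) (fst i)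
    then {0..<int (fst i)} else C i"
  obtain F' where F': "coarse_chart G (carrier G) F' ?C"
    using chart_locally_finite_extension[OF lf count S(2) Sc refl Sl F(1,2) Cf Cp] by blast
  have inf: "infinite (C i) \<longleftrightarrow> C i = UNIV" for i using F(4)[of i] infinite_UNIV_int by auto
  have infC: "{i. infinite (?C i)} = {i. C i = UNIV}"
    using inf Cp by (auto split: if_splits) (metis inf finite.emptyI finite.insertI)+
  have Usub: "{i. C i = UNIV} \<subseteq> {i. C i \<noteq> {0}}"
  proof
    fix i assume "i \<in> {i. C i = UNIV}"
    then have "1 \<in> C i" by simp
    then show "i \<in> {i. C i \<noteq> {0}}" by auto
  qed
  have Ufin: "finite {i. C i = UNIV}" using finite_subset[OF Usub Cf] .
  have idc: "coarse_map G G id"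
    unfolding coarse_map_def by (auto intro!: exI[of _ "_"])
  \<comment> \<open>The identity serves as coarse injection of \<open>G\<close> into its own
    chart.\<close>
  have le: "free_rank G \<le> enat (card {i. C i = UNIV})"
    by (rule free_rank_le_of_coarse_injection[OF group_axioms group_axioms idc _ F'])
       (use infC Ufin in simp_all)
  have ge: "enat (card S) \<le> free_rank G"
  proof -
    have "\<not> locally_finite_index G (generate G T)" if "finite T" "T \<subseteq> carrier G" "card T < card S" for T
      using Smin[of T] that lepoll_iff_card_le[OF S(2) that(1)] by auto
    then show ?thesis by (rule free_rank_ge_of_not_locally_finite_index[OF lf])
  qed
  \<comment> \<open>Excludes the deficit in the invariant of \<open>chart_generate\<close>.\<close>
  have "enat (card S) \<le> enat (card {i. C i = UNIV})" using ge le by (rule order_trans)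
  then have all: "\<forall>k<card S. C (0, k) = UNIV" using F(5) by auto
  have Ceq: "C = (\<lambda>i. if fst i = 0 \<and> snd i < card S then UNIV else {0})"
  proof
    fix i
    show "C i = (if fst i = 0 \<and> snd i < card S then UNIV else {0})"
      using all F(3)[of i] by (cases i) auto
  qed
  show "\<exists>F. coarse_chart G (generate G S) F (\<lambda>i::nat \<times> nat. if fst i = 0 \<and> snd i < card S then UNIV else {0})"
    using F(1) unfolding Ceq by blast
  have "{i. C i = UNIV} \<subseteq> {0} \<times> {..<card S}"
  proof
    fix i assume "i \<in> {i. C i = UNIV}"
    then have "C i \<noteq> {0}" using Usub by blast
    then show "i \<in> {0} \<times> {..<card S}" using F(3)[of i] by (cases i) simp
  qed
  then have "card {i. C i = UNIV} \<le> card S" using card_mono[of "{0::nat} \<times> {..<card S}"] by fastforce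
  then show "free_rank G = enat (card S)" using le ge by (metis antisym enat_ord_simps(1) order_trans)
  show "\<exists>F C. coarse_chart G (carrier G) F (C :: nat \<times> nat \<Rightarrow> int set) \<and>
       finite {i. infinite (C i)} \<and> card {i. infinite (C i)} \<le> card S"
    using F' infC Ufin \<open>card {i. C i = UNIV} \<le> card S\<close> by (intro exI[of _ F'] exI[of _ ?C]) simp
qed

text \<open>A finite \<open>T\<close> with the property would be smaller than the infinite minimal
  \<open>S\<close>. Independent elements therefore never run out.\<close>

lemma (in group) min_generators_infinite:
  assumes lf: "locally_finite_by_abelian G"
    and S: "min_locally_finite_index_generators G S" "infinite S"
  shows "free_rank G = \<infinity>"
    and "\<And>T. finite T \<Longrightarrow> T \<subseteq> carrier G \<Longrightarrow> \<not> locally_finite_index G (generate G T)"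
proof -
  show not: "\<not> locally_finite_index G (generate G T)" if "finite T" "T \<subseteq> carrier G" for T
    using S that infinite_le_lepoll[of S] infinite_le_lepoll[of T] lepoll_trans
    unfolding min_locally_finite_index_generators_def by blast
  have "enat n \<le> free_rank G" for n
  proof -
    show ?thesis by (rule free_rank_ge_of_not_locally_finite_index[OF lf]) (rule not)
  qed
  then show "free_rank G = \<infinity>"
    by (metis enat_ord_simps(1) not_less_eq_eq order_refl enat.exhaust)
qed

lemma free_rank_le_of_coarsely_isomorphic:
  assumes G: "group G" and H: "group H" "countable (carrier H)" "locally_finite_by_abelian H"
    "min_locally_finite_index_generators H S" and iso: "coarse_isomorphism G H f"
  shows "free_rank G \<le> free_rank H"
proof (cases "finite S")
  case True
  interpret H: group H by fact
  obtain F and C :: "nat \<times> nat \<Rightarrow> int set" where "coarse_chart H (carrier H) F C"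
    "finite {i. infinite (C i)}" "card {i. infinite (C i)} \<le> card S"
    using H.min_generators_finite(3)[OF H(3,2,4) True] by blast
  then have "free_rank G \<le> enat (card S)"
    using free_rank_le_of_coarse_injection[OF G H(1)] iso
    unfolding coarse_isomorphism_def bij_betw_def by blast
  then show ?thesis using H.min_generators_finite(1)[OF H(3,2,4) True] by simp
next
  case False
  then show ?thesis using group.min_generators_infinite(1)[OF H(1,3,4)] by simp
qed

lemma coarse_isomorphism_sym:
  assumes "group G" "coarse_isomorphism G H f"
  shows "coarse_isomorphism H G (inv_into (carrier G) f)"
proof -
  have b: "bij_betw f (carrier G) (carrier H)" using assms by (simp add: coarse_isomorphism_def)
  have ii: "f x = inv_into (carrier H) (inv_into (carrier G) f) x" if "x \<in> carrier G" for x
    using inv_into_inv_into_eq[OF b that] by simp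
  have f: "coarse_map G H f" using assms(2) by (simp add: coarse_isomorphism_def)
  have "coarse_map G H (inv_into (carrier H) (inv_into (carrier G) f))"
  proof (rule coarse_map_cong[where f = f and G = G])
    show "f x = inv_into (carrier H) (inv_into (carrier G) f) x" if "x \<in> carrier G" for x
      using ii[OF that] .
  qed (fact assms(1) f)+
  then show ?thesis using assms bij_betw_inv_into[OF b] by (simp add: coarse_isomorphism_def)
qed

section \<open>Folner sets and fibers of coarse isomorphisms\<close>

text \<open>The sets are boxes: a long interval in each integer coordinate and the full range in
  each finite one. Right multiplication by \<open>D\<close> leads at most to the box enlarged by
  \<open>l\<close> on both sides, and the ratio of the cardinalities tends to 1.\<close>

lemma (in group) chart_foelner:
  assumes K: "subgroup K G" and F: "coarse_chart G K F C"
    and C0: "\<And>i. 0 \<in> C i" and Cf: "finite {i. C i \<noteq> {0}}"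
    and CU: "\<And>i. C i = UNIV \<or> finite (C i)"
    and D: "finite D" "D \<subseteq> K" and \<epsilon>: "0 < (\<epsilon>::real)"
  shows "\<exists>B. finite B \<and> B \<noteq> {} \<and> B \<subseteq> K \<and>
    real (card ((\<lambda>(b, d). b \<otimes> d) ` (B \<times> D) - B)) \<le> \<epsilon> * card B"
proof -
  obtain J n where J: "\<forall>g\<in>K. \<forall>d\<in>D. near J n (F g) (F (g \<otimes> d))"
    using coarse_chartD(2)[OF F D] by blast
  \<comment> \<open>For empty \<open>D\<close> the bound \<open>n\<close> may be negative; the
    enlargement must not be.\<close>
  define l where "l = max n 0"
  define U where "U = {i. C i = UNIV}"
  define I where "I = {i. C i \<noteq> {0}}"
  have UI: "U \<subseteq> I"
  proof
    fix i assume "i \<in> U"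
    then have "1 \<in> C i" by (simp add: U_def)
    then show "i \<in> I" by (auto simp: I_def)
  qed
  have fI: "finite I" using Cf by (simp add: I_def)
  have fU: "finite U" using UI fI finite_subset by blast
  define box where "box a b i = (if C i = UNIV then {a..b} else C i)" for a b :: int and i
  define Q where "Q = (\<Prod>i\<in>I - U. card (C i))"
  have boxI: "box a b i = {0}" if "i \<notin> I" for a b i
    using that UI by (auto simp: box_def I_def U_def)
  have boxfin: "finite (box a b i)" for a b i using CU[of i] by (auto simp: box_def)
  have cbox: "card (fsupp (box a b)) = nat (b - a + 1) ^ card U * Q" for a b
  proof -
    have "card (fsupp (box a b)) = (\<Prod>i\<in>I. card (box a b i))" by (rule card_fsupp[OF fI boxI])
    also have "\<dots> = (\<Prod>i\<in>I \<inter> U. card (box a b i)) * (\<Prod>i\<in>I - U. card (box a b i))"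
      using prod.Int_Diff[OF fI] .
    also have "I \<inter> U = U" using UI by blast
    also have "(\<Prod>i\<in>U. card (box a b i)) = nat (b - a + 1) ^ card U"
      by (simp add: box_def U_def)
    also have "(\<Prod>i\<in>I - U. card (box a b i)) = Q"
      unfolding Q_def by (rule prod.cong) (auto simp: box_def U_def)
    finally show ?thesis .
  qed
  have fbox: "finite (fsupp (box a b))" for a b by (rule finite_fsupp[OF fI boxI boxfin])
  have sub: "fsupp (box a b) \<subseteq> fsupp C" for a b by (auto simp: fsupp_def box_def split: if_splits)
  have Q0: "0 < Q" unfolding Q_def
  proof (rule prod_pos)
    show "0 < card (C i)" if "i \<in> I - U" for i
      using that CU[of i] C0[of i] by (auto simp: U_def card_gt_0_iff)
  qed
  note b = coarse_chartD(1)[OF F]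
  have injF: "inj_on F K" using b by (simp add: bij_betw_def)
  define B where "B R = {g \<in> K. F g \<in> fsupp (box 0 (int R))}" for R :: nat
  have FB: "F ` {g \<in> K. F g \<in> fsupp (box a c)} = fsupp (box a c)" for a c
  proof -
    have "F ` {g \<in> K. F g \<in> fsupp (box a c)} = F ` K \<inter> fsupp (box a c)" by auto
    also have "F ` K = fsupp C" using b by (simp add: bij_betw_def)
    finally show ?thesis using sub by blast
  qed
  have cB: "card {g \<in> K. F g \<in> fsupp (box a c)} = nat (c - a + 1) ^ card U * Q" for a c
  proof -
    have "inj_on F {g \<in> K. F g \<in> fsupp (box a c)}" using injF by (rule inj_on_subset) auto
    from card_image[OF this] show ?thesis unfolding FB cbox by simp
  qed
  have fB: "finite {g \<in> K. F g \<in> fsupp (box a c)}" for a c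
  proof (rule finite_imageD)
    show "finite (F ` {g \<in> K. F g \<in> fsupp (box a c)})" unfolding FB by (rule fbox)
    show "inj_on F {g \<in> K. F g \<in> fsupp (box a c)}" using injF by (rule inj_on_subset) auto
  qed
  have bound: "real (card ((\<lambda>(b, d). b \<otimes> d) ` (B R \<times> D) - B R)) \<le>
      ((1 + (2 * real_of_int l) / (real R + 1)) ^ card U - 1) * real (card (B R))" for R
  proof -
    let ?B' = "{g \<in> K. F g \<in> fsupp (box (-l) (int R + l))}"
    have BB': "B R \<subseteq> ?B'"
    proof
      fix g assume g: "g \<in> B R"
      have "box 0 (int R) i \<subseteq> box (-l) (int R + l) i" for i by (auto simp: box_def l_def)
      then show "g \<in> ?B'" using g by (auto simp: B_def fsupp_def)
    qed
    have "(\<lambda>(b, d). b \<otimes> d) ` (B R \<times> D) \<subseteq> ?B'"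
    proof clarify
      fix g d assume g: "g \<in> B R" and d: "d \<in> D"
      have gK: "g \<in> K" using g by (simp add: B_def)
      have gd: "g \<otimes> d \<in> K" using gK d D(2) subgroup.m_closed[OF K] by blast
      have Fgd: "F (g \<otimes> d) \<in> fsupp C" using b gd by (auto simp: bij_betw_def)
      have nr: "\<bar>F g i - F (g \<otimes> d) i\<bar> \<le> l" for i
      proof -
        have "\<bar>F g i - F (g \<otimes> d) i\<bar> \<le> n" using J gK d by (simp add: near_def)
        then show ?thesis by (simp add: l_def)
      qed
      have "F (g \<otimes> d) i \<in> box (-l) (int R + l) i" for i
      proof (cases "C i = UNIV")
        case True
        have "F g i \<in> box 0 (int R) i" using g by (simp add: B_def fsupp_def)
        then have "0 \<le> F g i" "F g i \<le> int R" using True by (auto simp: box_def)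
        then have "- l \<le> F (g \<otimes> d) i" "F (g \<otimes> d) i \<le> int R + l" using nr[of i] by linarith+
        then show ?thesis using True by (simp add: box_def)
      next
        case False
        then show ?thesis using Fgd by (simp add: box_def fsupp_def)
      qed
      then show "g \<otimes> d \<in> K \<and> F (g \<otimes> d) \<in> fsupp (box (-l) (int R + l))"
        using gd Fgd by (simp add: fsupp_def)
    qed
    then have "card ((\<lambda>(b, d). b \<otimes> d) ` (B R \<times> D) - B R) \<le> card (?B' - B R)"
      using fB by (intro card_mono) auto
    also have "\<dots> = card ?B' - card (B R)"
      using BB' fB[of 0 "int R"] by (intro card_Diff_subset) (auto simp: B_def)
    finally have "real (card ((\<lambda>(b, d). b \<otimes> d) ` (B R \<times> D) - B R)) \<le> real (card ?B' - card (B R))"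
      by simp
    also have "\<dots> = real (card ?B') - real (card (B R))"
      using card_mono[OF fB BB'] by (simp add: of_nat_diff)
    also have "\<dots> = ((1 + (2 * real_of_int l) / (real R + 1)) ^ card U - 1) * real (card (B R))"
    proof -
      have 1: "card (B R) = (R + 1) ^ card U * Q" unfolding B_def cB by (simp add: nat_add_distrib)
      have l0: "0 \<le> l" by (simp add: l_def)
      have "real (nat (int R + l - - l + 1)) = (1 + (2 * real_of_int l) / (real R + 1)) * (real R + 1)"
        using l0 by (simp add: field_simps)
      then have "real (card ?B') = (1 + (2 * real_of_int l) / (real R + 1)) ^ card U * (real R + 1) ^ card U * real Q"
        unfolding cB by (simp add: power_mult_distrib)
      moreover have "real (card (B R)) = (real R + 1) ^ card U * real Q" unfolding 1 by (simp add: add.commute)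
      ultimately show ?thesis by (simp only: left_diff_distrib mult_1 mult.assoc)
    qed
    finally show ?thesis .
  qed
  \<comment> \<open>The relative excess of the enlarged box, with \<open>card U\<close> factors of
    the form \<open>1 + 2 * l / (R + 1)\<close>.\<close>
  have "(\<lambda>R::nat. (1 + (2 * real_of_int l) / (real R + 1)) ^ card U - 1) \<longlonglongrightarrow> (1 + 0) ^ card U - 1"
  proof (intro tendsto_diff tendsto_power tendsto_add tendsto_const)
    show "(\<lambda>R::nat. (2 * real_of_int l) / (real R + 1)) \<longlonglongrightarrow> 0"
      using tendsto_mult_right_zero[OF LIMSEQ_inverse_real_of_nat, of "2 * real_of_int l"]
      by (simp add: divide_inverse add.commute)
  qed
  then have "eventually (\<lambda>R. (1 + (2 * real_of_int l) / (real R + 1)) ^ card U - 1 < \<epsilon>) sequentially"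
    using \<epsilon> by (intro order_tendstoD(2)[of _ 0]) simp_all
  then obtain R where R: "(1 + (2 * real_of_int l) / (real R + 1)) ^ card U - 1 < \<epsilon>"
    using eventually_happens'[OF sequentially_bot] by blast
  have "card (B R) > 0" unfolding B_def cB using Q0 by simp
  then have "finite (B R)" "B R \<noteq> {}" by (auto simp: card_gt_0_iff)
  moreover have "B R \<subseteq> K" by (auto simp: B_def)
  moreover have "real (card ((\<lambda>(b, d). b \<otimes> d) ` (B R \<times> D) - B R)) \<le> \<epsilon> * card (B R)"
    using bound[of R] R by (meson less_imp_le mult_right_mono of_nat_0_le_iff order_trans)
  ultimately show ?thesis by blast
qed

section \<open>Fibers over cosets\<close>

text \<open>A coset of a finitely generated subgroup is connected by steps from a finite set. The
  displacement of a product telescopes into displacements of single steps, taken at different base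
  points but all in one finite set.\<close>

lemma coarse_map_generate:
  assumes "group G" "group H" and f: "coarse_map G H f" and T: "finite T" "T \<subseteq> carrier G"
  obtains D where "finite D" "D \<subseteq> carrier H"
    "\<And>x h. x \<in> carrier G \<Longrightarrow> h \<in> generate G T \<Longrightarrow> inv\<^bsub>H\<^esub> (f x) \<otimes>\<^bsub>H\<^esub> f (x \<otimes>\<^bsub>G\<^esub> h) \<in> generate H D"
proof -
  interpret G: group G by fact
  interpret H: group H by fact
  have fc: "f x \<in> carrier H" if "x \<in> carrier G" for x
    using f that by (auto simp: coarse_map_def)
  \<comment> \<open>Words use inverses of generators as steps, too.\<close>
  define E where "E = T \<union> m_inv G ` T"
  have "finite E" "E \<subseteq> carrier G" using T by (auto simp: E_def)
  then obtain D where D: "finite D" "D \<subseteq> carrier H"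
    "\<forall>x\<in>carrier G. f ` (x <#\<^bsub>G\<^esub> E) \<subseteq> f x <#\<^bsub>H\<^esub> D"
    using f unfolding coarse_map_def by meson
  have sD: "subgroup (generate H D) H" using H.generate_is_subgroup[OF D(2)] .
  have step: "inv\<^bsub>H\<^esub> (f x) \<otimes>\<^bsub>H\<^esub> f (x \<otimes>\<^bsub>G\<^esub> e) \<in> generate H D" if x: "x \<in> carrier G" and e: "e \<in> E" for x e
  proof -
    have "f (x \<otimes>\<^bsub>G\<^esub> e) \<in> f x <#\<^bsub>H\<^esub> D" using D(3) x e by (force simp: l_coset_def)
    then obtain d where d: "d \<in> D" "f (x \<otimes>\<^bsub>G\<^esub> e) = f x \<otimes>\<^bsub>H\<^esub> d" by (auto simp: l_coset_def)
    then have "inv\<^bsub>H\<^esub> (f x) \<otimes>\<^bsub>H\<^esub> f (x \<otimes>\<^bsub>G\<^esub> e) = d" using fc[OF x] D(2) by (auto simp: H.cancel_inv)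
    then show ?thesis using d by (simp add: generate.incl)
  qed
  have "inv\<^bsub>H\<^esub> (f x) \<otimes>\<^bsub>H\<^esub> f (x \<otimes>\<^bsub>G\<^esub> h) \<in> generate H D" if "x \<in> carrier G" "h \<in> generate G T" for x h
    using that(2,1)
  proof (induction h arbitrary: x rule: generate.induct)
    case one
    then show ?case using fc by (simp add: generate.one)
  next
    case (incl h) then show ?case using step by (simp add: E_def)
  next
    case (inv h) then show ?case using step by (simp add: E_def)
  next
    case (eng a b)
    have ab: "a \<in> carrier G" "b \<in> carrier G" using eng G.generate_in_carrier[OF T(2)] by auto
    have xa: "x \<otimes>\<^bsub>G\<^esub> a \<in> carrier G" using eng ab by simp
    have c: "f x \<in> carrier H" "f (x \<otimes>\<^bsub>G\<^esub> a) \<in> carrier H" "f (x \<otimes>\<^bsub>G\<^esub> a \<otimes>\<^bsub>G\<^esub> b) \<in> carrier H"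
      using fc eng xa ab by auto
    have "inv\<^bsub>H\<^esub> (f x) \<otimes>\<^bsub>H\<^esub> f (x \<otimes>\<^bsub>G\<^esub> (a \<otimes>\<^bsub>G\<^esub> b)) =
      (inv\<^bsub>H\<^esub> (f x) \<otimes>\<^bsub>H\<^esub> f (x \<otimes>\<^bsub>G\<^esub> a)) \<otimes>\<^bsub>H\<^esub> (inv\<^bsub>H\<^esub> (f (x \<otimes>\<^bsub>G\<^esub> a)) \<otimes>\<^bsub>H\<^esub> f (x \<otimes>\<^bsub>G\<^esub> a \<otimes>\<^bsub>G\<^esub> b))"
      using c eng ab by (simp add: H.m_assoc H.cancel_inv G.m_assoc)
    also have "\<dots> \<in> generate H D"
      using eng.IH(1)[OF eng.prems] eng.IH(2)[OF xa] by (rule generate.eng)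
    finally show ?case .
  qed
  then show thesis using that D by blast
qed

text \<open>Passing from \<open>x \<otimes> h\<close> to \<open>x' \<otimes> h\<close> is right
  multiplication by a conjugate of \<open>w\<close>, and passing from base point \<open>u\<close> to
  \<open>v\<close> produces a conjugate of \<open>w'\<close>. Both kinds of conjugates are finitely
  many, so the two displacements from the base points differ by a factor from a finite
  \<open>D\<close>. An \<open>h\<close> counted on the left and not on the right thus lands in the
  boundary of \<open>B\<close>.\<close>

lemma fiber_count_le:
  assumes "group G" "group H" and lfG: "locally_finite_by_abelian G" and lfH: "locally_finite_by_abelian H"
    and f: "coarse_map G H f" "inj_on f (carrier G)"
    and S: "finite S" "S \<subseteq> carrier G" "A = generate G S"
    and R: "finite R" "R \<subseteq> carrier H" "L = generate H R"
    and fA: "\<And>x h. x \<in> carrier G \<Longrightarrow> h \<in> A \<Longrightarrow> inv\<^bsub>H\<^esub> (f x) \<otimes>\<^bsub>H\<^esub> f (x \<otimes>\<^bsub>G\<^esub> h) \<in> L"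
    and uv: "u \<in> carrier H" "v \<in> carrier H"
    and x: "x \<in> carrier G" "x' \<in> carrier G"
    and x'v: "inv\<^bsub>H\<^esub> v \<otimes>\<^bsub>H\<^esub> f x' \<in> L"
  shows "\<exists>D. finite D \<and> D \<subseteq> L \<and> (\<forall>B. finite B \<and> B \<subseteq> L \<longrightarrow>
    card {h \<in> A. inv\<^bsub>H\<^esub> u \<otimes>\<^bsub>H\<^esub> f (x \<otimes>\<^bsub>G\<^esub> h) \<in> B} \<le>
    card {h \<in> A. inv\<^bsub>H\<^esub> v \<otimes>\<^bsub>H\<^esub> f (x' \<otimes>\<^bsub>G\<^esub> h) \<in> B} + card ((\<lambda>(b, d). b \<otimes>\<^bsub>H\<^esub> d) ` (B \<times> D) - B))"
proof -
  interpret G: group G by fact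
  interpret H: group H by fact
  have sA: "subgroup A G" using G.generate_is_subgroup[OF S(2)] S(3) by simp
  have sL: "subgroup L H" using H.generate_is_subgroup[OF R(2)] R(3) by simp
  note Ac = subgroup.mem_carrier[OF sA] and Lc = subgroup.mem_carrier[OF sL]
  have fc: "f z \<in> carrier H" if "z \<in> carrier G" for z
    using f(1) that by (auto simp: coarse_map_def)
  define w where "w = inv\<^bsub>G\<^esub> x \<otimes>\<^bsub>G\<^esub> x'"
  have w: "w \<in> carrier G" using x by (simp add: w_def)
  define E where "E = {inv\<^bsub>G\<^esub> h \<otimes>\<^bsub>G\<^esub> w \<otimes>\<^bsub>G\<^esub> h | h. h \<in> A}"
  have "finite {inv\<^bsub>G\<^esub> s \<otimes>\<^bsub>G\<^esub> e \<otimes>\<^bsub>G\<^esub> s | s e. s \<in> generate G (insert w S) \<and> e \<in> {w}}"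
    using G.conjugates_finite[OF lfG, of "insert w S" "{w}"] S w by (auto intro: generate.incl)
  moreover have "A \<subseteq> generate G (insert w S)" unfolding S(3) by (rule G.mono_generate) auto
  ultimately have E: "finite E" unfolding E_def by (rule_tac rev_finite_subset) auto
  have Ec: "E \<subseteq> carrier G" using w Ac by (auto simp: E_def)
  obtain DE where DE: "finite DE" "DE \<subseteq> carrier H" "\<forall>z\<in>carrier G. f ` (z <#\<^bsub>G\<^esub> E) \<subseteq> f z <#\<^bsub>H\<^esub> DE"
    using f(1) E Ec unfolding coarse_map_def by meson
  define w' where "w' = inv\<^bsub>H\<^esub> v \<otimes>\<^bsub>H\<^esub> u"
  have w': "w' \<in> carrier H" using uv by (simp add: w'_def)
  define E' where "E' = {inv\<^bsub>H\<^esub> b \<otimes>\<^bsub>H\<^esub> w' \<otimes>\<^bsub>H\<^esub> b | b. b \<in> L}"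
  have "finite {inv\<^bsub>H\<^esub> s \<otimes>\<^bsub>H\<^esub> e \<otimes>\<^bsub>H\<^esub> s | s e. s \<in> generate H (insert w' R) \<and> e \<in> {w'}}"
    using H.conjugates_finite[OF lfH, of "insert w' R" "{w'}"] R w' by (auto intro: generate.incl)
  moreover have "L \<subseteq> generate H (insert w' R)" unfolding R(3) by (rule H.mono_generate) auto
  ultimately have E': "finite E'" unfolding E'_def by (rule_tac rev_finite_subset) auto
  \<comment> \<open>The intersection with \<open>L\<close> loses nothing that occurs: both
    displacements lie in \<open>L\<close>, hence so does their quotient.\<close>
  define D where "D = L \<inter> (\<lambda>(a, b). a \<otimes>\<^bsub>H\<^esub> b) ` (E' \<times> DE)"
  have D: "finite D" "D \<subseteq> L" using E' DE by (auto simp: D_def)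
  have "card {h \<in> A. inv\<^bsub>H\<^esub> u \<otimes>\<^bsub>H\<^esub> f (x \<otimes>\<^bsub>G\<^esub> h) \<in> B} \<le>
    card {h \<in> A. inv\<^bsub>H\<^esub> v \<otimes>\<^bsub>H\<^esub> f (x' \<otimes>\<^bsub>G\<^esub> h) \<in> B} + card ((\<lambda>(b, d). b \<otimes>\<^bsub>H\<^esub> d) ` (B \<times> D) - B)"
    if B: "finite B" "B \<subseteq> L" for B
  proof -
    let ?BD = "(\<lambda>(b, d). b \<otimes>\<^bsub>H\<^esub> d) ` (B \<times> D)"
    let ?\<psi> = "\<lambda>h. inv\<^bsub>H\<^esub> v \<otimes>\<^bsub>H\<^esub> f (x' \<otimes>\<^bsub>G\<^esub> h)"
    have in_BD: "?\<psi> h \<in> ?BD" if h: "h \<in> A" "inv\<^bsub>H\<^esub> u \<otimes>\<^bsub>H\<^esub> f (x \<otimes>\<^bsub>G\<^esub> h) \<in> B" for h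
    proof -
      define b where "b = inv\<^bsub>H\<^esub> u \<otimes>\<^bsub>H\<^esub> f (x \<otimes>\<^bsub>G\<^esub> h)"
      have hc: "h \<in> carrier G" using h Ac by simp
      have xh: "x \<otimes>\<^bsub>G\<^esub> h \<in> carrier G" "x' \<otimes>\<^bsub>G\<^esub> h \<in> carrier G" using x hc by auto
      have b: "b \<in> B" "b \<in> L" "b \<in> carrier H" using h(2) B(2) Lc by (auto simp: b_def)
      have fxh: "f (x \<otimes>\<^bsub>G\<^esub> h) = u \<otimes>\<^bsub>H\<^esub> b" unfolding b_def using uv fc[OF xh(1)] by (simp add: H.cancel_inv)
      define e where "e = inv\<^bsub>G\<^esub> h \<otimes>\<^bsub>G\<^esub> w \<otimes>\<^bsub>G\<^esub> h"
      have e: "e \<in> E" using h(1) by (auto simp: E_def e_def)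
      have xe: "x \<otimes>\<^bsub>G\<^esub> h \<otimes>\<^bsub>G\<^esub> e = x' \<otimes>\<^bsub>G\<^esub> h"
        unfolding e_def w_def using x hc by (simp add: G.m_assoc G.cancel_inv)
      have "f (x' \<otimes>\<^bsub>G\<^esub> h) \<in> f (x \<otimes>\<^bsub>G\<^esub> h) <#\<^bsub>H\<^esub> DE"
      proof -
        have "x' \<otimes>\<^bsub>G\<^esub> h \<in> (x \<otimes>\<^bsub>G\<^esub> h) <#\<^bsub>G\<^esub> E" using e xe by (force simp: l_coset_def)
        then show ?thesis using DE(3) xh(1) by blast
      qed
      then obtain d where d: "d \<in> DE" "f (x' \<otimes>\<^bsub>G\<^esub> h) = u \<otimes>\<^bsub>H\<^esub> b \<otimes>\<^bsub>H\<^esub> d"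
        by (auto simp: l_coset_def fxh)
      have dc: "d \<in> carrier H" using d DE by auto
      define e' where "e' = inv\<^bsub>H\<^esub> b \<otimes>\<^bsub>H\<^esub> w' \<otimes>\<^bsub>H\<^esub> b"
      have e': "e' \<in> E'" "e' \<in> carrier H" using b w' by (auto simp: E'_def e'_def)
      have \<psi>: "?\<psi> h = b \<otimes>\<^bsub>H\<^esub> (e' \<otimes>\<^bsub>H\<^esub> d)"
        unfolding d(2) e'_def w'_def using uv b dc by (simp add: H.m_assoc H.cancel_inv)
      have "?\<psi> h \<in> L"
      proof -
        have "?\<psi> h = (inv\<^bsub>H\<^esub> v \<otimes>\<^bsub>H\<^esub> f x') \<otimes>\<^bsub>H\<^esub> (inv\<^bsub>H\<^esub> (f x') \<otimes>\<^bsub>H\<^esub> f (x' \<otimes>\<^bsub>G\<^esub> h))"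
          using uv fc[OF x(2)] fc[OF xh(2)] by (simp add: H.m_assoc H.cancel_inv)
        then show ?thesis using subgroup.m_closed[OF sL x'v fA[OF x(2) h(1)]] by simp
      qed
      then have "inv\<^bsub>H\<^esub> b \<otimes>\<^bsub>H\<^esub> ?\<psi> h \<in> L"
        using subgroup.m_closed[OF sL subgroup.m_inv_closed[OF sL b(2)]] by blast
      then have "e' \<otimes>\<^bsub>H\<^esub> d \<in> L" unfolding \<psi> using b e' dc by (simp add: H.cancel_inv)
      then have "e' \<otimes>\<^bsub>H\<^esub> d \<in> D" unfolding D_def using e' d(1) by auto
      then show ?thesis unfolding \<psi> using b(1) by force
    qed
    have inj: "inj_on ?\<psi> A"
    proof (rule inj_onI)
      fix h h' assume h: "h \<in> A" "h' \<in> A" "?\<psi> h = ?\<psi> h'"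
      have c: "x' \<otimes>\<^bsub>G\<^esub> h \<in> carrier G" "x' \<otimes>\<^bsub>G\<^esub> h' \<in> carrier G" using x Ac h by auto
      have "f (x' \<otimes>\<^bsub>G\<^esub> h) = f (x' \<otimes>\<^bsub>G\<^esub> h')"
        using h(3) uv fc[OF c(1)] fc[OF c(2)] by simp
      then have "x' \<otimes>\<^bsub>G\<^esub> h = x' \<otimes>\<^bsub>G\<^esub> h'" using f(2) c by (meson inj_onD)
      then show "h = h'" using x Ac h by simp
    qed
    let ?P = "{h \<in> A. inv\<^bsub>H\<^esub> u \<otimes>\<^bsub>H\<^esub> f (x \<otimes>\<^bsub>G\<^esub> h) \<in> B}" and ?P' = "{h \<in> A. ?\<psi> h \<in> B}"
    have fBD: "finite ?BD" using B(1) D(1) by simp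
    have fP': "finite ?P'"
    proof (rule finite_imageD)
      show "finite (?\<psi> ` ?P')" by (rule finite_subset[OF _ B(1)]) auto
      show "inj_on ?\<psi> ?P'" using inj by (rule inj_on_subset) auto
    qed
    \<comment> \<open>Injectivity of the displacement turns this inclusion into the bound by the
      size of the boundary.\<close>
    have img: "?\<psi> ` (?P - ?P') \<subseteq> ?BD - B" using in_BD by blast
    have injd: "inj_on ?\<psi> (?P - ?P')" using inj by (rule inj_on_subset) auto
    have "card (?P - ?P') \<le> card (?BD - B)"
      using card_inj_on_le[OF injd img] fBD by simp
    moreover have "finite (?P - ?P')" using finite_imageD[OF finite_subset[OF img] injd] fBD by simp
    then have "card ?P \<le> card (?P' \<union> (?P - ?P'))" using fP' by (intro card_mono) auto
    then have "card ?P \<le> card ?P' + card (?P - ?P')" using card_Un_le order_trans by blast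
    ultimately show ?thesis by linarith
  qed
  then show ?thesis using D by blast
qed

text \<open>The left cosets of \<open>A\<close> that meet the preimage of \<open>Y\<close>. When
  \<open>f\<close> maps cosets of \<open>A\<close> into cosets of \<open>L\<close> and
  \<open>Y\<close> is such a coset, they partition the preimage.\<close>

definition fiber_cosets ::
    "('a, 'c) monoid_scheme \<Rightarrow> 'a set \<Rightarrow> ('a \<Rightarrow> 'b) \<Rightarrow> 'b set \<Rightarrow> 'a set set" where
  "fiber_cosets G A f Y = (\<lambda>x. x <#\<^bsub>G\<^esub> A) ` {x \<in> carrier G. f x \<in> Y}"

text \<open>\<open>f\<close> is a bijection and the cosets in the fiber are disjoint, so every
  element of \<open>B\<close>, shifted to \<open>u\<close>, is hit exactly once by some
  representative \<open>x\<close> and some \<open>h\<close> in \<open>A\<close>.\<close>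

lemma fiber_cosets_sum:
  assumes "group G" "group H" and f: "bij_betw f (carrier G) (carrier H)"
    and sA: "subgroup A G" and sL: "subgroup L H"
    and fA: "\<And>x h. x \<in> carrier G \<Longrightarrow> h \<in> A \<Longrightarrow> inv\<^bsub>H\<^esub> (f x) \<otimes>\<^bsub>H\<^esub> f (x \<otimes>\<^bsub>G\<^esub> h) \<in> L"
    and u: "u \<in> carrier H" and fin: "finite (fiber_cosets G A f (u <#\<^bsub>H\<^esub> L))"
  shows "\<exists>X. finite X \<and> X \<subseteq> carrier G \<and> card X = card (fiber_cosets G A f (u <#\<^bsub>H\<^esub> L)) \<and>
    (\<forall>x\<in>X. inv\<^bsub>H\<^esub> u \<otimes>\<^bsub>H\<^esub> f x \<in> L) \<and>
    (\<forall>B. finite B \<and> B \<subseteq> L \<longrightarrow>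
       card B = (\<Sum>x\<in>X. card {h \<in> A. inv\<^bsub>H\<^esub> u \<otimes>\<^bsub>H\<^esub> f (x \<otimes>\<^bsub>G\<^esub> h) \<in> B}))"
proof -
  interpret G: group G by fact
  interpret H: group H by fact
  note Ac = subgroup.mem_carrier[OF sA] and Lc = subgroup.mem_carrier[OF sL]
  have fc: "f z \<in> carrier H" if "z \<in> carrier G" for z using f that by (auto simp: bij_betw_def)
  let ?N = "fiber_cosets G A f (u <#\<^bsub>H\<^esub> L)"
  define r where "r c = (SOME x. x \<in> carrier G \<and> f x \<in> u <#\<^bsub>H\<^esub> L \<and> c = x <#\<^bsub>G\<^esub> A)" for c
  have r: "r c \<in> carrier G \<and> f (r c) \<in> u <#\<^bsub>H\<^esub> L \<and> c = r c <#\<^bsub>G\<^esub> A" if "c \<in> ?N" for c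
  proof -
    have "\<exists>x. x \<in> carrier G \<and> f x \<in> u <#\<^bsub>H\<^esub> L \<and> c = x <#\<^bsub>G\<^esub> A"
      using that by (auto simp: fiber_cosets_def)
    then show ?thesis unfolding r_def by (rule someI_ex)
  qed
  have rinj: "inj_on r ?N" using r by (metis inj_onI)
  define X where "X = r ` ?N"
  have X: "finite X" "X \<subseteq> carrier G" "card X = card ?N"
    using fin r card_image[OF rinj] by (auto simp: X_def)
  have Xu: "inv\<^bsub>H\<^esub> u \<otimes>\<^bsub>H\<^esub> f x \<in> L" if "x \<in> X" for x
  proof -
    have "f x \<in> u <#\<^bsub>H\<^esub> L" "x \<in> carrier G" using that r by (auto simp: X_def)
    then show ?thesis using H.mem_l_coset_iff[OF sL u] fc by blast
  qed
  have Xeq: "x = x'" if m: "x \<in> X" "x' \<in> X" "inv\<^bsub>G\<^esub> x \<otimes>\<^bsub>G\<^esub> x' \<in> A" for x x'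
  proof -
    obtain c c' where c: "c \<in> ?N" "c' \<in> ?N" "x = r c" "x' = r c'" using m(1,2) by (auto simp: X_def)
    have "x <#\<^bsub>G\<^esub> A = x' <#\<^bsub>G\<^esub> A" using G.l_coset_eq_iff[OF sA] m X(2) by blast
    then show ?thesis using r[OF c(1)] r[OF c(2)] c by simp
  qed
  have "card B = (\<Sum>x\<in>X. card {h \<in> A. inv\<^bsub>H\<^esub> u \<otimes>\<^bsub>H\<^esub> f (x \<otimes>\<^bsub>G\<^esub> h) \<in> B})"
    if B: "finite B" "B \<subseteq> L" for B
  proof -
    define P where "P x = {h \<in> A. inv\<^bsub>H\<^esub> u \<otimes>\<^bsub>H\<^esub> f (x \<otimes>\<^bsub>G\<^esub> h) \<in> B}" for x
    define \<psi> where "\<psi> = (\<lambda>(x, h). inv\<^bsub>H\<^esub> u \<otimes>\<^bsub>H\<^esub> f (x \<otimes>\<^bsub>G\<^esub> h))"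
    have "bij_betw \<psi> (Sigma X P) B"
      unfolding bij_betw_def
    proof
      show "inj_on \<psi> (Sigma X P)"
      proof (rule inj_onI, clarify)
        fix x h x' h' assume m: "x \<in> X" "h \<in> P x" "x' \<in> X" "h' \<in> P x'" "\<psi> (x, h) = \<psi> (x', h')"
        have c: "x \<in> carrier G" "x' \<in> carrier G" "h \<in> carrier G" "h' \<in> carrier G" "h \<in> A" "h' \<in> A"
          using m X(2) Ac by (auto simp: P_def)
        have "f (x \<otimes>\<^bsub>G\<^esub> h) = f (x' \<otimes>\<^bsub>G\<^esub> h')" using m(5) u fc c by (simp add: \<psi>_def)
        then have e: "x \<otimes>\<^bsub>G\<^esub> h = x' \<otimes>\<^bsub>G\<^esub> h'" using f c by (metis G.m_closed bij_betw_def inj_onD)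
        have "inv\<^bsub>G\<^esub> x \<otimes>\<^bsub>G\<^esub> x' = inv\<^bsub>G\<^esub> x \<otimes>\<^bsub>G\<^esub> (x' \<otimes>\<^bsub>G\<^esub> h') \<otimes>\<^bsub>G\<^esub> inv\<^bsub>G\<^esub> h'"
          using c by (simp add: G.m_assoc)
        also have "\<dots> = h \<otimes>\<^bsub>G\<^esub> inv\<^bsub>G\<^esub> h'" unfolding e[symmetric] using c by (simp add: G.cancel_inv)
        also have "\<dots> \<in> A" using c subgroup.m_closed[OF sA] subgroup.m_inv_closed[OF sA] by blast
        finally have "x = x'" using Xeq m by blast
        then show "x = x' \<and> h = h'" using e c by simp
      qed
      show "\<psi> ` Sigma X P = B"
      proof (intro equalityI subsetI)
        fix b assume "b \<in> \<psi> ` Sigma X P" then show "b \<in> B" by (auto simp: \<psi>_def P_def)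
      next
        fix b assume b: "b \<in> B"
        have bL: "b \<in> L" "b \<in> carrier H" using b B(2) Lc by auto
        obtain z where z: "z \<in> carrier G" "f z = u \<otimes>\<^bsub>H\<^esub> b"
          using f u bL by (metis H.m_closed bij_betw_def imageE)
        have "f z \<in> u <#\<^bsub>H\<^esub> L" using z(2) bL by (auto simp: l_coset_def)
        then have zN: "z <#\<^bsub>G\<^esub> A \<in> ?N" using z(1) by (auto simp: fiber_cosets_def)
        define x where "x = r (z <#\<^bsub>G\<^esub> A)"
        have xX: "x \<in> X" using zN by (simp add: X_def x_def)
        have xc: "x \<in> carrier G" using xX X(2) by blast
        have "x <#\<^bsub>G\<^esub> A = z <#\<^bsub>G\<^esub> A" using r[OF zN] by (simp add: x_def)
        then have h: "inv\<^bsub>G\<^esub> x \<otimes>\<^bsub>G\<^esub> z \<in> A" using G.l_coset_eq_iff[OF sA xc z(1)] by simp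
        have "\<psi> (x, inv\<^bsub>G\<^esub> x \<otimes>\<^bsub>G\<^esub> z) = b"
          unfolding \<psi>_def using xc z u bL by (simp add: G.cancel_inv H.cancel_inv)
        moreover have "(x, inv\<^bsub>G\<^esub> x \<otimes>\<^bsub>G\<^esub> z) \<in> Sigma X P"
          using xX h calculation b by (auto simp: P_def \<psi>_def)
        ultimately show "b \<in> \<psi> ` Sigma X P" by (metis imageI)
      qed
    qed
    then have card: "card (Sigma X P) = card B" and fSP: "finite (Sigma X P)"
      using bij_betw_same_card bij_betw_finite B(1) by blast+
    have "finite (P x)" if "x \<in> X" for x
    proof (rule finite_imageD)
      show "finite (Pair x ` P x)" using fSP by (rule rev_finite_subset) (use that in auto)
    qed (simp add: inj_on_def)
    then show ?thesis using card_SigmaI[of X P] X(1) card unfolding P_def by simp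
  qed
  then show ?thesis using X Xu by (intro exI[of _ X]) simp
qed

text \<open>All cosets of \<open>A\<close> that map into \<open>u <# L\<close> or \<open>v <# L\<close> stay at bounded distance from each other, so
  each receives the same share of a Folner set \<open>B\<close> up to \<open>\<epsilon> * card B\<close>; hence the numbers of these
  cosets agree.\<close>

lemma fiber_count_not_less:
  assumes "group G" "group H" and lf: "locally_finite_by_abelian G" "locally_finite_by_abelian H"
    and f: "coarse_map G H f" "bij_betw f (carrier G) (carrier H)"
    and S: "finite S" "S \<subseteq> carrier G" "A = generate G S"
    and R: "finite R" "R \<subseteq> carrier H" "L = generate H R"
    and fA: "\<And>x h. x \<in> carrier G \<Longrightarrow> h \<in> A \<Longrightarrow> inv\<^bsub>H\<^esub> (f x) \<otimes>\<^bsub>H\<^esub> f (x \<otimes>\<^bsub>G\<^esub> h) \<in> L"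
    and uv: "u \<in> carrier H" "v \<in> carrier H"
    and fin: "\<And>y. y \<in> carrier H \<Longrightarrow> finite (fiber_cosets G A f (y <#\<^bsub>H\<^esub> L))"
    and foelner: "\<And>D \<epsilon>. finite D \<Longrightarrow> D \<subseteq> L \<Longrightarrow> 0 < (\<epsilon>::real) \<Longrightarrow> \<exists>B. finite B \<and> B \<noteq> {} \<and> B \<subseteq> L \<and>
      real (card ((\<lambda>(b, d). b \<otimes>\<^bsub>H\<^esub> d) ` (B \<times> D) - B)) \<le> \<epsilon> * card B"
  shows "\<not> card (fiber_cosets G A f (u <#\<^bsub>H\<^esub> L)) < card (fiber_cosets G A f (v <#\<^bsub>H\<^esub> L))"
proof
  assume less: "card (fiber_cosets G A f (u <#\<^bsub>H\<^esub> L)) < card (fiber_cosets G A f (v <#\<^bsub>H\<^esub> L))"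
  interpret G: group G by fact
  interpret H: group H by fact
  have sA: "subgroup A G" using G.generate_is_subgroup[OF S(2)] S(3) by simp
  have sL: "subgroup L H" using H.generate_is_subgroup[OF R(2)] R(3) by simp
  have injf: "inj_on f (carrier G)" using f(2) by (simp add: bij_betw_def)
  define c1 where "c1 = card (fiber_cosets G A f (u <#\<^bsub>H\<^esub> L))"
  define c2 where "c2 = card (fiber_cosets G A f (v <#\<^bsub>H\<^esub> L))"
  define m where "m B y x = card {h \<in> A. inv\<^bsub>H\<^esub> y \<otimes>\<^bsub>H\<^esub> f (x \<otimes>\<^bsub>G\<^esub> h) \<in> B}" for B y x
  obtain X where X: "finite X" "X \<subseteq> carrier G" "card X = c1" "\<forall>x\<in>X. inv\<^bsub>H\<^esub> u \<otimes>\<^bsub>H\<^esub> f x \<in> L"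
    "\<forall>B. finite B \<and> B \<subseteq> L \<longrightarrow> card B = (\<Sum>x\<in>X. m B u x)"
    using fiber_cosets_sum[OF assms(1,2) f(2) sA sL fA uv(1) fin[OF uv(1)]] unfolding c1_def m_def by meson
  obtain Y where Y: "finite Y" "Y \<subseteq> carrier G" "card Y = c2" "\<forall>x\<in>Y. inv\<^bsub>H\<^esub> v \<otimes>\<^bsub>H\<^esub> f x \<in> L"
    "\<forall>B. finite B \<and> B \<subseteq> L \<longrightarrow> card B = (\<Sum>x\<in>Y. m B v x)"
    using fiber_cosets_sum[OF assms(1,2) f(2) sA sL fA uv(2) fin[OF uv(2)]] unfolding c2_def m_def by meson
  have c1: "0 < c1"
  proof -
    obtain z where "z \<in> carrier G" "f z = u" using f(2) uv(1) by (metis bij_betw_def imageE)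
    moreover have "u \<in> u <#\<^bsub>H\<^esub> L"
      using H.mem_l_coset_iff[OF sL uv(1) uv(1)] subgroup.one_closed[OF sL] uv by simp
    ultimately have "fiber_cosets G A f (u <#\<^bsub>H\<^esub> L) \<noteq> {}" by (auto simp: fiber_cosets_def)
    then show ?thesis using fin[OF uv(1)] by (simp add: c1_def card_gt_0_iff)
  qed
  then obtain x0 where x0: "x0 \<in> X" using X(1,3) by (metis all_not_in_conv card.empty less_irrefl)
  have x0c: "x0 \<in> carrier G" using x0 X(2) by blast
  have "\<forall>x\<in>X. \<exists>D. finite D \<and> D \<subseteq> L \<and> (\<forall>B. finite B \<and> B \<subseteq> L \<longrightarrow>
      m B u x \<le> m B u x0 + card ((\<lambda>(b, d). b \<otimes>\<^bsub>H\<^esub> d) ` (B \<times> D) - B))"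
  proof
    fix x assume x: "x \<in> X"
    have "x \<in> carrier G" using x X(2) by blast
    then show "\<exists>D. finite D \<and> D \<subseteq> L \<and> (\<forall>B. finite B \<and> B \<subseteq> L \<longrightarrow>
      m B u x \<le> m B u x0 + card ((\<lambda>(b, d). b \<otimes>\<^bsub>H\<^esub> d) ` (B \<times> D) - B))"
      unfolding m_def using x0 X(4)
      by (intro fiber_count_le[OF assms(1,2) lf f(1) injf S R fA uv(1) uv(1) _ x0c]) blast+
  qed
  from bchoice[OF this] obtain D1 where D1: "\<forall>x\<in>X. finite (D1 x) \<and> D1 x \<subseteq> L \<and> (\<forall>B. finite B \<and> B \<subseteq> L \<longrightarrow>
      m B u x \<le> m B u x0 + card ((\<lambda>(b, d). b \<otimes>\<^bsub>H\<^esub> d) ` (B \<times> D1 x) - B))" by blast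
  have "\<forall>x\<in>Y. \<exists>D. finite D \<and> D \<subseteq> L \<and> (\<forall>B. finite B \<and> B \<subseteq> L \<longrightarrow>
      m B u x0 \<le> m B v x + card ((\<lambda>(b, d). b \<otimes>\<^bsub>H\<^esub> d) ` (B \<times> D) - B))"
  proof
    fix x assume x: "x \<in> Y"
    have "x \<in> carrier G" using x Y(2) by blast
    then show "\<exists>D. finite D \<and> D \<subseteq> L \<and> (\<forall>B. finite B \<and> B \<subseteq> L \<longrightarrow>
      m B u x0 \<le> m B v x + card ((\<lambda>(b, d). b \<otimes>\<^bsub>H\<^esub> d) ` (B \<times> D) - B))"
      unfolding m_def using x Y(4)
      by (intro fiber_count_le[OF assms(1,2) lf f(1) injf S R fA uv(1) uv(2) x0c]) blast+
  qed
  from bchoice[OF this] obtain D2 where D2: "\<forall>x\<in>Y. finite (D2 x) \<and> D2 x \<subseteq> L \<and> (\<forall>B. finite B \<and> B \<subseteq> L \<longrightarrow>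
      m B u x0 \<le> m B v x + card ((\<lambda>(b, d). b \<otimes>\<^bsub>H\<^esub> d) ` (B \<times> D2 x) - B))" by blast
  define D where "D = (\<Union>x\<in>X. D1 x) \<union> (\<Union>x\<in>Y. D2 x)"
  have D: "finite D" "D \<subseteq> L" using D1 D2 X(1) Y(1) by (auto simp: D_def)
  \<comment> \<open>If there were \<open>c2 \<ge> c1 + 1\<close> cosets over \<open>v\<close>, the
    two counts of \<open>B\<close> below would give 1 as a lower bound for
    \<open>\<epsilon> * (c1 * (c1 + 1 + c2))\<close>; the choice makes this product 1/2.\<close>
  define \<epsilon> where "\<epsilon> = 1 / (2 * real c1 * (real c1 + 1 + real c2))"
  have \<epsilon>: "0 < \<epsilon>" using c1 by (simp add: \<epsilon>_def add_pos_nonneg)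
  obtain B where B: "finite B" "B \<noteq> {}" "B \<subseteq> L"
    and Be: "real (card ((\<lambda>(b, d). b \<otimes>\<^bsub>H\<^esub> d) ` (B \<times> D) - B)) \<le> \<epsilon> * card B"
    using foelner[OF D \<epsilon>] by blast
  define b where "b = real (card B)"
  have b: "0 < b" using B by (simp add: b_def card_gt_0_iff)
  have err: "real (card ((\<lambda>(b, d). b \<otimes>\<^bsub>H\<^esub> d) ` (B \<times> D') - B)) \<le> \<epsilon> * b" if "D' \<subseteq> D" for D'
  proof -
    have "card ((\<lambda>(b, d). b \<otimes>\<^bsub>H\<^esub> d) ` (B \<times> D') - B) \<le> card ((\<lambda>(b, d). b \<otimes>\<^bsub>H\<^esub> d) ` (B \<times> D) - B)"
      using that B(1) D(1) by (intro card_mono) auto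
    then show ?thesis using Be unfolding b_def by linarith
  qed
  \<comment> \<open>The share of a single coset serves as pivot: shares over \<open>u\<close> exceed
    \<open>p\<close> by at most \<open>\<epsilon> * b\<close>, and shares over \<open>v\<close> fall
    short of it by at most as much.\<close>
  define p where "p = real (m B u x0)"
  have p0: "0 \<le> p" by (simp add: p_def)
  have mX: "real (m B u x) \<le> p + \<epsilon> * b" if "x \<in> X" for x
  proof -
    have "D1 x \<subseteq> D" using that by (auto simp: D_def)
    from err[OF this] show ?thesis using bspec[OF D1 that] B unfolding p_def by fastforce
  qed
  have mY: "p - \<epsilon> * b \<le> real (m B v x)" if "x \<in> Y" for x
  proof -
    have "D2 x \<subseteq> D" using that by (auto simp: D_def)
    from err[OF this] show ?thesis using bspec[OF D2 that] B unfolding p_def by fastforce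
  qed
  have "b = (\<Sum>x\<in>X. real (m B u x))" using X(5) B by (simp add: b_def)
  also have "\<dots> \<le> (\<Sum>x\<in>X. p + \<epsilon> * b)" using mX by (rule sum_mono)
  finally have 1: "b \<le> real c1 * (p + \<epsilon> * b)" using X(3) by simp
  have "real c2 * (p - \<epsilon> * b) = (\<Sum>x\<in>Y. p - \<epsilon> * b)" using Y(3) by simp
  also have "\<dots> \<le> (\<Sum>x\<in>Y. real (m B v x))" using mY by (rule sum_mono)
  also have "\<dots> = b" using Y(5) B by (simp add: b_def)
  finally have 2: "real c2 * (p - \<epsilon> * b) \<le> b" .
  have "real c1 + 1 \<le> real c2" using less by (simp add: c1_def c2_def)
  then have 3: "(real c1 + 1) * p \<le> real c2 * p" using p0 by (rule mult_right_mono)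
  have 4: "(real c1 + 1) * p \<le> b * (1 + real c2 * \<epsilon>)" using 2 3 by (simp add: algebra_simps)
  have "(real c1 + 1) * b \<le> (real c1 + 1) * (real c1 * (p + \<epsilon> * b))"
    using 1 by (intro mult_left_mono) auto
  also have "\<dots> = real c1 * ((real c1 + 1) * p) + real c1 * (real c1 + 1) * \<epsilon> * b" by (simp add: algebra_simps)
  also have "\<dots> \<le> real c1 * (b * (1 + real c2 * \<epsilon>)) + real c1 * (real c1 + 1) * \<epsilon> * b"
    using mult_left_mono[OF 4, of "real c1"] by simp
  also have "\<dots> = b * (real c1 + \<epsilon> * (real c1 * (real c1 + 1 + real c2)))" by (simp add: algebra_simps)
  finally have "b * (real c1 + 1) \<le> b * (real c1 + \<epsilon> * (real c1 * (real c1 + 1 + real c2)))"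
    by (simp add: mult.commute)
  then have "1 \<le> \<epsilon> * (real c1 * (real c1 + 1 + real c2))" using b by simp
  moreover have "\<epsilon> * (real c1 * (real c1 + 1 + real c2)) = 1 / 2"
  proof -
    have "real c1 * (real c1 + 1 + real c2) \<noteq> 0" using c1 by (simp add: add_nonneg_eq_0_iff)
    then show ?thesis unfolding \<epsilon>_def by (simp add: mult.assoc)
  qed
  ultimately show False by simp
qed

lemma (in group) finitely_generated_foelner:
  assumes lf: "locally_finite_by_abelian G" and S: "finite S" "S \<subseteq> carrier G"
    and D: "finite D" "D \<subseteq> generate G S" and \<epsilon>: "0 < (\<epsilon>::real)"
  shows "\<exists>B. finite B \<and> B \<noteq> {} \<and> B \<subseteq> generate G S \<and>
    real (card ((\<lambda>(b, d). b \<otimes> d) ` (B \<times> D) - B)) \<le> \<epsilon> * card B"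
proof -
  obtain F :: "'a \<Rightarrow> nat \<times> nat \<Rightarrow> int" and C where F: "coarse_chart G (generate G S) F C" "\<And>i. 0 \<in> C i"
    "\<And>i. C i \<noteq> {0} \<Longrightarrow> fst i = 0 \<and> snd i < card S" "\<And>i. C i = UNIV \<or> finite (C i)"
    using chart_generate[OF lf S] by blast
  have "finite {i. C i \<noteq> {0}}"
  proof (rule finite_subset)
    show "{i. C i \<noteq> {0}} \<subseteq> {0} \<times> {..<card S}"
    proof
      fix i assume "i \<in> {i. C i \<noteq> {0}}"
      then show "i \<in> {0} \<times> {..<card S}" using F(3)[of i] by (cases i) simp
    qed
  qed simp
  from chart_foelner[OF generate_is_subgroup[OF S(2)] F(1,2) this F(4) D \<epsilon>] show ?thesis .
qed

section \<open>Comparison of the factorizing functions\<close>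

text \<open>Double counting of the cosets of \<open>A\<close> over a large subgroup
  \<open>L\<close>. Grouped by cosets of \<open>L0\<close> in \<open>L\<close> there are
  \<open>l * c\<close> of them; grouped by cosets of the finite extension \<open>E\<close> of
  \<open>A\<close> their number is a multiple of the index of \<open>A\<close> in \<open>E\<close>.
  Hence this index divides \<open>l * c\<close>, where \<open>l\<close> divides an index counted by
  the factorizing function of \<open>H\<close> and \<open>c\<close> is independent of
  \<open>E\<close> and \<open>p\<close>.\<close>

lemma factorizing_function_le_of_coarse_isomorphism:
  assumes "group G" "group H" and lf: "locally_finite_by_abelian G" "locally_finite_by_abelian H"
    and iso: "coarse_isomorphism G H f"
    and S: "finite S" "S \<subseteq> carrier G" "locally_finite_index G (generate G S)"
    and R: "finite R" "R \<subseteq> carrier H" "locally_finite_index H (generate H R)"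
  shows "\<exists>c>0. (S = {} \<and> R = {} \<longrightarrow> c = 1) \<and> (\<forall>p. prime p \<longrightarrow>
    factorizing_function G (generate G S) p \<le>
      enat (multiplicity p c) + factorizing_function H (generate H R) p)"
proof -
  interpret G: group G by fact
  interpret H: group H by fact
  define A where "A = generate G S"
  have sA: "subgroup A G" using G.generate_is_subgroup[OF S(2)] by (simp add: A_def)
  note Ac = subgroup.mem_carrier[OF sA]
  define g where "g = inv_into (carrier G) f"
  have fm: "coarse_map G H f" and gm: "coarse_map H G g" and fb: "bij_betw f (carrier G) (carrier H)"
    using iso by (simp_all add: coarse_isomorphism_def g_def)
  have fc: "f x \<in> carrier H" if "x \<in> carrier G" for x using fb that by (auto simp: bij_betw_def)
  have gc: "g y \<in> carrier G" if "y \<in> carrier H" for y using gm that by (auto simp: coarse_map_def)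
  have gf: "g (f x) = x" if "x \<in> carrier G" for x
    using bij_betw_inv_into_left[OF fb that] by (simp add: g_def)
  \<comment> \<open>The case distinction guarantees \<open>D1 = {}\<close> for empty
    \<open>S\<close>, so that \<open>L0\<close> stays trivial when \<open>R\<close> is empty as
    well; otherwise \<open>c = 1\<close> could not be claimed.\<close>
  have "\<exists>D1. finite D1 \<and> D1 \<subseteq> carrier H \<and> (S = {} \<longrightarrow> D1 = {}) \<and>
    (\<forall>x\<in>carrier G. \<forall>h\<in>A. inv\<^bsub>H\<^esub> (f x) \<otimes>\<^bsub>H\<^esub> f (x \<otimes>\<^bsub>G\<^esub> h) \<in> generate H D1)"
  proof (cases "S = {}")
    case True
    then have "A = {\<one>\<^bsub>G\<^esub>}" by (simp add: A_def G.generate_empty)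
    then show ?thesis using fc by (intro exI[of _ "{}"]) (simp add: generate.one)
  next
    case False
    obtain D where D: "finite D" "D \<subseteq> carrier H"
      "\<And>x h. x \<in> carrier G \<Longrightarrow> h \<in> A \<Longrightarrow> inv\<^bsub>H\<^esub> (f x) \<otimes>\<^bsub>H\<^esub> f (x \<otimes>\<^bsub>G\<^esub> h) \<in> generate H D"
      using coarse_map_generate[OF assms(1,2) fm S(1,2)] unfolding A_def by metis
    then show ?thesis using False by (intro exI[of _ D]) simp
  qed
  then obtain D1 where D1: "finite D1" "D1 \<subseteq> carrier H" "S = {} \<Longrightarrow> D1 = {}"
    and fD1: "\<And>x h. x \<in> carrier G \<Longrightarrow> h \<in> A \<Longrightarrow> inv\<^bsub>H\<^esub> (f x) \<otimes>\<^bsub>H\<^esub> f (x \<otimes>\<^bsub>G\<^esub> h) \<in> generate H D1"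
    by blast
  define R' where "R' = R \<union> D1"
  have R': "finite R'" "R' \<subseteq> carrier H" using R D1 by (auto simp: R'_def)
  define L0 where "L0 = generate H R'"
  have sL0: "subgroup L0 H" using H.generate_is_subgroup[OF R'(2)] by (simp add: L0_def)
  have fA: "inv\<^bsub>H\<^esub> (f x) \<otimes>\<^bsub>H\<^esub> f (x \<otimes>\<^bsub>G\<^esub> h) \<in> L0" if "x \<in> carrier G" "h \<in> A" for x h
    using fD1[OF that] H.mono_generate[of D1 R'] by (auto simp: L0_def R'_def)
  have fin: "finite (fiber_cosets G A f (y <#\<^bsub>H\<^esub> generate H F))"
    if F: "finite F" "F \<subseteq> carrier H" and y: "y \<in> carrier H" for F y
  proof -
    obtain D where D: "finite D" "D \<subseteq> carrier G"
      "\<And>x h. x \<in> carrier H \<Longrightarrow> h \<in> generate H F \<Longrightarrow> inv\<^bsub>G\<^esub> (g x) \<otimes>\<^bsub>G\<^esub> g (x \<otimes>\<^bsub>H\<^esub> h) \<in> generate G D"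
      using coarse_map_generate[OF assms(2,1) gm F] by metis
    \<comment> \<open>The inverse map sends the coset of \<open>generate H F\<close> into one coset
      of a finitely generated subgroup of \<open>G\<close>, in which \<open>A\<close> has finite
      index after adjoining \<open>S\<close>.\<close>
    have "fiber_cosets G A f (y <#\<^bsub>H\<^esub> generate H F) \<subseteq>
      (\<lambda>c. g y <#\<^bsub>G\<^esub> c) ` lcosets G (generate G (S \<union> D)) A"
    proof
      fix c assume "c \<in> fiber_cosets G A f (y <#\<^bsub>H\<^esub> generate H F)"
      then obtain x where x: "x \<in> carrier G" "f x \<in> y <#\<^bsub>H\<^esub> generate H F" "c = x <#\<^bsub>G\<^esub> A"
        by (auto simp: fiber_cosets_def)
      then obtain l where l: "l \<in> generate H F" "f x = y \<otimes>\<^bsub>H\<^esub> l" by (auto simp: l_coset_def)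
      define k where "k = inv\<^bsub>G\<^esub> (g y) \<otimes>\<^bsub>G\<^esub> x"
      have "k \<in> generate G D" using D(3)[OF y l(1)] gf[OF x(1)] l(2) by (simp add: k_def)
      then have k: "k \<in> generate G (S \<union> D)" using G.mono_generate[of D "S \<union> D"] by auto
      have kc: "k \<in> carrier G" using gc[OF y] x(1) by (simp add: k_def)
      have "c = g y <#\<^bsub>G\<^esub> (k <#\<^bsub>G\<^esub> A)"
        unfolding x(3) using G.lcos_m_assoc[of A "g y" k] subgroup.subset[OF sA] gc[OF y] kc x(1)
        by (simp add: k_def G.cancel_inv)
      then show "c \<in> (\<lambda>c. g y <#\<^bsub>G\<^esub> c) ` lcosets G (generate G (S \<union> D)) A"
        using k by (auto simp: lcosets_def)
    qed
    moreover have "finite (lcosets G (generate G (S \<union> D)) A)"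
      using S(3) G.locally_finite_index_iff[OF S(2)] D unfolding A_def by blast
    ultimately show ?thesis using finite_surj by blast
  qed
  have const: "card (fiber_cosets G A f (u <#\<^bsub>H\<^esub> L0)) = card (fiber_cosets G A f (v <#\<^bsub>H\<^esub> L0))"
    if uv: "u \<in> carrier H" "v \<in> carrier H" for u v
  proof -
    have "\<not> card (fiber_cosets G A f (u <#\<^bsub>H\<^esub> L0)) < card (fiber_cosets G A f (v <#\<^bsub>H\<^esub> L0))"
      if "u \<in> carrier H" "v \<in> carrier H" for u v
      by (rule fiber_count_not_less[OF assms(1,2) lf fm fb S(1,2) A_def R' L0_def fA that])
        (use fin[OF R'] H.finitely_generated_foelner[OF lf(2) R'] in \<open>auto simp: L0_def\<close>)
    from this[OF uv] this[OF uv(2,1)] show ?thesis by simp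
  qed
  define c where "c = card (fiber_cosets G A f (\<one>\<^bsub>H\<^esub> <#\<^bsub>H\<^esub> L0))"
  have c: "0 < c"
  proof -
    obtain z where "z \<in> carrier G" "f z = \<one>\<^bsub>H\<^esub>"
      using fb H.one_closed by (metis bij_betw_def imageE)
    moreover have "\<one>\<^bsub>H\<^esub> \<in> \<one>\<^bsub>H\<^esub> <#\<^bsub>H\<^esub> L0"
      using H.mem_l_coset_iff[OF sL0, of "\<one>\<^bsub>H\<^esub>" "\<one>\<^bsub>H\<^esub>"] subgroup.one_closed[OF sL0] by simp
    ultimately have "fiber_cosets G A f (\<one>\<^bsub>H\<^esub> <#\<^bsub>H\<^esub> L0) \<noteq> {}" by (auto simp: fiber_cosets_def)
    then show ?thesis using fin[OF R' H.one_closed] by (simp add: c_def card_gt_0_iff L0_def)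
  qed
  have triv: "c = 1" if "S = {}" "R = {}"
  proof -
    have L1: "L0 = {\<one>\<^bsub>H\<^esub>}" using that D1(3) by (simp add: L0_def R'_def H.generate_empty)
    obtain z where z: "z \<in> carrier G" "f z = \<one>\<^bsub>H\<^esub>"
      using fb H.one_closed by (metis bij_betw_def imageE)
    have one: "\<one>\<^bsub>H\<^esub> <#\<^bsub>H\<^esub> L0 = {\<one>\<^bsub>H\<^esub>}" by (simp add: L1 l_coset_def)
    have "x = z" if "x \<in> carrier G" "f x = \<one>\<^bsub>H\<^esub>" for x
      using that z fb by (metis bij_betw_def inj_onD)
    then have "{x \<in> carrier G. f x \<in> \<one>\<^bsub>H\<^esub> <#\<^bsub>H\<^esub> L0} = {z}"
      unfolding one using z by blast
    then show ?thesis by (simp add: c_def fiber_cosets_def)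
  qed
  have bound: "Suc k \<le> multiplicity p c + e"
    if p: "prime p" and k: "enat k < factorizing_function G A p"
      and e: "factorizing_function H (generate H R) p = enat e" for p k e
  proof -
    obtain E where E: "subgroup E G" "A \<subseteq> E" "finite (lcosets G E A)" "p ^ Suc k dvd card (lcosets G E A)"
      using k G.less_factorizing_function_iff[OF sA] by blast
    note Ec = subgroup.mem_carrier[OF E(1)] and Em = subgroup.m_closed[OF E(1)] and Ei = subgroup.m_inv_closed[OF E(1)]
    obtain T where T: "T \<subseteq> E" "bij_betw (\<lambda>t. t <#\<^bsub>G\<^esub> A) T (lcosets G E A)"
      "\<And>a. a \<in> E \<Longrightarrow> \<exists>t\<in>T. inv\<^bsub>G\<^esub> t \<otimes>\<^bsub>G\<^esub> a \<in> A"
      using G.left_transversal[OF sA E(1,2)] by metis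
    have "finite T" using bij_betw_finite[OF T(2)] E(3) by simp
    then have fT: "finite (S \<union> T)" "S \<union> T \<subseteq> carrier G"
      using S(1,2) T(1) Ec by auto
    \<comment> \<open>\<open>E\<close> is finitely generated up to inclusion, by \<open>S\<close>
      and a transversal; this makes displacements along \<open>E\<close> controllable by a finite
      \<open>D2\<close>.\<close>
    have EST: "a \<in> generate G (S \<union> T)" if a: "a \<in> E" for a
    proof -
      obtain t where t: "t \<in> T" "inv\<^bsub>G\<^esub> t \<otimes>\<^bsub>G\<^esub> a \<in> A" using T(3)[OF a] by blast
      have "A \<subseteq> generate G (S \<union> T)" unfolding A_def by (rule G.mono_generate) auto
      then have "inv\<^bsub>G\<^esub> t \<otimes>\<^bsub>G\<^esub> a \<in> generate G (S \<union> T)" using t(2) by blast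
      moreover have "t \<in> generate G (S \<union> T)" using t(1) by (simp add: generate.incl)
      moreover have "t \<in> carrier G" using t(1) fT(2) by blast
      ultimately show ?thesis
        using generate.eng[of t G "S \<union> T" "inv\<^bsub>G\<^esub> t \<otimes>\<^bsub>G\<^esub> a"] Ec[OF a] by (simp add: G.cancel_inv)
    qed
    obtain D2 where D2: "finite D2" "D2 \<subseteq> carrier H"
      "\<And>x h. x \<in> carrier G \<Longrightarrow> h \<in> E \<Longrightarrow> inv\<^bsub>H\<^esub> (f x) \<otimes>\<^bsub>H\<^esub> f (x \<otimes>\<^bsub>G\<^esub> h) \<in> generate H D2"
      using coarse_map_generate[OF assms(1,2) fm fT] EST by metis
    define L where "L = generate H (R' \<union> D2)"
    have R2: "finite (R' \<union> D2)" "R' \<union> D2 \<subseteq> carrier H" using R' D2 by auto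
    have sL: "subgroup L H" using H.generate_is_subgroup[OF R2(2)] by (simp add: L_def)
    have L0L: "L0 \<subseteq> L" unfolding L0_def L_def by (rule H.mono_generate) auto
    have D2L: "generate H D2 \<subseteq> L" unfolding L_def by (rule H.mono_generate) auto
    have RL0: "generate H R \<subseteq> L0" unfolding L0_def R'_def by (rule H.mono_generate) auto
    have sR: "subgroup (generate H R) H" using H.generate_is_subgroup[OF R(2)] .
    have finLR: "finite (lcosets H L (generate H R))"
    proof -
      have "D1 \<union> D2 \<subseteq> carrier H" "finite (D1 \<union> D2)" using D1 D2 by auto
      then have "finite (lcosets H (generate H (R \<union> (D1 \<union> D2))) (generate H R))"
        using R(3) H.locally_finite_index_iff[OF R(2)] by blast
      then show ?thesis by (simp add: L_def R'_def Un_assoc)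
    qed
    define l where "l = card (lcosets H L L0)"
    define q where "q = card (lcosets H L (generate H R))"
    have q0: "0 < q"
      unfolding q_def using finLR subgroup.one_closed[OF sL] by (auto simp: card_gt_0_iff lcosets_def)
    \<comment> \<open>Finiteness of the index of \<open>L0\<close> in \<open>L\<close> is read off
      from here: a positive product has a positive factor \<open>l\<close>.\<close>
    have ql: "q = l * card (lcosets H L0 (generate H R))"
      unfolding q_def l_def by (rule H.lcosets_mult(1)[OF sR sL0 RL0 sL L0L])
    have l0: "0 < l" using q0 ql by (cases l) auto
    have lq: "l dvd q" using ql by simp
    have finLL0: "finite (lcosets H L L0)" using l0 unfolding l_def by (rule card_ge_0_finite)
    obtain U where U: "U \<subseteq> L" "bij_betw (\<lambda>t. t <#\<^bsub>H\<^esub> L0) U (lcosets H L L0)"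
      "\<And>a. a \<in> L \<Longrightarrow> \<exists>t\<in>U. inv\<^bsub>H\<^esub> t \<otimes>\<^bsub>H\<^esub> a \<in> L0"
      "\<And>t t'. t \<in> U \<Longrightarrow> t' \<in> U \<Longrightarrow> inv\<^bsub>H\<^esub> t \<otimes>\<^bsub>H\<^esub> t' \<in> L0 \<Longrightarrow> t = t'"
      using H.left_transversal[OF sL0 sL L0L] by metis
    have Uc: "t \<in> carrier H" if "t \<in> U" for t using that U(1) subgroup.mem_carrier[OF sL] by blast
    have fU: "finite U" "card U = l"
      using bij_betw_finite[OF U(2)] bij_betw_same_card[OF U(2)] finLL0 by (simp_all add: l_def)
    define NL where "NL = fiber_cosets G A f L"
    have L1: "\<one>\<^bsub>H\<^esub> <#\<^bsub>H\<^esub> L = L" using H.lcos_mult_one subgroup.subset[OF sL] by blast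
    have finNL: "finite NL" using fin[OF R2 H.one_closed] L1 by (simp add: NL_def L_def)
    have NLU: "NL = (\<Union>t\<in>U. fiber_cosets G A f (t <#\<^bsub>H\<^esub> L0))"
    proof -
      have "y \<in> L \<longleftrightarrow> (\<exists>t\<in>U. y \<in> t <#\<^bsub>H\<^esub> L0)" if y: "y \<in> carrier H" for y
      proof
        assume "y \<in> L"
        then obtain t where "t \<in> U" "inv\<^bsub>H\<^esub> t \<otimes>\<^bsub>H\<^esub> y \<in> L0" using U(3) by blast
        then show "\<exists>t\<in>U. y \<in> t <#\<^bsub>H\<^esub> L0" using H.mem_l_coset_iff[OF sL0 Uc y] by blast
      next
        assume "\<exists>t\<in>U. y \<in> t <#\<^bsub>H\<^esub> L0"
        then show "y \<in> L" using U(1) L0L subgroup.m_closed[OF sL] by (auto simp: l_coset_def)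
      qed
      then have "{x \<in> carrier G. f x \<in> L} = (\<Union>t\<in>U. {x \<in> carrier G. f x \<in> t <#\<^bsub>H\<^esub> L0})"
        using fc by blast
      then show ?thesis unfolding NL_def fiber_cosets_def by (simp add: image_UN)
    qed
    \<comment> \<open>A coset of \<open>A\<close> cannot meet two fibers, since \<open>f\<close>
      maps it into a single coset of \<open>L0\<close>.\<close>
    have same: "t = t'" if t: "t \<in> U" "t' \<in> U" and X: "X \<in> fiber_cosets G A f (t <#\<^bsub>H\<^esub> L0)"
      "X \<in> fiber_cosets G A f (t' <#\<^bsub>H\<^esub> L0)" for t t' X
    proof -
      obtain x x' where x: "x \<in> carrier G" "f x \<in> t <#\<^bsub>H\<^esub> L0" "x' \<in> carrier G" "f x' \<in> t' <#\<^bsub>H\<^esub> L0"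
        "x <#\<^bsub>G\<^esub> A = x' <#\<^bsub>G\<^esub> A" using X by (auto simp: fiber_cosets_def)
      have "inv\<^bsub>G\<^esub> x \<otimes>\<^bsub>G\<^esub> x' \<in> A" using G.l_coset_eq_iff[OF sA x(1,3)] x(5) by simp
      from fA[OF x(1) this] have m: "inv\<^bsub>H\<^esub> (f x) \<otimes>\<^bsub>H\<^esub> f x' \<in> L0" using x by (simp add: G.cancel_inv)
      have "t <#\<^bsub>H\<^esub> L0 = f x <#\<^bsub>H\<^esub> L0"
        using H.l_repr_independence[OF x(2) Uc[OF t(1)] sL0] .
      also have "\<dots> = f x' <#\<^bsub>H\<^esub> L0" using H.l_coset_eq_iff[OF sL0 fc[OF x(1)] fc[OF x(3)]] m by simp
      also have "\<dots> = t' <#\<^bsub>H\<^esub> L0"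
        using H.l_repr_independence[OF x(4) Uc[OF t(2)] sL0] by simp
      finally have "inv\<^bsub>H\<^esub> t \<otimes>\<^bsub>H\<^esub> t' \<in> L0" using H.l_coset_eq_iff[OF sL0 Uc[OF t(1)] Uc[OF t(2)]] by simp
      then show ?thesis using U(4) t by blast
    qed
    have "card NL = (\<Sum>t\<in>U. card (fiber_cosets G A f (t <#\<^bsub>H\<^esub> L0)))"
      unfolding NLU using fU(1) fin[OF R' Uc] same
      by (intro card_UN_disjoint) (auto simp: L0_def)
    also have "\<dots> = (\<Sum>t\<in>U. c)"
      using const[OF Uc H.one_closed] by (intro sum.cong) (auto simp: c_def)
    finally have cNL: "card NL = l * c" using fU(2) by simp
    define i where "i = card (lcosets G E A)"
    define P where "P x0 = (\<lambda>x. x <#\<^bsub>G\<^esub> A) ` (x0 <#\<^bsub>G\<^esub> E)" for x0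
    \<comment> \<open>The second grouping: \<open>L\<close> was chosen large enough that a coset of
      \<open>E\<close> meeting the preimage of \<open>L\<close> lies in it entirely, so the blocks
      \<open>P x\<close> partition \<open>NL\<close>.\<close>
    define CC where "CC = P ` {x \<in> carrier G. f x \<in> L}"
    have CCU: "\<Union>CC = NL"
    proof (intro equalityI subsetI)
      fix X assume "X \<in> \<Union>CC"
      then obtain x0 h where x: "x0 \<in> carrier G" "f x0 \<in> L" "h \<in> E" "X = (x0 \<otimes>\<^bsub>G\<^esub> h) <#\<^bsub>G\<^esub> A"
        by (auto simp: CC_def P_def l_coset_def)
      have xh: "x0 \<otimes>\<^bsub>G\<^esub> h \<in> carrier G" using x Ec by simp
      have "f x0 \<otimes>\<^bsub>H\<^esub> (inv\<^bsub>H\<^esub> (f x0) \<otimes>\<^bsub>H\<^esub> f (x0 \<otimes>\<^bsub>G\<^esub> h)) \<in> L"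
        using D2(3)[OF x(1,3)] D2L x(2) subgroup.m_closed[OF sL] by blast
      then have "f (x0 \<otimes>\<^bsub>G\<^esub> h) \<in> L" using fc[OF x(1)] fc[OF xh] by (simp add: H.cancel_inv)
      then show "X \<in> NL" using xh x(4) by (auto simp: NL_def fiber_cosets_def)
    next
      fix X assume "X \<in> NL"
      then obtain x where x: "x \<in> carrier G" "f x \<in> L" "X = x <#\<^bsub>G\<^esub> A" by (auto simp: NL_def fiber_cosets_def)
      have "x \<in> x <#\<^bsub>G\<^esub> E"
        using G.mem_l_coset_iff[OF E(1) x(1) x(1)] subgroup.one_closed[OF E(1)] x(1) by simp
      then have "X \<in> P x" using x(3) by (simp add: P_def)
      then show "X \<in> \<Union>CC" using x by (auto simp: CC_def)
    qed
    have cP: "card (P x0) = i" if x0: "x0 \<in> carrier G" for x0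
    proof -
      have "P x0 = (\<lambda>X. x0 <#\<^bsub>G\<^esub> X) ` lcosets G E A"
      proof -
        have "(x0 \<otimes>\<^bsub>G\<^esub> h) <#\<^bsub>G\<^esub> A = x0 <#\<^bsub>G\<^esub> (h <#\<^bsub>G\<^esub> A)" if "h \<in> E" for h
          using G.lcos_m_assoc[of A x0 h] subgroup.subset[OF sA] x0 Ec[OF that] by simp
        moreover have "x0 <#\<^bsub>G\<^esub> E = (\<lambda>h. x0 \<otimes>\<^bsub>G\<^esub> h) ` E" by (auto simp: l_coset_def)
        ultimately show ?thesis unfolding P_def lcosets_def by (simp add: image_image)
      qed
      moreover have "inj_on (\<lambda>X. x0 <#\<^bsub>G\<^esub> X) (lcosets G E A)"
      proof (rule inj_on_inverseI[where g = "\<lambda>X. inv\<^bsub>G\<^esub> x0 <#\<^bsub>G\<^esub> X"])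
        fix X assume "X \<in> lcosets G E A"
        then have "X \<subseteq> carrier G"
          using G.l_coset_subset_G subgroup.subset[OF sA] Ec by (auto simp: lcosets_def)
        then show "inv\<^bsub>G\<^esub> x0 <#\<^bsub>G\<^esub> (x0 <#\<^bsub>G\<^esub> X) = X"
          using G.lcos_m_assoc[of X "inv\<^bsub>G\<^esub> x0" x0] x0 G.lcos_mult_one by simp
      qed
      ultimately show ?thesis by (simp add: card_image i_def)
    qed
    have Peq: "P x = P x'" if x: "x \<in> carrier G" "x' \<in> carrier G" and X: "X \<in> P x" "X \<in> P x'" for x x' X
    proof -
      obtain h h' where h: "h \<in> E" "h' \<in> E" "(x \<otimes>\<^bsub>G\<^esub> h) <#\<^bsub>G\<^esub> A = (x' \<otimes>\<^bsub>G\<^esub> h') <#\<^bsub>G\<^esub> A"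
        using X by (auto simp: P_def l_coset_def)
      have hc: "h \<in> carrier G" "h' \<in> carrier G" using h Ec by auto
      have "inv\<^bsub>G\<^esub> (x \<otimes>\<^bsub>G\<^esub> h) \<otimes>\<^bsub>G\<^esub> (x' \<otimes>\<^bsub>G\<^esub> h') \<in> E"
        using G.l_coset_eq_iff[OF sA, of "x \<otimes>\<^bsub>G\<^esub> h" "x' \<otimes>\<^bsub>G\<^esub> h'"] h(3) x hc E(2) by auto
      then have "h \<otimes>\<^bsub>G\<^esub> (inv\<^bsub>G\<^esub> (x \<otimes>\<^bsub>G\<^esub> h) \<otimes>\<^bsub>G\<^esub> (x' \<otimes>\<^bsub>G\<^esub> h')) \<otimes>\<^bsub>G\<^esub> inv\<^bsub>G\<^esub> h' \<in> E"
        using Em[OF Em[OF h(1)] Ei[OF h(2)]] by simp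
      then have "inv\<^bsub>G\<^esub> x \<otimes>\<^bsub>G\<^esub> x' \<in> E"
        using x hc by (simp add: G.inv_mult_group G.m_assoc G.cancel_inv)
      then have "x <#\<^bsub>G\<^esub> E = x' <#\<^bsub>G\<^esub> E" using G.l_coset_eq_iff[OF E(1) x] by simp
      then show ?thesis by (simp add: P_def)
    qed
    have "i dvd card (\<Union>CC)"
    proof (rule dvd_partition)
      show "finite (\<Union>CC)" using CCU finNL by simp
      show "\<forall>c\<in>CC. i dvd card c" using cP by (auto simp: CC_def)
      show "\<forall>X1\<in>CC. \<forall>X2\<in>CC. X1 \<noteq> X2 \<longrightarrow> X1 \<inter> X2 = {}" using Peq unfolding CC_def by blast
    qed
    then have "p ^ Suc k dvd l * c"
      using E(4) CCU cNL unfolding i_def by (metis dvd_trans)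
    then have "Suc k \<le> multiplicity p (l * c)"
      using l0 c p by (intro multiplicity_geI) (auto dest: prime_gt_1_nat)
    also have "\<dots> = multiplicity p l + multiplicity p c"
      using p l0 c by (intro prime_elem_multiplicity_mult_distrib) auto
    also have "multiplicity p l \<le> multiplicity p q"
      using lq q0 by (intro dvd_imp_multiplicity_le) auto
    \<comment> \<open>\<open>L\<close> is itself a finite extension of \<open>generate H R\<close>,
      so the full power of \<open>p\<close> in its index is visible to the factorizing
      function.\<close>
    also have "multiplicity p q \<le> e"
    proof (cases "multiplicity p q")
      case (Suc j)
      have "p ^ Suc j dvd q" using multiplicity_dvd[of p q] Suc by simp
      then have "enat j < factorizing_function H (generate H R) p"
        using H.less_factorizing_function_iff[OF sR] sL RL0 L0L finLR unfolding q_def by blast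
      then show ?thesis using e Suc by simp
    qed simp
    finally show ?thesis by simp
  qed
  have "factorizing_function G A p \<le> enat (multiplicity p c) + factorizing_function H (generate H R) p"
    if p: "prime p" for p
  proof (cases "factorizing_function H (generate H R) p")
    case (enat e)
    show ?thesis
    proof (rule ccontr)
      assume "\<not> ?thesis"
      then have "enat (multiplicity p c + e) < factorizing_function G A p" using enat by simp
      from bound[OF p this enat] show False by simp
    qed
  qed simp
  then show ?thesis using c triv unfolding A_def by blast
qed

section \<open>The classification\<close>

lemma enat_dist_le:
  assumes "a \<le> enat m + b" "b \<le> enat n + a"
  shows "enat_dist a b \<le> enat (m + n)"
  using assms by (cases a; cases b) (auto simp: enat_dist_def max_def)

lemma enat_dist_eq_0: "enat_dist a a = 0"
  by (simp add: enat_dist_def)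

lemma one_le_enat_dist: "a \<noteq> b \<Longrightarrow> 1 \<le> enat_dist a b"
  by (cases a; cases b) (auto simp: enat_dist_def max_def one_enat_def)

text \<open>A prime dividing neither \<open>c\<close> nor \<open>d\<close> gives equality of the
  values, and the finitely many remaining primes contribute finite distances.\<close>

lemma almost_equal_on_primesI:
  assumes c: "0 < c" "0 < d"
    and "\<And>p. prime p \<Longrightarrow> f p \<le> enat (multiplicity p c) + g p"
    and "\<And>p. prime p \<Longrightarrow> g p \<le> enat (multiplicity p d) + f p"
  shows "almost_equal_on_primes f g"
proof -
  let ?W = "prime_factors c \<union> prime_factors (d :: nat)"
  have dist: "enat_dist (f p) (g p) \<le> enat (multiplicity p c + multiplicity p d)" if "prime p" for p
    using enat_dist_le assms(3,4) that by blast
  have "enat_dist (f p) (g p) = 0" if "prime p" "p \<notin> ?W" for p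
  proof -
    have "multiplicity p c = 0" "multiplicity p d = 0"
      using that c by (auto simp: prime_factors_multiplicity)
    then show ?thesis using dist[OF that(1)] by (simp flip: zero_enat_def)
  qed
  then have "(\<Sum>\<^sub>\<infinity>p\<in>{p. prime p}. ennreal_of_enat (enat_dist (f p) (g p))) =
      (\<Sum>\<^sub>\<infinity>p\<in>?W. ennreal_of_enat (enat_dist (f p) (g p)))"
    by (intro infsum_cong_neutral) auto
  also have "\<dots> = (\<Sum>p\<in>?W. ennreal_of_enat (enat_dist (f p) (g p)))" by simp
  also have "\<dots> < \<infinity>"
  proof -
    have "ennreal_of_enat (enat_dist (f p) (g p)) < \<infinity>" if "p \<in> ?W" for p
    proof -
      have "prime p" using that by auto
      from dist[OF this] show ?thesis by (cases "enat_dist (f p) (g p)") (auto simp: ennreal_of_nat_eq_real_of_nat)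
    qed
    then show ?thesis unfolding infinity_ennreal_def by (subst ennreal_sum_less_top) auto
  qed
  finally show ?thesis by (simp add: almost_equal_on_primes_def)
qed

text \<open>Distances are natural numbers or infinite, so each nonzero summand is at least 1 and a
  finite sum has finitely many of them. A finite distance between different values excludes infinite
  values.\<close>

lemma almost_equal_on_primesD:
  assumes "almost_equal_on_primes f g"
  shows "finite {p. prime p \<and> f p \<noteq> g p}"
    and "prime p \<Longrightarrow> f p \<noteq> g p \<Longrightarrow> f p \<noteq> \<infinity> \<and> g p \<noteq> \<infinity>"
proof -
  let ?W = "{p. prime p \<and> f p \<noteq> g p}"
  let ?d = "\<lambda>p. ennreal_of_enat (enat_dist (f p) (g p))"
  have "infsum ?d {p. prime p} = infsum ?d ?W"
    by (rule infsum_cong_neutral) (auto simp: enat_dist_eq_0)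
  then have lt: "infsum ?d ?W < \<infinity>" using assms by (simp add: almost_equal_on_primes_def)
  have ge: "1 \<le> ?d p" if "p \<in> ?W" for p
  proof -
    have "1 \<le> enat_dist (f p) (g p)" using that one_le_enat_dist by simp
    then show ?thesis
      by (cases "enat_dist (f p) (g p)") (auto simp: one_enat_def)
  qed
  show fin: "finite ?W"
  proof (rule ccontr)
    assume "infinite ?W"
    then have "infsum ?d ?W = \<infinity>" using ge by (intro infsum_superconst_infinite_ennreal[where b = 1]) auto
    then show False using lt by simp
  qed
  show "f p \<noteq> \<infinity> \<and> g p \<noteq> \<infinity>" if p: "prime p" "f p \<noteq> g p"
  proof -
    have "?d p \<le> sum ?d ?W" using fin p by (intro member_le_sum) auto
    also have "\<dots> < \<infinity>" using lt fin by simp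
    finally have lt: "?d p < \<infinity>" .
    have "enat_dist (f p) (g p) \<noteq> \<infinity>"
    proof
      assume "enat_dist (f p) (g p) = \<infinity>"
      then show False using lt by simp
    qed
    then show ?thesis using p(2) by (cases "f p"; cases "g p") (auto simp: enat_dist_def)
  qed
qed

text \<open>The base charts agree because both have \<open>card S1\<close> integer coordinates, so
  only the blocks at primes have to be matched. Equal factorizing functions give literally the same
  model space.\<close>

lemma coarsely_isomorphic_of_finite_rank:
  fixes G1 :: "('a, 'c) monoid_scheme" and G2 :: "('b, 'd) monoid_scheme"
  assumes G1: "group G1" "countable (carrier G1)" "locally_finite_by_abelian G1"
    and G2: "group G2" "countable (carrier G2)" "locally_finite_by_abelian G2"
    and S1: "min_locally_finite_index_generators G1 S1" "finite S1"
    and S2: "min_locally_finite_index_generators G2 S2" "finite S2"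
    and card: "card S1 = card S2"
    and eq: "equal_on_primes (factorizing_function G1 (generate G1 S1)) (factorizing_function G2 (generate G2 S2)) \<or>
      0 < card S1 \<and> almost_equal_on_primes (factorizing_function G1 (generate G1 S1)) (factorizing_function G2 (generate G2 S2))"
  shows "coarsely_isomorphic G1 G2"
proof -
  define C where "C = (\<lambda>i::nat \<times> nat. if fst i = 0 \<and> snd i < card S1 then UNIV else {0::int})"
  define E where "E \<phi> = (\<lambda>i. if prime (fst i) \<and> enat (snd i) < \<phi> (fst i) then {0..<int (fst i)} else C i)"
    for \<phi> :: "nat \<Rightarrow> enat"
  define \<phi>1 where "\<phi>1 = factorizing_function G1 (generate G1 S1)"
  define \<phi>2 where "\<phi>2 = factorizing_function G2 (generate G2 S2)"
  have C0: "0 \<in> C i" for i by (simp add: C_def)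
  have Cf: "finite {i. C i \<noteq> {0}}"
    by (rule finite_subset[of _ "{0} \<times> {..<card S1}"]) (auto simp: C_def split: if_splits)
  have Cp: "C (p, k) = {0}" if "prime p" for p k using that by (auto simp: C_def)
  have S1': "S1 \<subseteq> carrier G1" "locally_finite_index G1 (generate G1 S1)"
    and S2': "S2 \<subseteq> carrier G2" "locally_finite_index G2 (generate G2 S2)"
    using S1(1) S2(1) by (auto simp: min_locally_finite_index_generators_def)
  obtain F1 where "coarse_chart G1 (generate G1 S1) F1 C"
    using group.min_generators_finite(2)[OF G1(1,3,2) S1] unfolding C_def by blast
  then obtain F1 where F1: "coarse_chart G1 (carrier G1) F1 (E \<phi>1)"
    using group.chart_locally_finite_extension[OF G1(1,3,2) S1(2) S1'(1) refl S1'(2) _ C0 Cf Cp]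
    unfolding E_def \<phi>1_def by blast
  obtain F2 where "coarse_chart G2 (generate G2 S2) F2 C"
    using group.min_generators_finite(2)[OF G2(1,3,2) S2] unfolding C_def card by blast
  then obtain F2 where F2: "coarse_chart G2 (carrier G2) F2 (E \<phi>2)"
    using group.chart_locally_finite_extension[OF G2(1,3,2) S2(2) S2'(1) refl S2'(2) _ C0 Cf Cp]
    unfolding E_def \<phi>2_def by blast
  show ?thesis
    using eq unfolding \<phi>1_def[symmetric] \<phi>2_def[symmetric]
  proof
    assume "equal_on_primes \<phi>1 \<phi>2"
    then have "E \<phi>1 = E \<phi>2" by (auto simp: E_def equal_on_primes_def fun_eq_iff)
    then show ?thesis using coarsely_isomorphic_of_charts[OF G1(1) G2(1) F1] F2 by simp
  next
    assume "0 < card S1 \<and> almost_equal_on_primes \<phi>1 \<phi>2"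
    then have r: "0 < card S1" and ae: "almost_equal_on_primes \<phi>1 \<phi>2" by auto
    define W where "W = {p. prime p \<and> \<phi>1 p \<noteq> \<phi>2 p}"
    have W: "finite W" using almost_equal_on_primesD(1)[OF ae] by (simp add: W_def)
    have Wf: "\<phi>1 p \<noteq> \<infinity>" "\<phi>2 p \<noteq> \<infinity>" if "p \<in> W" for p
      using almost_equal_on_primesD(2)[OF ae, of p] that by (auto simp: W_def)
    \<comment> \<open>Splitting an integer coordinate can only add finite ones, so both groups are
      raised to the common maximum.\<close>
    define m where "m p = max (\<phi>1 p) (\<phi>2 p)" for p
    have raise: "\<exists>F'. coarse_chart G K F' (E m)"
      if F: "coarse_chart G K F (E \<phi>)" and \<phi>: "\<And>p. \<phi> p \<le> m p" "\<And>p. prime p \<Longrightarrow> p \<notin> W \<Longrightarrow> \<phi> p = m p"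
      for G :: "('x, 'y) monoid_scheme" and K F \<phi>
    proof -
      define I where "I = {i. prime (fst i) \<and> \<phi> (fst i) \<le> enat (snd i) \<and> enat (snd i) < m (fst i)}"
      have "I \<subseteq> Sigma W (\<lambda>p. {..<the_enat (m p)})"
      proof
        fix i assume i: "i \<in> I"
        then have iW: "fst i \<in> W" using \<phi>(2)[of "fst i"] by (force simp: I_def)
        have "m (fst i) \<noteq> \<infinity>" using Wf[OF iW] by (simp add: m_def max_def)
        then obtain n where "m (fst i) = enat n" by auto
        then show "i \<in> Sigma W (\<lambda>p. {..<the_enat (m p)})" using i iW by (cases i) (auto simp: I_def)
      qed
      then have "finite I" using W by (auto intro: finite_subset)
      have "\<exists>F'. coarse_chart G K F' (\<lambda>i. if i \<in> I then {0..<int (fst i)} else E \<phi> i)"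
      \<comment> \<open>The integer coordinate \<open>(0, 0)\<close> pays for all missing positions.
        They are finitely many: they belong to the finite set \<open>W\<close> of primes, where both
        functions are finite.\<close>
      proof (rule chart_split_finite[OF \<open>finite I\<close> F])
        show "E \<phi> (0, 0) = UNIV" using r by (simp add: E_def C_def)
        show "(0, 0) \<notin> I" by (simp add: I_def)
        show "E \<phi> i = {0} \<and> 0 < int (fst i)" if "i \<in> I" for i
        proof -
          have p: "prime (fst i)" "\<phi> (fst i) \<le> enat (snd i)" using that by (auto simp: I_def)
          then have "E \<phi> i = {0}" using Cp[of "fst i" "snd i"] by (simp add: E_def)
          then show ?thesis using prime_gt_0_nat[OF p(1)] by simp
        qed
      qed
      moreover have "(if i \<in> I then {0..<int (fst i)} else E \<phi> i) = E m i" for i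
      proof (cases "i \<in> I")
        case True
        then show ?thesis by (simp add: I_def E_def)
      next
        case False
        then have "enat (snd i) < \<phi> (fst i) \<longleftrightarrow> enat (snd i) < m (fst i)" if p: "prime (fst i)"
        proof -
          have "\<not> (\<phi> (fst i) \<le> enat (snd i) \<and> enat (snd i) < m (fst i))"
            using False p by (simp add: I_def)
          then show ?thesis using order_less_le_trans[OF _ \<phi>(1)[of "fst i"]] not_le by blast
        qed
        then show ?thesis using False by (auto simp: E_def)
      qed
      ultimately show ?thesis by simp
    qed
    obtain F1' where F1': "coarse_chart G1 (carrier G1) F1' (E m)"
      using raise[OF F1] by (auto simp: m_def W_def)
    obtain F2' where F2': "coarse_chart G2 (carrier G2) F2' (E m)"
      using raise[OF F2] by (auto simp: m_def W_def)
    show ?thesis using coarsely_isomorphic_of_charts[OF G1(1) G2(1) F1' F2'] .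
  qed
qed

theorem theorem1p2:
  fixes G1 :: "('a, 'c) monoid_scheme" and G2 :: "('b, 'd) monoid_scheme"
    and S1 H1 :: "'a set" and S2 H2 :: "'b set"
  assumes "group G1" and "countable (carrier G1)" and "locally_finite_by_abelian G1"
    and "group G2" and "countable (carrier G2)" and "locally_finite_by_abelian G2"
    and "min_locally_finite_index_generators G1 S1" and "H1 = generate G1 S1"
    and "min_locally_finite_index_generators G2 S2" and "H2 = generate G2 S2"
  shows "coarsely_isomorphic G1 G2 \<longleftrightarrow>
      (free_rank G1 = \<infinity> \<and> free_rank G2 = \<infinity>) \<or>
      (free_rank G1 = 0 \<and> free_rank G2 = 0 \<and>
         equal_on_primes (factorizing_function G1 H1) (factorizing_function G2 H2)) \<or>
      (0 < free_rank G1 \<and> free_rank G1 = free_rank G2 \<and> free_rank G2 < \<infinity> \<and>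
         almost_equal_on_primes (factorizing_function G1 H1) (factorizing_function G2 H2))"
    (is "?iso \<longleftrightarrow> ?inf \<or> ?zero \<or> ?fin")
proof -
  note G1 = assms(1-3) and G2 = assms(4-6)
  note H1 = assms(8) and H2 = assms(10)
  have S1: "S1 \<subseteq> carrier G1" "locally_finite_index G1 (generate G1 S1)"
    and S2: "S2 \<subseteq> carrier G2" "locally_finite_index G2 (generate G2 S2)"
    using assms(7,9) by (auto simp: min_locally_finite_index_generators_def)
  have r1: "free_rank G1 = (if finite S1 then enat (card S1) else \<infinity>)"
    using group.min_generators_finite(1)[OF G1(1,3,2) assms(7)]
      group.min_generators_infinite(1)[OF G1(1,3) assms(7)] by simp
  have r2: "free_rank G2 = (if finite S2 then enat (card S2) else \<infinity>)"
    using group.min_generators_finite(1)[OF G2(1,3,2) assms(9)]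
      group.min_generators_infinite(1)[OF G2(1,3) assms(9)] by simp
  have "?inf \<or> ?zero \<or> ?fin" if iso: ?iso
  proof -
    obtain f where f: "coarse_isomorphism G1 G2 f" using iso by (auto simp: coarsely_isomorphic_def)
    note f' = coarse_isomorphism_sym[OF G1(1) f]
    have r: "free_rank G1 = free_rank G2"
      using free_rank_le_of_coarsely_isomorphic[OF G1(1) G2 assms(9) f]
        free_rank_le_of_coarsely_isomorphic[OF G2(1) G1 assms(7) f'] by (rule antisym)
    show ?thesis
    proof (cases "finite S1")
      case False
      then show ?thesis using r r1 by simp
    next
      case True
      then have fS2: "finite S2" using r r1 r2 by (auto split: if_splits)
      have card: "card S1 = card S2" using True fS2 r r1 r2 by simp
      have "\<exists>c>0. (S1 = {} \<and> S2 = {} \<longrightarrow> c = 1) \<and> (\<forall>p. prime p \<longrightarrow>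
          factorizing_function G1 H1 p \<le> enat (multiplicity p c) + factorizing_function G2 H2 p)"
        unfolding H1 H2
        by (rule factorizing_function_le_of_coarse_isomorphism[OF G1(1) G2(1) G1(3) G2(3) f True S1 fS2 S2])
      then obtain c where c: "0 < c" "S1 = {} \<and> S2 = {} \<longrightarrow> c = 1"
        "\<forall>p. prime p \<longrightarrow> factorizing_function G1 H1 p \<le> enat (multiplicity p c) + factorizing_function G2 H2 p"
        by (elim exE conjE)
      have "\<exists>d>0. (S2 = {} \<and> S1 = {} \<longrightarrow> d = 1) \<and> (\<forall>p. prime p \<longrightarrow>
          factorizing_function G2 H2 p \<le> enat (multiplicity p d) + factorizing_function G1 H1 p)"
        unfolding H1 H2
        by (rule factorizing_function_le_of_coarse_isomorphism[OF G2(1) G1(1) G2(3) G1(3) f' fS2 S2 True S1])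
      then obtain d where d: "0 < d" "S2 = {} \<and> S1 = {} \<longrightarrow> d = 1"
        "\<forall>p. prime p \<longrightarrow> factorizing_function G2 H2 p \<le> enat (multiplicity p d) + factorizing_function G1 H1 p"
        by (elim exE conjE)
      show ?thesis
      proof (cases "card S1 = 0")
        case True
        then have "S1 = {}" "S2 = {}" using \<open>finite S1\<close> fS2 card by auto
        \<comment> \<open>In rank zero both subgroups are trivial, so the error terms
          \<open>multiplicity p c\<close> and \<open>multiplicity p d\<close> vanish and the two
          inequalities give equality.\<close>
        then have "c = 1" "d = 1" using c(2) d(2) by auto
        then have "equal_on_primes (factorizing_function G1 H1) (factorizing_function G2 H2)"
          unfolding equal_on_primes_def using c(3) d(3) by (auto intro: antisym simp flip: zero_enat_def)
        then show ?thesis using True \<open>finite S1\<close> r1 r by (simp add: zero_enat_def)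
      next
        case False
        have "almost_equal_on_primes (factorizing_function G1 H1) (factorizing_function G2 H2)"
          using almost_equal_on_primesI[OF c(1) d(1) c(3)[rule_format] d(3)[rule_format]] .
        then show ?thesis using False \<open>finite S1\<close> r1 r by (simp add: zero_enat_def card_gt_0_iff)
      qed
    qed
  qed
  moreover have ?iso if ?inf
  proof -
    have inf: "infinite S1" "infinite S2" using that r1 r2 by (auto split: if_splits)
    obtain F1 where F1: "coarse_chart G1 (carrier G1) F1 (\<lambda>i::nat \<times> nat. if fst i = 0 then UNIV else {0})"
      using group.chart_infinite_rank[OF G1(1,3,2)]
        group.min_generators_infinite(2)[OF G1(1,3) assms(7) inf(1)] by blast
    obtain F2 where F2: "coarse_chart G2 (carrier G2) F2 (\<lambda>i::nat \<times> nat. if fst i = 0 then UNIV else {0})"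
      using group.chart_infinite_rank[OF G2(1,3,2)]
        group.min_generators_infinite(2)[OF G2(1,3) assms(9) inf(2)] by blast
    show ?thesis using coarsely_isomorphic_of_charts[OF G1(1) G2(1) F1 F2] .
  qed
  moreover have ?iso if "?zero \<or> ?fin"
  proof -
    have fin: "finite S1" "finite S2" "card S1 = card S2"
      using that r1 r2 by (auto split: if_splits simp: zero_enat_def)
    have "equal_on_primes (factorizing_function G1 H1) (factorizing_function G2 H2) \<or>
      0 < card S1 \<and> almost_equal_on_primes (factorizing_function G1 H1) (factorizing_function G2 H2)"
      using that r1 fin(1) by (auto simp: zero_enat_def)
    then show ?thesis
      using coarsely_isomorphic_of_finite_rank[OF G1 G2 assms(7) fin(1) assms(9) fin(2,3)] unfolding H1 H2 by blast
  qed
  ultimately show ?thesis by blast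
qed

end
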